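(* The eigenvalues of the transition matrix $P$ of the biased random transposition shuffle are $$\frac{a^2|A|+b^2|B|}{N^2}+\frac{2(a^2-ab)}{N^2}\operatorname{Diag}(\mu)+\frac{2(b^2-ab)}{N^2}\operatorname{Diag}(\nu)+\frac{2ab}{N^2}\operatorname{Diag}(\lambda),$$ with multiplicities $f_\lambda f_\mu f_\nu c^{\lambda}_{\mu,\nu}$, for all partitions $\lambda\vdash N$, $\mu\vdash|A|$, $\nu\vdash|B|$ (that is, the multiset of eigenvalues of $P$ is obtained by taking, for each triple $(\lambda,\mu,\nu)$, the displayed number $f_\lambda f_\mu f_\nu c^{\lambda}_{\mu,\nu}$ times).
   Context: Let $N=2n$, $[N]=A\sqcup B$ with $|A|=|B|=n$, and fix real numbers $0<b\le a$ with $a+b=2$. The biased random transposition shuffle is the random walk on $\mathfrak S_N$ in which at each step two cards of $[N]$ are chosen independently, each card of $A$ with probability $a/N$ and each card of $B$ with probability $b/N$, and swapped (nothing happens if they coincide). Its transition matrix $P=(P(x,y))_{x,y\in\mathfrak S_N}$ is: $P(x,y)=\frac{2a^2}{N^2}$ if $yx^{-1}$ is a transposition of two elements of $A$; $\frac{2b^2}{N^2}$ if $yx^{-1}$ is a transposition of two elements of $B$; $\frac{2ab}{N^2}$ if $yx^{-1}$ is a transposition of an element of $A$ with an element of $B$; $\frac{a^2|A|+b^2|B|}{N^2}$ if $y=x$; and $0$ otherwise. For a partition $\lambda=(\lambda_1\ge\lambda_2\ge\cdots)$, $\lambda^*$ is the conjugate partition and $\operatorname{Diag}(\lambda)=\sum_i\binom{\lambda_i}{2}-\sum_i\binom{\lambda_i^*}{2}$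 (equivalently $\sum_{(i,j)\in\lambda}(j-i)$ over boxes in row $i$, column $j$). $f_\lambda$ is the number of standard Young tableaux of shape $\lambda$. The Littlewood–Richardson coefficient $c^\lambda_{\mu,\nu}$ is the number of semistandard fillings of the skew shape $\lambda/\mu$ with content $\nu$ such that in every prefix of the word obtained by reading rows right to left, from top to bottom, the number of $i$'s is at least the number of $(i+1)$'s for all $i$ (and $c^\lambda_{\mu,\nu}=0$ if there are none or if $\mu\not\subseteq\lambda$). *)

theory Defs
  imports
    "HOL-Combinatorics.Permutations"
    "HOL-Library.FuncSet"
    "Jordan_Normal_Form.Char_Poly"
begin

section \<open>The biased random transposition shuffle\<close>

text \<open>
  The permutations in question are those of \<open>{1..N}\<close>, extended by the identity to all of
  \<open>nat\<close> (the library predicate \<open>permutes\<close>). \<open>Transposition.transpose\<close> is qualified because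
  \<open>transpose\<close> alone may denote other constants.
\<close>

definition is_transposition_between :: "nat set \<Rightarrow> nat set \<Rightarrow> (nat \<Rightarrow> nat) \<Rightarrow> bool" where
  "is_transposition_between S T \<sigma> \<longleftrightarrow>
     (\<exists>i\<in>S. \<exists>j\<in>T. i \<noteq> j \<and> \<sigma> = Transposition.transpose i j)"

definition shuffle_prob ::
  "nat set \<Rightarrow> nat set \<Rightarrow> real \<Rightarrow> real \<Rightarrow> (nat \<Rightarrow> nat) \<Rightarrow> (nat \<Rightarrow> nat) \<Rightarrow> real" where
  "shuffle_prob A B a b x y =
     (let N = real (card A + card B); \<sigma> = y \<circ> inv_into UNIV x in
      if is_transposition_between A A \<sigma> then 2 * a\<^sup>2 / N\<^sup>2
      else if is_transposition_between B B \<sigma> then 2 * b\<^sup>2 / N\<^sup>2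
      else if is_transposition_between A B \<sigma> then 2 * a * b / N\<^sup>2
      else if y = x then (a\<^sup>2 * real (card A) + b\<^sup>2 * real (card B)) / N\<^sup>2
      else 0)"

text \<open>
  The transition matrix with rows and columns indexed through a list \<open>ps\<close> enumerating the
  states.
\<close>

definition shuffle_matrix ::
  "nat set \<Rightarrow> nat set \<Rightarrow> real \<Rightarrow> real \<Rightarrow> (nat \<Rightarrow> nat) list \<Rightarrow> real mat" where
  "shuffle_matrix A B a b ps =
     mat (length ps) (length ps) (\<lambda>(r, s). shuffle_prob A B a b (ps ! r) (ps ! s))"

text \<open>
  The multiset of all complex eigenvalues of a real square matrix, with algebraic
  multiplicities. (The matrices above are symmetric, so for them algebraic and geometric
  multiplicities agree.)
\<close>

definition eigenvalue_mset :: "real mat \<Rightarrow> complex multiset" where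
  "eigenvalue_mset M = proots (char_poly (map_mat complex_of_real M))"


section \<open>Partitions and tableaux\<close>

text \<open>
  A partition is the list of its positive parts in weakly decreasing order. Rows and columns
  are numbered from \<open>0\<close>; tableau entries start from \<open>1\<close>.
\<close>

definition partitions_of :: "nat \<Rightarrow> nat list set" where
  "partitions_of n = {l. sorted_wrt (\<ge>) l \<and> (\<forall>p\<in>set l. 0 < p) \<and> sum_list l = n}"

definition part :: "nat list \<Rightarrow> nat \<Rightarrow> nat" where
  "part l i = (if i < length l then l ! i else 0)"

definition cells :: "nat list \<Rightarrow> (nat \<times> nat) set" where
  "cells l = {(i, j). i < length l \<and> j < part l i}"

definition conj_partition :: "nat list \<Rightarrow> nat list" where
  "conj_partition l = map (\<lambda>j. length (filter (\<lambda>p. j < p) l)) [0..<part l 0]"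

definition Diag :: "nat list \<Rightarrow> int" where
  "Diag l = (\<Sum>p\<leftarrow>l. int (p choose 2)) - (\<Sum>p\<leftarrow>conj_partition l. int (p choose 2))"

text \<open>
  Fillings are functions on cells that are \<open>undefined\<close> outside the shape, so that counting
  functions counts fillings.
\<close>

definition standard_tableaux :: "nat list \<Rightarrow> (nat \<times> nat \<Rightarrow> nat) set" where
  "standard_tableaux l =
     {T \<in> extensional (cells l).
        bij_betw T (cells l) {1..sum_list l} \<and>
        (\<forall>i j j'. (i, j) \<in> cells l \<and> (i, j') \<in> cells l \<and> j < j' \<longrightarrow> T (i, j) < T (i, j')) \<and>
        (\<forall>i i' j. (i, j) \<in> cells l \<and> (i', j) \<in> cells l \<and> i < i' \<longrightarrow> T (i, j) < T (i', j))}"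

definition num_SYT :: "nat list \<Rightarrow> nat" where
  "num_SYT l = card (standard_tableaux l)"

text \<open>Semistandard fillings of the skew shape \<open>l / m\<close> with content \<open>v\<close>.\<close>

definition skew_tableaux :: "nat list \<Rightarrow> nat list \<Rightarrow> nat list \<Rightarrow> (nat \<times> nat \<Rightarrow> nat) set" where
  "skew_tableaux l m v =
     (let S = cells l - cells m in
      {T \<in> S \<rightarrow>\<^sub>E {1..length v}.
        (\<forall>i j j'. (i, j) \<in> S \<and> (i, j') \<in> S \<and> j < j' \<longrightarrow> T (i, j) \<le> T (i, j')) \<and>
        (\<forall>i i' j. (i, j) \<in> S \<and> (i', j) \<in> S \<and> i < i' \<longrightarrow> T (i, j) < T (i', j)) \<and>
        (\<forall>k\<in>{1..length v}. card {c \<in> S. T c = k} = v ! (k - 1))})"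

text \<open>Rows are read right to left, from the top row to the bottom row.\<close>

definition reading_word :: "nat list \<Rightarrow> nat list \<Rightarrow> (nat \<times> nat \<Rightarrow> nat) \<Rightarrow> nat list" where
  "reading_word l m T =
     concat (map (\<lambda>i. map (\<lambda>j. T (i, j)) (rev [part m i..<part l i])) [0..<length l])"

definition lattice_word :: "nat list \<Rightarrow> bool" where
  "lattice_word w \<longleftrightarrow>
     (\<forall>k\<le>length w. \<forall>i\<ge>1. count_list (take k w) (Suc i) \<le> count_list (take k w) i)"

definition LR_coeff :: "nat list \<Rightarrow> nat list \<Rightarrow> nat list \<Rightarrow> nat" where
  "LR_coeff l m v =
     (if cells m \<subseteq> cells l
      then card {T \<in> skew_tableaux l m v. lattice_word (reading_word l m T)}
      else 0)"


section \<open>Finiteness of the sets that are counted or summed over\<close>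

lemma finite_cells: "finite (cells l)"
proof -
  have "cells l = (SIGMA i:{..<length l}. {..<part l i})"
    by (auto simp: cells_def)
  then show ?thesis by simp
qed

lemma finite_standard_tableaux: "finite (standard_tableaux l)"
proof (rule finite_subset)
  show "standard_tableaux l \<subseteq> cells l \<rightarrow>\<^sub>E {1..sum_list l}"
    unfolding standard_tableaux_def PiE_def by (auto dest: bij_betwE)
  show "finite (cells l \<rightarrow>\<^sub>E {1..sum_list l})"
    by (intro finite_PiE finite_cells) simp
qed

lemma finite_skew_tableaux: "finite (skew_tableaux l m v)"
proof (rule finite_subset)
  show "skew_tableaux l m v \<subseteq> (cells l - cells m) \<rightarrow>\<^sub>E {1..length v}"
    by (auto simp: skew_tableaux_def Let_def)
  show "finite ((cells l - cells m) \<rightarrow>\<^sub>E {1..length v})"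
    by (intro finite_PiE finite_Diff finite_cells) simp
qed

lemma finite_partitions_of: "finite (partitions_of n)"
proof (rule finite_subset)
  have len: "length l \<le> sum_list l" if "\<forall>p\<in>set l. 0 < p" for l :: "nat list"
    using that by (induction l) auto
  show "partitions_of n \<subseteq> {l. set l \<subseteq> {..n} \<and> length l \<le> n}"
    using len by (auto simp: partitions_of_def member_le_sum_list)
  show "finite {l. set l \<subseteq> {..n} \<and> length l \<le> n}"
    by (rule finite_lists_length_le) simp
qed

end

theory Submission
  imports Defs "Jordan_Normal_Form.Schur_Decomposition"
begin

text \<open>
  \<open>P\<close> is multiplication by \<open>c + \<alpha> T\<^sub>A + \<beta> T\<^sub>B + \<gamma> T\<^sub>N\<close>, where \<open>T\<^sub>X\<close> is the sum of all
  transpositions of \<open>X\<close>, so its eigenvalues are determined by the traces of its powers, that is, by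
  the coefficients of the identity in the powers of this element. The indicator of the identity is
  \<open>\<Sum>\<^sub>\<lambda> f\<^sub>\<lambda> \<chi>\<^sup>\<lambda> / N!\<close>; each \<open>\<chi>\<^sup>\<lambda>\<close> is an eigenfunction of \<open>T\<^sub>N\<close> with eigenvalue \<open>Diag \<lambda>\<close>, and on the
  subgroup of the permutations preserving \<open>A\<close> and \<open>B\<close> it splits as
  \<open>\<Sum> c\<^sup>\<lambda>\<^sub>\<mu>\<^sub>\<nu> \<chi>\<^sup>\<mu> \<otimes> \<chi>\<^sup>\<nu>\<close>, on whose summands \<open>T\<^sub>A\<close> and \<open>T\<^sub>B\<close> act by \<open>Diag \<mu>\<close> and \<open>Diag \<nu>\<close>.

  The characters are defined by Frobenius' formula: \<open>\<chi>\<^sup>\<lambda>(\<sigma>)\<close> is the coefficient of the alternant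
  \<open>a\<^bsub>\<lambda>+\<delta>\<^esub>\<close> in \<open>p\<^sub>\<sigma> a\<^sub>\<delta>\<close>, where \<open>p\<^sub>\<sigma>\<close> sums the monomials of all words fixed by \<open>\<sigma>\<close>. Polynomial identities
  are proved pointwise at generic real points. The product rule for alternants and Schur polynomials
  is Stembridge's cancellation of Bender--Knuth type, carried out on Gelfand--Tsetlin patterns, where
  the Bender--Knuth involution becomes \<open>x \<mapsto> lo + hi - x\<close> in every entry of a layer.
\<close>

unbundle no m_inv_syntax

section \<open>Alternants\<close>

text \<open>The obstacle is that \<open>T\<^sub>N\<close> maps out of the subgroup on which the
  characters split, so powers of the element cannot be computed inside the subgroup. But
  \<open>T\<^sub>N\<close> commutes with the whole walk operator; it is therefore traded for its
  scalar on the full group, and only the result is restricted. What remains are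
  \<open>T\<^sub>A\<close> and \<open>T\<^sub>B\<close>, which preserve the subgroup and act on one
  factor each. Every diagonal entry of a power of \<open>P\<close> is the same coefficient of the
  identity, so the trace carries a factor \<open>N!\<close>, which cancels the denominator in the
  expansion of the indicator. A pointwise identity cannot be divided by the Vandermonde alternant
  where that vanishes, while the Schur expansion of \<open>p\<^sub>\<sigma>\<close> is needed at
  every point and also coefficient by coefficient. Cancellation is therefore done by comparing
  coefficients after a substitution that turns distinct monomials into distinct powers of one
  variable. The number of variables is \<open>N\<close> for all three groups at once, enough for
  every partition of the three sizes to occur.\<close>

definition xpow :: "nat \<Rightarrow> (nat \<Rightarrow> nat) \<Rightarrow> (nat \<Rightarrow> real) \<Rightarrow> real" where
  "xpow m b x = (\<Prod>k<m. x k ^ b k)"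

text \<open>The Leibniz expansion of the determinant with entries \<open>x j ^ b k\<close>.\<close>

definition alternant :: "nat \<Rightarrow> (nat \<Rightarrow> nat) \<Rightarrow> (nat \<Rightarrow> real) \<Rightarrow> real" where
  "alternant m b x = (\<Sum>u | u permutes {..<m}. of_int (sign u) * xpow m b (x \<circ> u))"

text \<open>Distinctness allows division by the differences \<open>x c - x d\<close>. All points
  \<open>x k = t ^ (M ^ k)\<close> with \<open>1 < t\<close> and \<open>2 \<le> M\<close> qualify,
  which is what the substitution argument needs.\<close>

definition generic :: "nat \<Rightarrow> (nat \<Rightarrow> real) \<Rightarrow> bool" where
  "generic m x \<longleftrightarrow> (\<forall>k<m. 0 < x k) \<and> inj_on x {..<m}"

definition staircase :: "nat \<Rightarrow> nat \<Rightarrow> nat" where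
  "staircase m k = m - 1 - k"

text \<open>Partitions of \<open>n\<close> with at most \<open>m\<close> parts, as functions padded
  with zeros: adding the staircase, enlarging one row and comparing are then pointwise
  operations.\<close>

definition Par :: "nat \<Rightarrow> nat \<Rightarrow> (nat \<Rightarrow> nat) set" where
  "Par m n = {f. (\<forall>k. f (Suc k) \<le> f k) \<and> (\<forall>k\<ge>m. f k = 0) \<and> (\<Sum>k<m. f k) = n}"

abbreviation fadd :: "(nat \<Rightarrow> nat) \<Rightarrow> (nat \<Rightarrow> nat) \<Rightarrow> nat \<Rightarrow> nat" (infixl "\<boxplus>" 65) where
  "b \<boxplus> c \<equiv> \<lambda>k. b k + c k"

abbreviation "swp \<equiv> Transposition.transpose"

lemma finite_perms [simp]: "finite {u. u permutes {..<m::nat}}"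
  by (simp add: finite_permutations)

lemma xpow_cong: "(\<And>k. k < m \<Longrightarrow> b k = c k) \<Longrightarrow> (\<And>k. k < m \<Longrightarrow> x k = y k) \<Longrightarrow> xpow m b x = xpow m c y"
  unfolding xpow_def by (intro prod.cong) auto

lemma xpow_add: "xpow m (b \<boxplus> c) x = xpow m b x * xpow m c x"
  unfolding xpow_def by (simp add: power_add prod.distrib)

lemma xpow_perm: "u permutes {..<m} \<Longrightarrow> xpow m (b \<circ> u) (x \<circ> u) = xpow m b x"
  unfolding xpow_def using prod.permute[of u "{..<m}" "\<lambda>k. x k ^ b k"] by (simp add: o_def)

lemma xpow_perm': "u permutes {..<m} \<Longrightarrow> xpow m b (x \<circ> u) = xpow m (b \<circ> inv u) x"
  using xpow_perm[of u m "b \<circ> inv u" x] by (simp add: o_assoc permutes_inv_o comp_assoc)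

lemma alternant_cong: "(\<And>k. k < m \<Longrightarrow> b k = c k) \<Longrightarrow> alternant m b x = alternant m c x"
  unfolding alternant_def by (intro sum.cong refl arg_cong2[where f="(*)"] xpow_cong) auto

lemma sign_mult_sign_real: "(of_int (sign v) :: real) * of_int (sign v) = 1"
  by (metis of_int_1 of_int_mult sign_idempotent)

lemma alternant_perm_var:
  assumes "v permutes {..<m}"
  shows "alternant m b (x \<circ> v) = of_int (sign v) * alternant m b x"
proof -
  have "of_int (sign v) * alternant m b x = (\<Sum>u | u permutes {..<m}. of_int (sign v) * (of_int (sign (v \<circ> u)) * xpow m b (x \<circ> (v \<circ> u))))"
    unfolding alternant_def sum_distrib_left
    by (subst setum_permutations_compose_left[OF assms]) simp
  also have "\<dots> = alternant m b (x \<circ> v)"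
    unfolding alternant_def
  proof (intro sum.cong refl)
    fix u assume "u \<in> {u. u permutes {..<m}}"
    then have "sign (v \<circ> u) = sign v * sign u"
      using assms by (intro sign_compose) (auto intro: permutes_imp_permutation[of "{..<m}"])
    then show "real_of_int (sign v) * (of_int (sign (v \<circ> u)) * xpow m b (x \<circ> (v \<circ> u))) =
        of_int (sign u) * xpow m b (x \<circ> v \<circ> u)"
      using sign_mult_sign_real[of v] by (simp add: o_assoc mult.assoc[symmetric])
  qed
  finally show ?thesis by simp
qed

lemma alternant_perm_exp:
  assumes "v permutes {..<m}"
  shows "alternant m (b \<circ> v) x = of_int (sign v) * alternant m b x"
proof -
  have "alternant m (b \<circ> v) (x \<circ> inv v \<circ> v) = (\<Sum>u | u permutes {..<m}. of_int (sign u) * xpow m (b \<circ> v) (x \<circ> u))"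
    unfolding alternant_def using assms by (simp add: comp_assoc permutes_inv_o)
  also have "\<dots> = (\<Sum>u | u permutes {..<m}. of_int (sign (u \<circ> v)) * xpow m (b \<circ> v) (x \<circ> (u \<circ> v)))"
    by (subst sum_permutations_compose_right[OF assms]) simp
  also have "\<dots> = (\<Sum>u | u permutes {..<m}. of_int (sign v) * (of_int (sign u) * xpow m b (x \<circ> u)))"
  proof (intro sum.cong refl)
    fix u assume "u \<in> {u. u permutes {..<m}}"
    then have "sign (u \<circ> v) = sign u * sign v"
      using assms by (intro sign_compose) (auto intro: permutes_imp_permutation[of "{..<m}"])
    then show "real_of_int (sign (u \<circ> v)) * xpow m (b \<circ> v) (x \<circ> (u \<circ> v)) =
        of_int (sign v) * (of_int (sign u) * xpow m b (x \<circ> u))"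
      using xpow_perm[OF assms, of b "x \<circ> u"] by (simp add: o_assoc)
  qed
  finally show ?thesis using assms
    by (simp add: comp_assoc permutes_inv_o alternant_def sum_distrib_left)
qed

lemma alternant_transpose:
  assumes "i < m" "j < m" "i \<noteq> j" "c i = b j" "c j = b i" "\<And>k. k < m \<Longrightarrow> k \<noteq> i \<Longrightarrow> k \<noteq> j \<Longrightarrow> c k = b k"
  shows "alternant m c x = - alternant m b x"
proof -
  have "alternant m c x = alternant m (b \<circ> swp i j) x"
    using assms by (intro alternant_cong) (auto simp: Transposition.transpose_def)
  also have "\<dots> = of_int (sign (swp i j)) * alternant m b x"
    using assms by (intro alternant_perm_exp permutes_swap_id) auto
  finally show ?thesis using assms by (simp add: sign_swap_id)
qed

lemma alternant_eq_0:
  assumes "\<not> inj_on b {..<m}"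
  shows "alternant m b x = 0"
proof -
  obtain i j where "i < m" "j < m" "i \<noteq> j" "b i = b j"
    using assms by (auto simp: inj_on_def)
  then have "alternant m b x = - alternant m b x"
    by (intro alternant_transpose[of i m j]) auto
  then show ?thesis by simp
qed

text \<open>Symmetry allows \<open>F x\<close> to be replaced by \<open>F (x \<circ> u)\<close> in
  the term of \<open>u\<close>, where it multiplies \<open>xpow m b (x \<circ> u)\<close>; every
  monomial of \<open>F\<close> then merely shifts the exponent.\<close>

lemma symmetric_times_alternant:
  assumes F: "\<And>x. F x = (\<Sum>t\<in>S. xpow m (g t) x)"
    and sym: "\<And>u x. u permutes {..<m} \<Longrightarrow> F (x \<circ> u) = F x"
  shows "F x * alternant m b x = (\<Sum>t\<in>S. alternant m (b \<boxplus> g t) x)"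
proof -
  have "F x * alternant m b x = (\<Sum>u | u permutes {..<m}. of_int (sign u) * (F (x \<circ> u) * xpow m b (x \<circ> u)))"
    unfolding alternant_def sum_distrib_left by (intro sum.cong) (auto simp: sym)
  also have "\<dots> = (\<Sum>u | u permutes {..<m}. \<Sum>t\<in>S. of_int (sign u) * xpow m (b \<boxplus> g t) (x \<circ> u))"
    by (simp add: F sum_distrib_left sum_distrib_right xpow_add mult_ac)
  also have "\<dots> = (\<Sum>t\<in>S. alternant m (b \<boxplus> g t) x)"
    unfolding alternant_def by (rule sum.swap)
  finally show ?thesis .
qed

section \<open>Linear independence of monomials and of alternants\<close>

definition kron :: "nat \<Rightarrow> nat \<Rightarrow> (nat \<Rightarrow> nat) \<Rightarrow> nat" where
  "kron M m b = (\<Sum>k<m. b k * M ^ k)"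

lemma kron_less: "(\<And>k. k < m \<Longrightarrow> b k < M) \<Longrightarrow> kron M m b < M ^ m"
proof (induction m)
  case (Suc m)
  have "kron M m b < M ^ m" using Suc by auto
  moreover have "Suc (b m) * M ^ m \<le> M * M ^ m" using Suc.prems[of m] by (intro mult_right_mono) auto
  ultimately show ?case by (simp add: kron_def)
qed (simp add: kron_def)

lemma kron_inj:
  "(\<And>k. k < m \<Longrightarrow> b k < M) \<Longrightarrow> (\<And>k. k < m \<Longrightarrow> c k < M) \<Longrightarrow> kron M m b = kron M m c \<Longrightarrow> k < m \<Longrightarrow> b k = c k"
proof (induction m)
  case (Suc m)
  have lt: "kron M m b < M ^ m" "kron M m c < M ^ m" using Suc.prems by (auto intro!: kron_less)
  have eq: "kron M m b + b m * M ^ m = kron M m c + c m * M ^ m"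
    using Suc.prems(3) by (simp add: kron_def)
  have "(kron M m b + b m * M ^ m) div M ^ m = b m" "(kron M m c + c m * M ^ m) div M ^ m = c m"
    using lt by (cases "M ^ m = 0"; simp add: div_add1_eq)+
  with eq have "b m = c m" by simp
  moreover from this eq have "kron M m b = kron M m c" by simp
  ultimately show ?case using Suc.IH Suc.prems by (cases "k = m") auto
qed simp

lemma xpow_kron: "xpow m b (\<lambda>k. t ^ (M ^ k)) = t ^ kron M m b"
  unfolding xpow_def kron_def by (simp add: power_sum power_mult[symmetric] mult.commute)

lemma generic_powers: "1 < t \<Longrightarrow> 2 \<le> M \<Longrightarrow> generic m (\<lambda>k. t ^ (M ^ k))"
  unfolding generic_def by (auto intro!: inj_onI)

lemma poly_eq_0_if_zero_above_1:
  assumes "\<And>t. 1 < t \<Longrightarrow> poly p (t::real) = 0"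
  shows "p = 0"
proof (rule ccontr)
  assume "p \<noteq> 0"
  then have "finite {t. poly p t = 0}" by (rule poly_roots_finite)
  moreover have "{1<..} \<subseteq> {t. poly p t = 0}" using assms by auto
  ultimately show False using infinite_Ioi[of "1::real"] finite_subset by blast
qed

text \<open>Kronecker substitution \<open>x\<^sub>k = t ^ (M ^ k)\<close> reduces to polynomials in one variable.\<close>

lemma monomials_times_alternant_independent:
  assumes S: "finite S"
    and sep: "\<And>s s'. s \<in> S \<Longrightarrow> s' \<in> S \<Longrightarrow> (\<And>k. k < m \<Longrightarrow> g s k = g s' k) \<Longrightarrow> s = s'"
    and d: "inj_on d {..<m}"
    and zero: "\<And>x. generic m x \<Longrightarrow> (\<Sum>s\<in>S. f s * xpow m (g s) x) * alternant m d x = 0"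
    and "s \<in> S"
  shows "f s = 0"
proof -
  \<comment> \<open>Larger than every exponent occurring in the \<open>g s\<close> and in
    \<open>d\<close>, so that all of them are digits in base \<open>M\<close>; the second
    \<open>Suc\<close> secures \<open>2 \<le> M\<close>.\<close>
  define M where "M = Suc (Suc (Max (insert 0 ((\<lambda>(s, k). g s k) ` (S \<times> {..<m}) \<union> d ` {..<m}))))"
  have fin: "finite (insert 0 ((\<lambda>(s, k). g s k) ` (S \<times> {..<m}) \<union> d ` {..<m}))" using S by auto
  have M: "2 \<le> M" by (simp add: M_def)
  have gM: "g s k < M" if "s \<in> S" "k < m" for s k
    using Max_ge[OF fin, of "g s k"] that unfolding M_def by force
  have dM: "d k < M" if "k < m" for k
    using Max_ge[OF fin, of "d k"] that unfolding M_def by force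
  define U where "U = {u. u permutes {..<m}}"
  define P where "P = (\<Sum>s\<in>S. monom (f s) (kron M m (g s)))"
  define Q where "Q = (\<Sum>u\<in>U. monom (of_int (sign u) :: real) (kron M m (d \<circ> inv u)))"
  have "P * Q = 0"
  proof (rule poly_eq_0_if_zero_above_1)
    fix t :: real assume t: "1 < t"
    let ?x = "\<lambda>k. t ^ (M ^ k)"
    have "poly P t = (\<Sum>s\<in>S. f s * xpow m (g s) ?x)"
      by (simp add: P_def poly_sum poly_monom xpow_kron)
    moreover have "poly Q t = alternant m d ?x"
      unfolding Q_def alternant_def U_def poly_sum
      by (intro sum.cong refl) (simp add: poly_monom xpow_perm' xpow_kron)
    ultimately show "poly (P * Q) t = 0" using zero[OF generic_powers[OF t M]] by simp
  qed
  \<comment> \<open>The exponent of the identity permutation is attained by no other term: equal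
    digit expansions give \<open>d \<circ> inv u = d\<close> on \<open>{..<m}\<close>, and
    \<open>d\<close> is injective there.\<close>
  moreover have "Q \<noteq> 0"
  proof
    assume "Q = 0"
    have "coeff Q (kron M m d) = (\<Sum>u\<in>U. if u = id then 1 else 0)"
      unfolding Q_def coeff_sum
    proof (intro sum.cong refl)
      fix u assume u: "u \<in> U"
      show "coeff (monom (of_int (sign u) :: real) (kron M m (d \<circ> inv u))) (kron M m d) = (if u = id then 1 else 0)"
      proof (cases "kron M m (d \<circ> inv u) = kron M m d")
        case True
        have iu: "inv u permutes {..<m}" using u by (simp add: U_def permutes_inv)
        have "inv u k = k" for k
        proof (cases "k < m")
          case True2: True
          have "(d \<circ> inv u) k = d k"
            by (rule kron_inj[OF _ _ True True2])
              (use dM permutes_in_image[OF iu] in auto)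
          then show ?thesis using d True2 permutes_in_image[OF iu, of k] by (auto simp: inj_on_def)
        next
          case False
          then show ?thesis using iu by (auto simp: permutes_def)
        qed
        then have "inv u = id" by auto
        then have "u = id" using permutes_inv_inv[of u "{..<m}"] u by (simp add: U_def inv_id)
        then show ?thesis by simp
      next
        case False
        then have "u \<noteq> id" by auto
        then show ?thesis using False by simp
      qed
    qed
    also have "\<dots> = 1" by (simp add: U_def permutes_id sum.delta)
    finally show False using \<open>Q = 0\<close> by simp
  qed
  ultimately have "P = 0" by simp
  have "coeff P (kron M m (g s)) = (\<Sum>s'\<in>S. if s' = s then f s else 0)"
    unfolding P_def coeff_sum
  proof (intro sum.cong refl)
    fix s' assume s': "s' \<in> S"
    have "s' = s" if "kron M m (g s') = kron M m (g s)"
      using kron_inj[OF _ _ that] gM s' \<open>s \<in> S\<close> by (intro sep) auto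
    then show "coeff (monom (f s') (kron M m (g s'))) (kron M m (g s)) = (if s' = s then f s else 0)"
      by auto
  qed
  also have "\<dots> = f s" using S \<open>s \<in> S\<close> by simp
  finally show ?thesis using \<open>P = 0\<close> by simp
qed

lemma monomials_independent:
  assumes "finite S"
    and "\<And>s s'. s \<in> S \<Longrightarrow> s' \<in> S \<Longrightarrow> (\<And>k. k < m \<Longrightarrow> g s k = g s' k) \<Longrightarrow> s = s'"
    and "\<And>x. generic m x \<Longrightarrow> (\<Sum>s\<in>S. f s * xpow m (g s) x) = 0"
    and "s \<in> S"
  shows "f s = 0"
proof (rule monomials_times_alternant_independent[where d = id, OF assms(1,2) _ _ assms(4)])
  fix x assume "generic m x"
  then show "(\<Sum>s\<in>S. f s * xpow m (g s) x) * alternant m id x = 0"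
    by (simp only: assms(3) mult_zero_left)
qed auto

lemma finite_Par [simp]: "finite (Par m n)"
proof (rule finite_subset)
  show "Par m n \<subseteq> {f. \<forall>k. (k \<in> {..<m} \<longrightarrow> f k \<in> {..n}) \<and> (k \<notin> {..<m} \<longrightarrow> f k = 0)}"
  proof
    fix f assume f: "f \<in> Par m n"
    have "f k \<le> n" if "k < m" for k
      using member_le_sum[of k "{..<m}" f] f that by (simp add: Par_def)
    then show "f \<in> {f. \<forall>k. (k \<in> {..<m} \<longrightarrow> f k \<in> {..n}) \<and> (k \<notin> {..<m} \<longrightarrow> f k = 0)}"
      using f by (simp add: Par_def)
  qed
qed (rule finite_set_of_finite_funs; simp)

lemma Par_antimono: "f \<in> Par m n \<Longrightarrow> i \<le> j \<Longrightarrow> f j \<le> f i"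
  by (rule lift_Suc_antimono_le[of f]) (auto simp: Par_def)

lemma Par_staircase_less: "f \<in> Par m n \<Longrightarrow> i < j \<Longrightarrow> j < m \<Longrightarrow> (f \<boxplus> staircase m) j < (f \<boxplus> staircase m) i"
  using Par_antimono[of f m n i j] by (simp add: staircase_def)

text \<open>Comparing the two decreasing sequences makes \<open>v\<close> increasing, hence
  \<open>k \<le> v k\<close>, and only the identity of an initial segment achieves this.\<close>

lemma strict_decreasing_rearrangement:
  fixes b c :: "nat \<Rightarrow> nat"
  assumes v: "v permutes {..<m}" and eq: "\<And>k. k < m \<Longrightarrow> b k = c (v k)"
    and b: "\<And>i j. i < j \<Longrightarrow> j < m \<Longrightarrow> b j < b i" and c: "\<And>i j. i < j \<Longrightarrow> j < m \<Longrightarrow> c j < c i"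
  shows "v = id"
proof -
  have mono: "v i < v j" if "i < j" "j < m" for i j
  proof (rule ccontr)
    assume "\<not> v i < v j"
    moreover have "v i \<noteq> v j" using permutes_inj[OF v] that by (auto simp: inj_def)
    ultimately have "v j < v i" by simp
    then have "c (v i) < c (v j)" using permutes_in_image[OF v, of i] that by (intro c) auto
    then show False using b[OF that] eq[of i] eq[of j] that by simp
  qed
  have "k \<le> v k" if "k < m" for k using that
  proof (induction k)
    case (Suc k)
    then show ?case using mono[of k "Suc k"] by simp
  qed simp
  then have "\<forall>k\<in>{..<m}. k \<le> v k" by simp
  then show ?thesis using permutes_natset_ge[OF v] by blast
qed

text \<open>Expanded over pairs \<open>(l, u)\<close>, the alternants have pairwise different
  monomials: \<open>l \<boxplus> staircase m\<close> is strictly decreasing, so its rearrangements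
  are distinct and determine both \<open>l\<close> and \<open>u\<close>.\<close>

lemma alternants_independent:
  assumes zero: "\<And>x. generic m x \<Longrightarrow> (\<Sum>l\<in>Par m n. f l * alternant m (l \<boxplus> staircase m) x) = 0"
    and l: "l \<in> Par m n"
  shows "f l = 0"
proof -
  let ?U = "{u. u permutes {..<m}}"
  let ?g = "\<lambda>(l, u). (l \<boxplus> staircase m) \<circ> inv u"
  let ?f = "\<lambda>(l, u :: nat \<Rightarrow> nat). f l * of_int (sign u)"
  have "?f (l, id) = 0"
  proof (rule monomials_independent[where f = ?f and s = "(l, id)" and S = "Par m n \<times> ?U" and g = ?g and m = m])
    show "finite (Par m n \<times> ?U)" by simp
    show "(l, id) \<in> Par m n \<times> ?U" using l by (simp add: permutes_id)
  next
    fix s s' assume s: "s \<in> Par m n \<times> ?U" and s': "s' \<in> Par m n \<times> ?U"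
      and eq: "\<And>k. k < m \<Longrightarrow> ?g s k = ?g s' k"
    obtain l u where lu: "s = (l, u)" "l \<in> Par m n" "u permutes {..<m}" using s by auto
    obtain l' u' where lu': "s' = (l', u')" "l' \<in> Par m n" "u' permutes {..<m}" using s' by auto
    have e: "(l \<boxplus> staircase m) k = (l' \<boxplus> staircase m) ((inv u' \<circ> u) k)" if "k < m" for k
      using eq[of "u k"] that permutes_in_image[OF lu(3), of k] permutes_inverses[OF lu(3)]
      by (simp add: lu lu')
    have "inv u' \<circ> u = id"
    proof (rule strict_decreasing_rearrangement[where m = m and b = "l \<boxplus> staircase m" and c = "l' \<boxplus> staircase m"])
      show "inv u' \<circ> u permutes {..<m}" using lu lu' by (intro permutes_compose permutes_inv)
    qed (erule e, (erule Par_staircase_less[OF lu(2)] Par_staircase_less[OF lu'(2)], assumption)+)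
    then have "u' \<circ> inv u' \<circ> u = u'" by (simp add: comp_assoc)
    then have u: "u = u'" using permutes_inv_o(1)[OF lu'(3)] by simp
    have "l k = l' k" for k
    proof (cases "k < m")
      case True
      then show ?thesis using e[of k] \<open>inv u' \<circ> u = id\<close> by simp
    next
      case False
      then show ?thesis using lu(2) lu'(2) by (simp add: Par_def)
    qed
    then show "s = s'" using u lu lu' by auto
  next
    fix x assume "generic m x"
    then have "0 = (\<Sum>l\<in>Par m n. f l * alternant m (l \<boxplus> staircase m) x)" using zero by simp
    also have "\<dots> = (\<Sum>l\<in>Par m n. \<Sum>u\<in>?U. f l * of_int (sign u) * xpow m ((l \<boxplus> staircase m) \<circ> inv u) x)"
      unfolding alternant_def sum_distrib_left
      by (intro sum.cong refl) (simp add: xpow_perm')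
    also have "\<dots> = (\<Sum>s\<in>Par m n \<times> ?U. ?f s * xpow m (?g s) x)"
      by (simp add: sum.cartesian_product case_prod_unfold)
    finally show "(\<Sum>s\<in>Par m n \<times> ?U. ?f s * xpow m (?g s) x) = 0" by simp
  qed
  then show ?thesis by simp
qed

lemma straighten_exponent:
  assumes inj: "inj_on b {..<m}" and sum: "(\<Sum>k<m. b k) = n + (\<Sum>k<m. staircase m k)"
  shows "\<exists>l\<in>Par m n. \<exists>u. u permutes {..<m} \<and> (\<forall>k<m. b k = ((l \<boxplus> staircase m) \<circ> u) k)"
proof -
  define xs where "xs = map b [0..<m]"
  define ys where "ys = rev (sort xs)"
  have "mset xs = mset ys" by (simp add: ys_def)
  then obtain p where p: "p permutes {..<length ys}" "permute_list p ys = xs"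
    using mset_eq_permutation by blast
  have len: "length ys = m" by (simp add: xs_def ys_def)
  have "distinct ys" using inj by (simp add: ys_def xs_def distinct_map atLeast0LessThan)
  have dec: "ys ! j < ys ! i" if "i < j" "j < m" for i j
  proof -
    have "ys ! j \<le> ys ! i" using that len unfolding ys_def
      by (simp add: rev_nth sorted_nth_mono)
    moreover have "ys ! j \<noteq> ys ! i" using that len \<open>distinct ys\<close> by (simp add: nth_eq_iff_index_eq)
    ultimately show ?thesis by simp
  qed
  define l where "l k = (if k < m then ys ! k - staircase m k else 0)" for k
  \<comment> \<open>A strictly decreasing sequence of \<open>m\<close> natural numbers dominates the
    staircase; the induction starts at the last position, where the bound is
    \<open>0\<close>.\<close>
  have ge: "staircase m k \<le> ys ! k" if "k < m" for k
  proof -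
    have "d < m \<Longrightarrow> d \<le> ys ! (m - 1 - d)" for d
    proof (induction d)
      case (Suc d)
      have "m - 1 - Suc d < m - 1 - d" using Suc.prems by linarith
      then show ?case using dec[of "m - 1 - Suc d" "m - 1 - d"] Suc by simp
    qed simp
    from this[of "m - 1 - k"] that show ?thesis by (simp add: staircase_def)
  qed
  have ys: "ys ! k = (l \<boxplus> staircase m) k" if "k < m" for k
    using ge[OF that] that by (simp add: l_def)
  have b: "b k = ys ! p k" if "k < m" for k
    using p that len by (metis (no_types, lifting) length_permute_list permute_list_nth xs_def add_0 length_map length_upt minus_nat.diff_0 nth_map nth_upt)
  have pk: "p k < m" if "k < m" for k using p(1) len that permutes_in_image by force
  have "(\<Sum>k<m. b k) = (\<Sum>k<m. (l \<boxplus> staircase m) (p k))"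
    using b ys pk by (intro sum.cong) auto
  also have "\<dots> = (\<Sum>k<m. (l \<boxplus> staircase m) k)"
    using sum.permute[of p "{..<m}" "l \<boxplus> staircase m"] p(1) len by (simp add: o_def)
  finally have "(\<Sum>k<m. l k) = n" using sum by (simp add: sum.distrib)
  moreover have "l (Suc k) \<le> l k" for k
    using dec[of k "Suc k"] by (auto simp: l_def staircase_def)
  ultimately have "l \<in> Par m n" by (auto simp: Par_def l_def)
  moreover have "\<forall>k<m. b k = ((l \<boxplus> staircase m) \<circ> p) k" using b ys pk by simp
  ultimately show ?thesis using p(1) len by auto
qed

text \<open>The coefficients are a single sign, or all zero when an exponent repeats. The second
  property is carried along because \<open>content_weight\<close> computes the eigenvalue from the
  rearrangement relation.\<close>

lemma alternant_straighten:
  assumes "(\<Sum>k<m. b k) = n + (\<Sum>k<m. staircase m k)"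
  obtains c :: "(nat \<Rightarrow> nat) \<Rightarrow> real" where
    "\<And>x. alternant m b x = (\<Sum>l\<in>Par m n. c l * alternant m (l \<boxplus> staircase m) x)"
    "\<And>l. c l \<noteq> 0 \<Longrightarrow> l \<in> Par m n \<and> (\<exists>u. u permutes {..<m} \<and> (\<forall>k<m. b k = ((l \<boxplus> staircase m) \<circ> u) k))"
proof (cases "inj_on b {..<m}")
  case False
  then show ?thesis using that[of "\<lambda>_. 0"] by (simp add: alternant_eq_0)
next
  case True
  obtain l u where l: "l \<in> Par m n" and u: "u permutes {..<m}" "\<forall>k<m. b k = ((l \<boxplus> staircase m) \<circ> u) k"
    using straighten_exponent[OF True assms] by blast
  have "alternant m b x = of_int (sign u) * alternant m (l \<boxplus> staircase m) x" for x
    using alternant_cong[of m b "(l \<boxplus> staircase m) \<circ> u" x] alternant_perm_exp[OF u(1)] u(2) by simp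
  then have "alternant m b x = (\<Sum>l'\<in>Par m n. (if l' = l then of_int (sign u) else 0) * alternant m (l' \<boxplus> staircase m) x)" for x
    using l by (simp add: if_distrib[of "\<lambda>c. c * _"] cong: if_cong)
  moreover have "l' \<in> Par m n \<and> (\<exists>u. u permutes {..<m} \<and> (\<forall>k<m. b k = ((l' \<boxplus> staircase m) \<circ> u) k))"
    if "(if l' = l then real_of_int (sign u) else 0) \<noteq> 0" for l'
    using that l u by (auto split: if_splits)
  ultimately show ?thesis by (rule that)
qed

section \<open>Gelfand--Tsetlin patterns\<close>

text \<open>
  \<open>G i k\<close> is the number of letters below \<open>i\<close> in row \<open>k\<close> of a semistandard tableau of shape \<open>\<nu>\<close> with
  letters in \<open>{..<L}\<close>. Layers from \<open>L\<close> on are kept equal to \<open>\<nu>\<close>, so that counting functions counts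
  tableaux.
\<close>

definition GT :: "nat \<Rightarrow> (nat \<Rightarrow> nat) \<Rightarrow> (nat \<Rightarrow> nat \<Rightarrow> nat) set" where
  "GT L \<nu> = {G. G 0 = (\<lambda>_. 0) \<and> (\<forall>i\<ge>L. G i = \<nu>) \<and>
      (\<forall>i<L. \<forall>k. G (Suc i) (Suc k) \<le> G i k \<and> G i k \<le> G (Suc i) k)}"

text \<open>The number of letters \<open>i\<close> in the tableau. The layers of a pattern grow, so
  the subtraction does not truncate; \<open>wt_int\<close> is the form used for arithmetic.\<close>

definition wt :: "nat \<Rightarrow> (nat \<Rightarrow> nat \<Rightarrow> nat) \<Rightarrow> nat \<Rightarrow> nat" where
  "wt L G i = (\<Sum>k<L. G (Suc i) k) - (\<Sum>k<L. G i k)"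

definition schur :: "nat \<Rightarrow> (nat \<Rightarrow> nat) \<Rightarrow> (nat \<Rightarrow> real) \<Rightarrow> real" where
  "schur L \<nu> x = (\<Sum>G\<in>GT L \<nu>. xpow L (wt L G) x)"

lemma GT_zero: "G \<in> GT L \<nu> \<Longrightarrow> i \<le> L \<Longrightarrow> i \<le> k \<Longrightarrow> G i k = 0"
proof (induction i arbitrary: k)
  case (Suc i)
  then obtain k' where "k = Suc k'" by (cases k) auto
  moreover have "G (Suc i) (Suc k') \<le> G i k'" using Suc.prems by (simp add: GT_def)
  ultimately show ?case using Suc.IH[of k'] Suc.prems by simp
qed (simp add: GT_def)

lemma GT_step: "G \<in> GT L \<nu> \<Longrightarrow> G i k \<le> G (Suc i) k"
  by (cases "i < L") (auto simp: GT_def)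

lemma GT_mono: "G \<in> GT L \<nu> \<Longrightarrow> i \<le> j \<Longrightarrow> G i k \<le> G j k"
  using lift_Suc_mono_le[of "\<lambda>i. G i k" i j] GT_step by auto

lemma GT_le: "G \<in> GT L \<nu> \<Longrightarrow> G i k \<le> \<nu> k"
  using GT_mono[of G L \<nu> i "max i L" k] by (auto simp: GT_def)

lemma finite_GT [simp]: "finite (GT L \<nu>)"
proof (cases "\<exists>G. G \<in> GT L \<nu>")
  case True
  then have \<nu>0: "\<nu> k = 0" if "L \<le> k" for k
    using GT_zero[of _ L \<nu> L k] that by (auto simp: GT_def)
  let ?B = "{f. \<forall>k. (k \<in> {..<L} \<longrightarrow> f k \<in> {..sum \<nu> {..<L}}) \<and> (k \<notin> {..<L} \<longrightarrow> f k = (0::nat))}"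
  have "finite ?B" by (rule finite_set_of_finite_funs; simp)
  then have "finite {G. \<forall>i. (i \<in> {..<L} \<longrightarrow> G i \<in> ?B) \<and> (i \<notin> {..<L} \<longrightarrow> G i = \<nu>)}"
    by (intro finite_set_of_finite_funs) simp_all
  moreover have "GT L \<nu> \<subseteq> {G. \<forall>i. (i \<in> {..<L} \<longrightarrow> G i \<in> ?B) \<and> (i \<notin> {..<L} \<longrightarrow> G i = \<nu>)}"
  proof
    fix G assume G: "G \<in> GT L \<nu>"
    have "G i k \<le> sum \<nu> {..<L}" if "k < L" for i k
      using GT_le[OF G, of i k] member_le_sum[of k "{..<L}" \<nu>] that by simp
    moreover have "G i k = 0" if "L \<le> k" for i k
      using GT_le[OF G, of i k] \<nu>0[OF that] by simp
    ultimately show "G \<in> {G. \<forall>i. (i \<in> {..<L} \<longrightarrow> G i \<in> ?B) \<and> (i \<notin> {..<L} \<longrightarrow> G i = \<nu>)}"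
      using G by (simp add: GT_def)
  qed
  ultimately show ?thesis by (rule rev_finite_subset)
qed auto

lemma GT_size_mono: "G \<in> GT L \<nu> \<Longrightarrow> (\<Sum>k<L. G i k) \<le> (\<Sum>k<L. G (Suc i) k)"
  by (intro sum_mono GT_step)

lemma wt_int: "G \<in> GT L \<nu> \<Longrightarrow> int (wt L G i) = (\<Sum>k<L. int (G (Suc i) k)) - (\<Sum>k<L. int (G i k))"
  unfolding wt_def using GT_size_mono[of G L \<nu> i] by (simp add: of_nat_diff)

lemma sum_wt: "G \<in> GT L \<nu> \<Longrightarrow> (\<Sum>i<j. wt L G i) = (\<Sum>k<L. G j k)"
proof (induction j)
  case (Suc j)
  then show ?case using GT_size_mono[of G L \<nu> j] by (simp add: wt_def)
qed (simp add: GT_def)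

section \<open>Symmetry of Schur polynomials\<close>

definition lo :: "(nat \<Rightarrow> nat \<Rightarrow> nat) \<Rightarrow> nat \<Rightarrow> nat \<Rightarrow> nat" where
  "lo G j k = max (G (Suc j) (Suc k)) (G (j - 1) k)"

text \<open>For positive \<open>j\<close>, \<open>lo\<close> and \<open>hi\<close> delimit the
  interval that interlacing with the two neighbouring layers leaves to \<open>G j k\<close>; in row
  \<open>0\<close> the layer below gives no upper bound. Neither involves layer \<open>j\<close>
  itself.\<close>

definition hi :: "(nat \<Rightarrow> nat \<Rightarrow> nat) \<Rightarrow> nat \<Rightarrow> nat \<Rightarrow> nat" where
  "hi G j k = (case k of 0 \<Rightarrow> G (Suc j) 0 | Suc k' \<Rightarrow> min (G (Suc j) k) (G (j - 1) k'))"

lemma lo_upd [simp]: "0 < j \<Longrightarrow> lo (G(j := f)) j = lo G j"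
  and hi_upd [simp]: "0 < j \<Longrightarrow> hi (G(j := f)) j = hi G j"
  by (auto simp: lo_def hi_def fun_eq_iff split: nat.splits)

lemma GT_lo_hi:
  assumes "G \<in> GT L \<nu>" "0 < j" "j < L"
  shows "lo G j k \<le> G j k" "G j k \<le> hi G j k"
proof -
  obtain j' where j: "j = Suc j'" using assms by (cases j) auto
  show "lo G j k \<le> G j k" "G j k \<le> hi G j k"
    using assms unfolding j by (auto simp: lo_def hi_def GT_def split: nat.splits)
qed

lemma GT_upd:
  assumes G: "G \<in> GT L \<nu>" and j: "0 < j" "j < L" and f: "\<And>k. lo G j k \<le> f k" "\<And>k. f k \<le> hi G j k"
  shows "G(j := f) \<in> GT L \<nu>"
proof -
  obtain j' where j': "j = Suc j'" using j by (cases j) auto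
  have 1: "G (Suc j) (Suc k) \<le> f k" "G j' k \<le> f k" for k using f(1)[of k] by (auto simp: lo_def j')
  have 2: "f k \<le> G (Suc j) k" "f (Suc k) \<le> G j' k" for k
    using f(2)[of k] f(2)[of "Suc k"] by (auto simp: hi_def j' split: nat.splits)
  show ?thesis using G j 1 2 unfolding GT_def by (auto simp: j')
qed

text \<open>\<open>lo G j k\<close> and \<open>hi G j (Suc k)\<close> are the maximum and the
  minimum of the same two entries, so together they have the same sum as those entries.\<close>

lemma sum_hi_lo:
  "(\<Sum>k\<le>K. int (hi G j k)) + (\<Sum>k<K. int (lo G j k)) = (\<Sum>k\<le>K. int (G (Suc j) k)) + (\<Sum>k<K. int (G (j - 1) k))"
  by (induction K) (auto simp: hi_def lo_def min_def max_def)

lemma sum_hi_lo_all: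
  assumes G: "G \<in> GT L \<nu>" and j: "0 < j" "j < L"
  shows "(\<Sum>k<L. int (hi G j k) + int (lo G j k)) = (\<Sum>k<L. int (G (Suc j) k)) + (\<Sum>k<L. int (G (j - 1) k))"
proof -
  obtain L' where L: "L = Suc L'" using j by (cases L) auto
  have "G (Suc j) L = 0" using GT_zero[OF G, of "Suc j" L] j by simp
  then have "lo G j L' = G (j - 1) L'" by (simp add: lo_def L)
  then show ?thesis using sum_hi_lo[where G=G and j=j and K=L']
    by (simp add: L sum.distrib lessThan_Suc_atMost[symmetric])
qed

lemma wt_upd_other: "i \<noteq> j \<Longrightarrow> Suc i \<noteq> j \<Longrightarrow> wt L (G(j := f)) i = wt L G i"
  by (simp add: wt_def)

definition flip :: "nat \<Rightarrow> (nat \<Rightarrow> nat \<Rightarrow> nat) \<Rightarrow> nat \<Rightarrow> nat \<Rightarrow> nat" where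
  "flip j G = G(j := \<lambda>k. lo G j k + hi G j k - G j k)"

lemma flip_GT: "G \<in> GT L \<nu> \<Longrightarrow> 0 < j \<Longrightarrow> j < L \<Longrightarrow> flip j G \<in> GT L \<nu>"
  unfolding flip_def
proof (rule GT_upd)
  fix k assume *: "G \<in> GT L \<nu>" "0 < j" "j < L"
  show "lo G j k \<le> lo G j k + hi G j k - G j k" "lo G j k + hi G j k - G j k \<le> hi G j k"
    using GT_lo_hi[OF *, of k] by linarith+
qed

lemma flip_flip:
  assumes "G \<in> GT L \<nu>" "0 < j" "j < L"
  shows "flip j (flip j G) = G"
proof (intro ext)
  fix i k
  show "flip j (flip j G) i k = G i k"
    using GT_lo_hi[OF assms, of k] assms(2) by (auto simp: flip_def)
qed

text \<open>Reflection replaces the size of layer \<open>Suc j\<close> by the sizes of its two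
  neighbours minus the old size. This exchanges the two increments, which are the numbers of letters
  \<open>j\<close> and \<open>Suc j\<close>.\<close>

lemma wt_flip:
  assumes G: "G \<in> GT L \<nu>" and j: "Suc j < L" and i: "i < L"
  shows "wt L (flip (Suc j) G) i = (wt L G \<circ> swp j (Suc j)) i"
proof -
  have F: "flip (Suc j) G \<in> GT L \<nu>" using flip_GT[OF G, of "Suc j"] j by simp
  have "int (flip (Suc j) G (Suc j) k) = int (hi G (Suc j) k) + int (lo G (Suc j) k) - int (G (Suc j) k)" for k
    using GT_lo_hi[OF G, of "Suc j" k] j by (simp add: flip_def of_nat_diff)
  then have *: "(\<Sum>k<L. int (flip (Suc j) G (Suc j) k)) =
      (\<Sum>k<L. int (G (Suc (Suc j)) k)) + (\<Sum>k<L. int (G j k)) - (\<Sum>k<L. int (G (Suc j) k))"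
    using sum_hi_lo_all[OF G, of "Suc j"] j by (simp add: sum.distrib sum_subtractf)
  have 1: "flip (Suc j) G j = G j" "flip (Suc j) G (Suc (Suc j)) = G (Suc (Suc j))"
    by (simp_all add: flip_def)
  consider "i = j" | "i = Suc j" | "i \<noteq> j" "i \<noteq> Suc j" by blast
  then show ?thesis
  proof cases
    case 1
    have "int (wt L (flip (Suc j) G) j) = int (wt L G (Suc j))"
      unfolding wt_int[OF F] wt_int[OF G] * by (simp add: flip_def)
    then show ?thesis using 1 by simp
  next
    case 2
    have "int (wt L (flip (Suc j) G) (Suc j)) = int (wt L G j)"
      unfolding wt_int[OF F] wt_int[OF G] * by (simp add: flip_def)
    then show ?thesis using 2 by simp
  next
    case 3
    then show ?thesis by (simp add: flip_def wt_upd_other)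
  qed
qed

lemma schur_adjacent:
  assumes "Suc j < L"
  shows "schur L \<nu> (x \<circ> swp j (Suc j)) = schur L \<nu> x"
proof -
  let ?t = "swp j (Suc j)"
  have t: "?t permutes {..<L}" using assms by (intro permutes_swap_id) auto
  have "xpow L (wt L G) (x \<circ> ?t) = xpow L (wt L (flip (Suc j) G)) x" if "G \<in> GT L \<nu>" for G
  proof -
    have "xpow L (wt L (flip (Suc j) G)) x = xpow L (wt L G \<circ> ?t) x"
      by (intro xpow_cong refl wt_flip[OF that assms])
    also have "\<dots> = xpow L (wt L G) (x \<circ> ?t)"
      using xpow_perm'[OF t, of "wt L G" x] by (simp add: inv_swap_id)
    finally show ?thesis by simp
  qed
  then have "schur L \<nu> (x \<circ> ?t) = (\<Sum>G\<in>GT L \<nu>. xpow L (wt L (flip (Suc j) G)) x)"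
    unfolding schur_def by (intro sum.cong) auto
  also have "\<dots> = schur L \<nu> x" unfolding schur_def
    by (rule sum.reindex_bij_witness[of _ "flip (Suc j)" "flip (Suc j)"])
      (use assms in \<open>auto simp: flip_flip flip_GT\<close>)
  finally show ?thesis .
qed

text \<open>The transposition of \<open>a\<close> and \<open>Suc b\<close> is that of
  \<open>a\<close> and \<open>b\<close> conjugated by an adjacent one; so adjacent ones reach all
  transpositions, and these reach all permutations.\<close>

lemma symmetric_if_adjacent:
  assumes adj: "\<And>j x. Suc j < L \<Longrightarrow> F (x \<circ> swp j (Suc j)) = F (x :: nat \<Rightarrow> real)"
    and u: "u permutes {..<L}"
  shows "F (x \<circ> u) = F x"
proof -
  have *: "F (x \<circ> swp a b) = F x" if "a < b" "b < L" for a b x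
    using that
  proof (induction b arbitrary: x)
    case (Suc b)
    show ?case
    proof (cases "a = b")
      case True
      show ?thesis unfolding True using Suc.prems(2) by (rule adj)
    next
      case False
      let ?s = "swp b (Suc b)"
      have "swp a (Suc b) = ?s \<circ> swp a b \<circ> ?s"
        using transpose_comp_triple[where a = "Suc b" and b = b and c = a] False Suc.prems
          transpose_commute[of "Suc b" b] transpose_commute[of b a] transpose_commute[of "Suc b" a]
        by simp
      then have "F (x \<circ> swp a (Suc b)) = F (((x \<circ> ?s) \<circ> swp a b) \<circ> ?s)"
        by (simp only: o_assoc)
      also have "\<dots> = F ((x \<circ> ?s) \<circ> swp a b)"
        using Suc.prems by (rule_tac adj) simp
      also have "\<dots> = F (x \<circ> ?s)" using False Suc.prems by (intro Suc.IH) auto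
      also have "\<dots> = F x" using Suc.prems by (rule_tac adj) simp
      finally show ?thesis .
    qed
  qed simp
  have **: "F (x \<circ> swp a b) = F x" if "a < L" "b < L" for a b x
  proof (cases a b rule: linorder_cases)
    case less
    then show ?thesis using that(2) by (rule *)
  next
    case greater
    then show ?thesis unfolding transpose_commute[of a b] using that(1) by (rule *)
  qed simp
  have "\<forall>x. F (x \<circ> u) = F x"
    using u finite_lessThan
  proof (induction u rule: permutes_induct)
    case (swap a b p)
    have "F (x \<circ> (swp a b \<circ> p)) = F x" for x
    proof -
      have "F (x \<circ> (swp a b \<circ> p)) = F ((x \<circ> swp a b) \<circ> p)"
        by (simp only: o_assoc)
      also have "\<dots> = F (x \<circ> swp a b)" using swap by blast
      also have "\<dots> = F x" using swap by (intro **) auto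
      finally show ?thesis .
    qed
    then show ?case by blast
  qed simp
  then show ?thesis by simp
qed

lemma schur_symmetric:
  assumes "u permutes {..<L}"
  shows "schur L \<nu> (x \<circ> u) = schur L \<nu> x"
proof (rule symmetric_if_adjacent[where F = "schur L \<nu>", OF _ assms])
  fix j x assume "Suc j < L"
  then show "schur L \<nu> (x \<circ> swp j (Suc j)) = schur L \<nu> x"
    by (rule schur_adjacent)
qed

lemma schur_times_alternant:
  "schur L \<nu> x * alternant L b x = (\<Sum>G\<in>GT L \<nu>. alternant L (b \<boxplus> wt L G) x)"
proof (rule symmetric_times_alternant[where F = "schur L \<nu>" and g = "wt L"])
  show "schur L \<nu> x = (\<Sum>G\<in>GT L \<nu>. xpow L (wt L G) x)" for x
    by (rule schur_def)
  show "schur L \<nu> (x \<circ> u) = schur L \<nu> x" if "u permutes {..<L}" for u x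
    using that by (rule schur_symmetric)
qed

section \<open>The product rule\<close>

text \<open>
  \<open>slack \<mu> G j K \<le> 0\<close> for all \<open>j\<close>, \<open>K\<close> says that the companion filling of \<open>(\<mu> + wt G) / \<mu>\<close>, which has in
  row \<open>i\<close> as many letters \<open>k\<close> as the tableau has letters \<open>i\<close> in row \<open>k\<close>, is strict in columns. A
  pattern violating this is cancelled by flipping layer \<open>j\<close> below the first violation: rows are scanned
  first, and the largest \<open>j\<close> is taken within a row, because the conditions for larger \<open>j\<close> in row \<open>K\<close>
  and all conditions in earlier rows do not see the entries that are changed.
\<close>

definition slack :: "(nat \<Rightarrow> nat) \<Rightarrow> (nat \<Rightarrow> nat \<Rightarrow> nat) \<Rightarrow> nat \<Rightarrow> nat \<Rightarrow> int" where
  "slack \<mu> G j K = int (\<mu> j) - int (\<mu> (j - 1)) + (\<Sum>k\<le>K. int (G (Suc j) k) - int (G j k))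
     + (\<Sum>k<K. int (G (j - 1) k) - int (G j k))"

definition violated :: "nat \<Rightarrow> (nat \<Rightarrow> nat) \<Rightarrow> (nat \<Rightarrow> nat \<Rightarrow> nat) \<Rightarrow> nat \<Rightarrow> nat \<Rightarrow> bool" where
  "violated L \<mu> G K j \<longleftrightarrow> 0 < j \<and> j < L \<and> K < L \<and> 0 < slack \<mu> G j K"

definition good :: "nat \<Rightarrow> (nat \<Rightarrow> nat) \<Rightarrow> (nat \<Rightarrow> nat \<Rightarrow> nat) \<Rightarrow> bool" where
  "good L \<mu> G \<longleftrightarrow> (\<forall>K j. \<not> violated L \<mu> G K j)"

definition critical :: "nat \<Rightarrow> (nat \<Rightarrow> nat) \<Rightarrow> (nat \<Rightarrow> nat \<Rightarrow> nat) \<Rightarrow> nat \<Rightarrow> nat \<Rightarrow> bool" where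
  "critical L \<mu> G K j \<longleftrightarrow> violated L \<mu> G K j \<and> (\<forall>K'<K. \<forall>j'. \<not> violated L \<mu> G K' j') \<and>
     (\<forall>j'>j. \<not> violated L \<mu> G K j')"

text \<open>
  The value in row \<open>K\<close> is chosen so that the exponents \<open>j - 1\<close> and \<open>j\<close> of \<open>\<mu> + \<delta> + wt G\<close> are exchanged.
\<close>

definition tailflip :: "(nat \<Rightarrow> nat) \<Rightarrow> (nat \<Rightarrow> nat \<Rightarrow> nat) \<Rightarrow> nat \<Rightarrow> nat \<Rightarrow> nat \<Rightarrow> nat \<Rightarrow> nat" where
  "tailflip \<mu> G K j = G(j := \<lambda>k. if k < K then G j k
     else if k = K then nat (int (lo G j k) + slack \<mu> G j K - 1)
     else lo G j k + hi G j k - G j k)"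

section \<open>The sign-reversing involution on bad patterns\<close>

lemma critical_unique: "critical L \<mu> G K j \<Longrightarrow> critical L \<mu> G K' j' \<Longrightarrow> K = K' \<and> j = j'"
  unfolding critical_def by (metis linorder_neqE_nat)

lemma critical_exists:
  assumes "\<not> good L \<mu> G"
  shows "\<exists>K j. critical L \<mu> G K j"
proof -
  define K where "K = (LEAST K. \<exists>j. violated L \<mu> G K j)"
  have ex: "\<exists>j. violated L \<mu> G K j"
    unfolding K_def by (rule LeastI_ex) (use assms in \<open>auto simp: good_def\<close>)
  have min: "\<not> violated L \<mu> G K' j" if "K' < K" for K' j
    using not_less_Least[of K' "\<lambda>K. \<exists>j. violated L \<mu> G K j"] that unfolding K_def by blast
  define j where "j = (GREATEST j. violated L \<mu> G K j)"
  have bound: "j' \<le> L" if "violated L \<mu> G K j'" for j' using that by (simp add: violated_def)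
  have "violated L \<mu> G K j"
    unfolding j_def by (rule GreatestI_ex_nat[OF ex bound])
  moreover have "\<not> violated L \<mu> G K j'" if "j < j'" for j'
    using Greatest_le_nat[of "violated L \<mu> G K" j' L] bound that unfolding j_def by fastforce
  ultimately have "critical L \<mu> G K j" using min by (simp add: critical_def)
  then show ?thesis by blast
qed

text \<open>For fixed neighbouring layers \<open>hi\<close> and \<open>lo\<close> are constants, so
  this form isolates the dependence on layer \<open>j\<close> (for positive \<open>j\<close>): an
  entry in a row before \<open>K\<close> enters with coefficient \<open>- 2\<close>, the entry in
  row \<open>K\<close> with \<open>- 1\<close>, later ones not at all.\<close>

lemma slack_hi_lo:
  "slack \<mu> G j K = int (\<mu> j) - int (\<mu> (j - 1)) + (\<Sum>k\<le>K. int (hi G j k) - int (G j k))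
     + (\<Sum>k<K. int (lo G j k) - int (G j k))"
  using sum_hi_lo[where G=G and j=j and K=K] by (simp add: slack_def sum_subtractf)

lemma slack_cong:
  assumes "\<And>k. k \<le> K \<Longrightarrow> G' (Suc j) k = G (Suc j) k" "\<And>k. k \<le> K \<Longrightarrow> G' j k = G j k"
    "\<And>k. k < K \<Longrightarrow> G' (j - 1) k = G (j - 1) k"
  shows "slack \<mu> G' j K = slack \<mu> G j K"
  unfolding slack_def using assms by simp

context
  fixes L n :: nat and \<mu> \<nu> :: "nat \<Rightarrow> nat" and G :: "nat \<Rightarrow> nat \<Rightarrow> nat" and K j :: nat
  assumes \<mu>: "\<And>k. \<mu> (Suc k) \<le> \<mu> k" and G: "G \<in> GT L \<nu>" and crit: "critical L \<mu> G K j"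
begin

lemma crit_bounds: "0 < j" "j < L" "K < L" "0 < slack \<mu> G j K"
  using crit by (auto simp: critical_def violated_def)

text \<open>At the previous row the slack is at most \<open>0\<close>, because \<open>K\<close> is
  the first row with a violation (for \<open>K = 0\<close>, because \<open>\<mu>\<close> decreases).
  Passing to row \<open>K\<close> adds \<open>hi - G\<close> there and the nonpositive
  \<open>lo - G\<close> of the row before. This bound keeps the new entry below
  \<open>hi\<close>.\<close>

lemma slack_le: "slack \<mu> G j K \<le> int (hi G j K) - int (G j K)"
proof (cases K)
  case 0
  have "\<mu> j \<le> \<mu> (j - 1)" using \<mu>[of "j - 1"] crit_bounds by simp
  then show ?thesis by (simp add: slack_hi_lo 0)
next
  case (Suc K')
  have "\<not> violated L \<mu> G K' j" using crit Suc by (simp add: critical_def)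
  then have "slack \<mu> G j K' \<le> 0" using crit_bounds Suc by (simp add: violated_def)
  then show ?thesis using GT_lo_hi(1)[OF G crit_bounds(1,2), of K'] unfolding slack_hi_lo Suc by simp
qed

lemma tailflip_at_K: "int (tailflip \<mu> G K j j K) = int (lo G j K) + slack \<mu> G j K - 1"
  using crit_bounds by (simp add: tailflip_def)

lemma tailflip_GT: "tailflip \<mu> G K j \<in> GT L \<nu>"
  unfolding tailflip_def
proof (rule GT_upd[OF G crit_bounds(1,2)])
  fix k
  note b = GT_lo_hi[OF G crit_bounds(1,2), of k]
  show "lo G j k \<le> (if k < K then G j k else if k = K then nat (int (lo G j k) + slack \<mu> G j K - 1)
      else lo G j k + hi G j k - G j k)"
    using b crit_bounds by auto
  show "(if k < K then G j k else if k = K then nat (int (lo G j k) + slack \<mu> G j K - 1)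
      else lo G j k + hi G j k - G j k) \<le> hi G j k"
    using b crit_bounds slack_le by auto
qed

lemma lo_tailflip: "lo (tailflip \<mu> G K j) j = lo G j" "hi (tailflip \<mu> G K j) j = hi G j"
  using crit_bounds by (simp_all add: tailflip_def)

text \<open>Entry and slack trade places: the new entry minus \<open>lo\<close> is the old slack
  minus one, and the new slack minus one is the old entry minus \<open>lo\<close>. Hence the
  violation persists and the operation undoes itself.\<close>

lemma slack_tailflip: "slack \<mu> (tailflip \<mu> G K j) j K = int (G j K) - int (lo G j K) + 1"
proof -
  let ?G = "tailflip \<mu> G K j"
  have *: "?G j k = G j k" if "k < K" for k using that by (simp add: tailflip_def)
  have "slack \<mu> ?G j K - slack \<mu> G j K = int (G j K) - int (?G j K)"
    unfolding slack_hi_lo lo_tailflip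
    by (simp add: * lessThan_Suc_atMost[symmetric])
  then show ?thesis using tailflip_at_K by simp
qed

lemma critical_tailflip: "critical L \<mu> (tailflip \<mu> G K j) K j"
proof -
  let ?G = "tailflip \<mu> G K j"
  have other: "?G i = G i" if "i \<noteq> j" for i using that by (simp add: tailflip_def)
  have below: "?G i k = G i k" if "k < K" for i k using that by (simp add: tailflip_def)
  have 1: "violated L \<mu> ?G K j"
    using slack_tailflip GT_lo_hi(1)[OF G crit_bounds(1,2), of K] crit_bounds by (simp add: violated_def)
  have 2: "\<not> violated L \<mu> ?G K' j'" if "K' < K" for K' j'
  proof -
    have "slack \<mu> ?G j' K' = slack \<mu> G j' K'"
      using that by (intro slack_cong below) auto
    then show ?thesis using crit that by (simp add: critical_def violated_def)
  qed
  have 3: "\<not> violated L \<mu> ?G K j'" if "j < j'" for j'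
  proof -
    have "slack \<mu> ?G j' K = slack \<mu> G j' K"
      using that by (intro slack_cong) (auto simp: other below)
    then show ?thesis using crit that by (simp add: critical_def violated_def)
  qed
  show ?thesis using 1 2 3 by (simp add: critical_def)
qed

lemma tailflip_tailflip: "tailflip \<mu> (tailflip \<mu> G K j) K j = G"
proof (intro ext)
  fix i k
  show "tailflip \<mu> (tailflip \<mu> G K j) K j i k = G i k"
    unfolding tailflip_def[of \<mu> "tailflip \<mu> G K j"] lo_tailflip slack_tailflip
    using GT_lo_hi[OF G crit_bounds(1,2), of k] by (auto simp: tailflip_def)
qed

lemma alternant_tailflip:
  "alternant L ((\<mu> \<boxplus> staircase L) \<boxplus> wt L (tailflip \<mu> G K j)) x =
     - alternant L ((\<mu> \<boxplus> staircase L) \<boxplus> wt L G) x"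
proof (rule alternant_transpose[where i = j and j = "j - 1"])
  let ?G = "tailflip \<mu> G K j"
  note b = crit_bounds
  have eq: "int (?G j k) + int (G j k) = (if k < K then 2 * int (G j k) else
      if k = K then int (lo G j K) + slack \<mu> G j K - 1 + int (G j K) else int (lo G j k) + int (hi G j k))" for k
    using tailflip_at_K GT_lo_hi[OF G b(1,2), of k] by (auto simp: tailflip_def)
  have split: "(\<Sum>k<L. f k) = (\<Sum>k<K. f k) + f K + (\<Sum>k\<in>{K<..<L}. f k)" for f :: "nat \<Rightarrow> int"
  proof -
    have "sum f {..<L} = sum f ({..<Suc K} \<union> {K<..<L})" using b by (intro sum.cong) auto
    also have "\<dots> = sum f {..<Suc K} + sum f {K<..<L}" by (intro sum.union_disjoint) auto
    finally show ?thesis by simp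
  qed
  have "(\<Sum>k<L. int (?G j k) + int (G j k)) =
      2 * (\<Sum>k<K. int (G j k)) + (int (lo G j K) + slack \<mu> G j K - 1 + int (G j K))
      + (\<Sum>k\<in>{K<..<L}. int (lo G j k) + int (hi G j k))"
    unfolding eq split by (simp add: sum_distrib_left)
  also have "\<dots> = (\<Sum>k<L. int (hi G j k) + int (lo G j k)) + int (\<mu> j) - int (\<mu> (j - 1)) - 1"
    unfolding split slack_hi_lo
    by (simp add: sum.distrib sum_subtractf lessThan_Suc_atMost[symmetric])
  also have "\<dots> = (\<Sum>k<L. int (G (Suc j) k)) + (\<Sum>k<L. int (G (j - 1) k)) + int (\<mu> j) - int (\<mu> (j - 1)) - 1"
    unfolding sum_hi_lo_all[OF G b(1,2)] ..
  \<comment> \<open>This value of the layer total is exactly what exchanges the two exponents; the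
    final \<open>- 1\<close> is the difference of the staircase at \<open>j\<close> and at
    \<open>j - 1\<close>.\<close>
  finally have main: "(\<Sum>k<L. int (?G j k)) + (\<Sum>k<L. int (G j k)) =
      (\<Sum>k<L. int (G (Suc j) k)) + (\<Sum>k<L. int (G (j - 1) k)) + int (\<mu> j) - int (\<mu> (j - 1)) - 1"
    by (simp add: sum.distrib)
  have st: "staircase L (j - 1) = Suc (staircase L j)" using b by (simp add: staircase_def)
  have oth: "?G (Suc j) = G (Suc j)" "?G (j - 1) = G (j - 1)" using b by (auto simp: tailflip_def)
  have Sj: "Suc (j - 1) = j" using b by simp
  note w = wt_int[OF tailflip_GT, of j] wt_int[OF tailflip_GT, of "j - 1"] wt_int[OF G, of j] wt_int[OF G, of "j - 1"]
  show "((\<mu> \<boxplus> staircase L) \<boxplus> wt L ?G) j = ((\<mu> \<boxplus> staircase L) \<boxplus> wt L G) (j - 1)"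
    using w main st unfolding oth Sj by linarith
  show "((\<mu> \<boxplus> staircase L) \<boxplus> wt L ?G) (j - 1) = ((\<mu> \<boxplus> staircase L) \<boxplus> wt L G) j"
    using w main st unfolding oth Sj by linarith
  show "((\<mu> \<boxplus> staircase L) \<boxplus> wt L ?G) k = ((\<mu> \<boxplus> staircase L) \<boxplus> wt L G) k"
    if "k \<noteq> j" "k \<noteq> j - 1" for k
    using that wt_upd_other[of k j L G] by (auto simp: tailflip_def)
qed (use crit_bounds in auto)

end

lemma critical_imp_not_good: "critical L \<mu> G K j \<Longrightarrow> \<not> good L \<mu> G"
  by (auto simp: critical_def good_def)

lemma sum_GT_eq_sum_good:
  assumes \<mu>: "\<And>k. \<mu> (Suc k) \<le> \<mu> k"
  shows "(\<Sum>G\<in>GT L \<nu>. alternant L ((\<mu> \<boxplus> staircase L) \<boxplus> wt L G) x) =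
    (\<Sum>G\<in>{G \<in> GT L \<nu>. good L \<mu> G}. alternant L ((\<mu> \<boxplus> staircase L) \<boxplus> wt L G) x)"
proof -
  define f where "f G = alternant L ((\<mu> \<boxplus> staircase L) \<boxplus> wt L G) x" for G
  define B where "B = {G \<in> GT L \<nu>. \<not> good L \<mu> G}"
  obtain K j where Kj: "\<And>G. G \<in> B \<Longrightarrow> critical L \<mu> G (K G) (j G)"
    using critical_exists[of L \<mu>] unfolding B_def by (simp add: Ball_def[symmetric]) metis
  define h where "h G = tailflip \<mu> G (K G) (j G)" for G
  have hB: "h G \<in> B" if "G \<in> B" for G
    using tailflip_GT[where \<nu> = \<nu>, OF \<mu> _ Kj[OF that]] critical_tailflip[where \<nu> = \<nu>, OF \<mu> _ Kj[OF that]] that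
    by (auto simp: h_def B_def dest: critical_imp_not_good)
  \<comment> \<open>\<open>K\<close> and \<open>j\<close> are arbitrary choices; applying
    \<open>h\<close> twice returns to \<open>G\<close> because the critical position is unique and
    survives the flip.\<close>
  have hh: "h (h G) = G" if "G \<in> B" for G
  proof -
    have "critical L \<mu> (h G) (K G) (j G)"
      using critical_tailflip[where \<nu> = \<nu>, OF \<mu> _ Kj[OF that]] that by (simp add: h_def B_def)
    then have "K (h G) = K G \<and> j (h G) = j G"
      using critical_unique Kj[OF hB[OF that]] by blast
    then show ?thesis
      using tailflip_tailflip[where \<nu> = \<nu>, OF \<mu> _ Kj[OF that]] that by (simp add: h_def B_def)
  qed
  have "sum f B = sum (\<lambda>G. f (h G)) B"
    by (rule sum.reindex_bij_witness[of _ h h]) (auto simp: hB hh)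
  also have "\<dots> = - sum f B"
    using alternant_tailflip[where \<nu> = \<nu>, OF \<mu> _ Kj] unfolding f_def h_def sum_negf[symmetric]
    by (intro sum.cong) (auto simp: B_def)
  finally have "sum f B = 0" by simp
  moreover have "GT L \<nu> = B \<union> {G \<in> GT L \<nu>. good L \<mu> G}" by (auto simp: B_def)
  moreover have "sum f (B \<union> {G \<in> GT L \<nu>. good L \<mu> G}) = sum f B + sum f {G \<in> GT L \<nu>. good L \<mu> G}"
    by (rule sum.union_disjoint) (auto simp: B_def)
  ultimately show ?thesis unfolding f_def by simp
qed

text \<open>Counts the patterns of shape \<open>\<nu>\<close> that survive the cancellation, by
  resulting exponent; \<open>LR_coeff_eq_lr_number\<close> matches them with tableaux of shape
  \<open>l / \<mu>\<close>.\<close>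

definition lr_number :: "nat \<Rightarrow> (nat \<Rightarrow> nat) \<Rightarrow> (nat \<Rightarrow> nat) \<Rightarrow> (nat \<Rightarrow> nat) \<Rightarrow> nat" where
  "lr_number L l \<mu> \<nu> = card {G \<in> GT L \<nu>. good L \<mu> G \<and> (\<forall>k<L. \<mu> k + wt L G k = l k)}"

lemma good_Par:
  assumes \<mu>: "\<mu> \<in> Par L n1" and \<nu>: "\<nu> \<in> Par L n2" and G: "G \<in> GT L \<nu>" and good: "good L \<mu> G"
  shows "(\<lambda>k. if k < L then \<mu> k + wt L G k else 0) \<in> Par L (n1 + n2)"
proof -
  have "\<mu> (Suc k) + wt L G (Suc k) \<le> \<mu> k + wt L G k" if k: "Suc k < L" for k
  proof -
    obtain L' where L: "L = Suc L'" using k by (cases L) auto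
    \<comment> \<open>The instance for the last row index already bounds all of row
      \<open>Suc k\<close> of the companion filling by row \<open>k\<close>.\<close>
    have "slack \<mu> G (Suc k) L' \<le> 0"
      using good[unfolded good_def, rule_format, of L' "Suc k"] k L by (simp add: violated_def)
    then show ?thesis using GT_step[OF G, of k L'] wt_int[OF G, of k] wt_int[OF G, of "Suc k"]
      by (simp add: slack_def L sum_subtractf lessThan_Suc_atMost[symmetric])
  qed
  moreover have "(\<Sum>k<L. wt L G k) = n2"
    using sum_wt[OF G, of L] G \<nu> by (simp add: GT_def Par_def)
  ultimately show ?thesis using \<mu> by (auto simp: Par_def sum.distrib)
qed

text \<open>The exponents that survive the cancellation are already partition plus staircase, so
  they only have to be grouped, and no signs are left.\<close>

theorem schur_times_alternant_lr_number:
  assumes \<mu>: "\<mu> \<in> Par L n1" and \<nu>: "\<nu> \<in> Par L n2"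
  shows "schur L \<nu> x * alternant L (\<mu> \<boxplus> staircase L) x =
    (\<Sum>l\<in>Par L (n1 + n2). of_nat (lr_number L l \<mu> \<nu>) * alternant L (l \<boxplus> staircase L) x)"
proof -
  have \<mu>': "\<And>k. \<mu> (Suc k) \<le> \<mu> k" using \<mu> by (simp add: Par_def)
  let ?g = "\<lambda>G k. if k < L then \<mu> k + wt L G k else 0"
  let ?S = "{G \<in> GT L \<nu>. good L \<mu> G}"
  have "schur L \<nu> x * alternant L (\<mu> \<boxplus> staircase L) x =
      (\<Sum>G\<in>?S. alternant L ((\<mu> \<boxplus> staircase L) \<boxplus> wt L G) x)"
    unfolding schur_times_alternant by (rule sum_GT_eq_sum_good) (rule \<mu>')
  also have "\<dots> = (\<Sum>G\<in>?S. alternant L (?g G \<boxplus> staircase L) x)"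
    by (intro sum.cong refl alternant_cong) auto
  also have "\<dots> = (\<Sum>l\<in>Par L (n1 + n2). \<Sum>G | G \<in> ?S \<and> ?g G = l. alternant L (?g G \<boxplus> staircase L) x)"
    by (rule sum.group[symmetric]) (use good_Par[OF \<mu> \<nu>] in auto)
  also have "\<dots> = (\<Sum>l\<in>Par L (n1 + n2). of_nat (lr_number L l \<mu> \<nu>) * alternant L (l \<boxplus> staircase L) x)"
  proof (intro sum.cong refl)
    fix l assume l: "l \<in> Par L (n1 + n2)"
    have "(\<Sum>G | G \<in> ?S \<and> ?g G = l. alternant L (?g G \<boxplus> staircase L) x) =
        (\<Sum>G | G \<in> ?S \<and> ?g G = l. alternant L (l \<boxplus> staircase L) x)"
      by (rule sum.cong) auto
    moreover have "{G \<in> ?S. ?g G = l} = {G \<in> GT L \<nu>. good L \<mu> G \<and> (\<forall>k<L. \<mu> k + wt L G k = l k)}"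
      using l by (auto simp: fun_eq_iff Par_def)
    ultimately show "(\<Sum>G | G \<in> ?S \<and> ?g G = l. alternant L (?g G \<boxplus> staircase L) x) =
        of_nat (lr_number L l \<mu> \<nu>) * alternant L (l \<boxplus> staircase L) x"
      by (simp add: lr_number_def)
  qed
  finally show ?thesis .
qed

text \<open>With empty \<open>\<mu>\<close>, a letter \<open>i\<close> can occur only in row
  \<open>i\<close>. For \<open>i < k\<close> this is triangularity of the pattern. For
  \<open>k < i\<close>, goodness bounds the letters \<open>i\<close> in rows up to \<open>k\<close>
  by the letters \<open>i - 1\<close> in rows before \<open>k\<close>, of which there are none by
  induction.\<close>

lemma GT_good_zero:
  assumes G: "G \<in> GT L \<nu>" and good: "good L (\<lambda>_. 0) G"
  shows "i \<noteq> k \<Longrightarrow> i < L \<Longrightarrow> k < L \<Longrightarrow> G (Suc i) k = G i k"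
proof (induction k arbitrary: i rule: less_induct)
  case (less k)
  show ?case
  proof (cases "i < k")
    case True
    then show ?thesis using GT_zero[OF G, of "Suc i" k] GT_zero[OF G, of i k] less.prems by simp
  next
    case False
    then have i: "k < i" "0 < i" using less.prems by auto
    have "slack (\<lambda>_. 0) G i k \<le> 0"
      using good[unfolded good_def, rule_format, of k i] less.prems i by (simp add: violated_def)
    moreover have "G (Suc i) k' = G i k'" if "k' < k" for k'
      using that less.prems i by (intro less.IH) auto
    moreover have "G (i - 1) k' = G i k'" if "k' < k" for k'
      using less.IH[of k' "i - 1"] that less.prems i by auto
    ultimately have "int (G (Suc i) k) \<le> int (G i k)"
      by (simp add: slack_def lessThan_Suc_atMost[symmetric])
    then show ?thesis using GT_step[OF G, of i k] by simp
  qed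
qed

lemma GT_good_zero_eq:
  assumes G: "G \<in> GT L \<nu>" and good: "good L (\<lambda>_. 0) G" and \<nu>: "\<nu> \<in> Par L n"
  shows "G = (\<lambda>i k. if k < i then \<nu> k else 0)"
proof -
  have a: "G i k = \<nu> k" if "k < i" "i \<le> L" for i k
    using \<open>i \<le> L\<close> that
  proof (induction i rule: inc_induct)
    case base
    then show ?case using G by (simp add: GT_def)
  next
    case (step i)
    then show ?case using GT_good_zero[OF G good, of i k] by simp
  qed
  show ?thesis
  proof (intro ext)
    fix i k
    consider "i \<le> L" "k < i" | "i \<le> L" "i \<le> k" | "L < i" by linarith
    then show "G i k = (if k < i then \<nu> k else 0)"
      using a GT_zero[OF G] G \<nu> by cases (auto simp: GT_def Par_def)
  qed
qed

text \<open>The bialternant formula, as the product rule with empty \<open>\<mu>\<close>: the only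
  good pattern is that of the tableau whose row \<open>k\<close> consists of letters
  \<open>k\<close>, and its weight is \<open>\<nu>\<close>.\<close>

theorem schur_times_staircase:
  assumes \<nu>: "\<nu> \<in> Par L n"
  shows "schur L \<nu> x * alternant L (staircase L) x = alternant L (\<nu> \<boxplus> staircase L) x"
proof -
  let ?G = "\<lambda>i k. if k < i then \<nu> k else 0"
  let ?S = "{G \<in> GT L \<nu>. good L (\<lambda>_. 0) G}"
  have GT: "?G \<in> GT L \<nu>" using \<nu> by (auto simp: GT_def Par_def fun_eq_iff)
  have wt: "wt L ?G k = \<nu> k" if "k < L" for k
  proof -
    have "int (wt L ?G k) = (\<Sum>k'<L. if k' = k then int (\<nu> k) else 0)"
      unfolding wt_int[OF GT] sum_subtractf[symmetric] by (intro sum.cong) auto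
    then show ?thesis using that by simp
  qed
  have "good L (\<lambda>_. 0) ?G"
  proof -
    have "slack (\<lambda>_. 0) ?G j K \<le> 0" if "0 < j" for j K
    proof (cases "j \<le> K")
      case False
      have "(\<Sum>k\<le>K. int (?G (Suc j) k) - int (?G j k)) = 0"
        using False by (intro sum.neutral) auto
      moreover have "(\<Sum>k<K. int (?G (j - 1) k) - int (?G j k)) \<le> 0"
        by (intro sum_nonpos) auto
      ultimately show ?thesis by (simp add: slack_def)
    next
      case True
      have "(\<Sum>k\<le>K. int (?G (Suc j) k) - int (?G j k)) = (\<Sum>k\<le>K. if k = j then int (\<nu> j) else 0)"
        by (intro sum.cong) auto
      moreover have "(\<Sum>k<K. int (?G (j - 1) k) - int (?G j k)) = (\<Sum>k<K. if k = j - 1 then - int (\<nu> (j - 1)) else 0)"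
        using that by (intro sum.cong) auto
      moreover have "\<nu> j \<le> \<nu> (j - 1)" using Par_antimono[OF \<nu>] by simp
      moreover have "j - 1 < K" using True that by simp
      ultimately show ?thesis using True by (simp add: slack_def)
    qed
    then show ?thesis by (auto simp: good_def violated_def not_less)
  qed
  then have S: "?S = {?G}" using GT GT_good_zero_eq[OF _ _ \<nu>] by blast
  have "schur L \<nu> x * alternant L (staircase L) x =
      schur L \<nu> x * alternant L ((\<lambda>_. 0) \<boxplus> staircase L) x" by simp
  also have "\<dots> = (\<Sum>G\<in>?S. alternant L (((\<lambda>_. 0) \<boxplus> staircase L) \<boxplus> wt L G) x)"
    unfolding schur_times_alternant by (rule sum_GT_eq_sum_good) simp
  also have "\<dots> = alternant L (\<nu> \<boxplus> staircase L) x"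
    unfolding S by (simp, intro alternant_cong) (simp add: wt)
  finally show ?thesis .
qed

section \<open>Words fixed by a permutation\<close>

definition words :: "nat \<Rightarrow> nat set \<Rightarrow> (nat \<Rightarrow> nat) \<Rightarrow> (nat \<Rightarrow> nat) set" where
  "words m I s = {w \<in> I \<rightarrow>\<^sub>E {..<m}. \<forall>i\<in>I. w (s i) = w i}"

definition ct :: "nat set \<Rightarrow> (nat \<Rightarrow> nat) \<Rightarrow> nat \<Rightarrow> nat" where
  "ct I w c = card {i \<in> I. w i = c}"

definition wpow :: "nat set \<Rightarrow> (nat \<Rightarrow> nat) \<Rightarrow> (nat \<Rightarrow> real) \<Rightarrow> real" where
  "wpow I w x = (\<Prod>i\<in>I. x (w i))"

text \<open>The power sum polynomial of the cycle type of \<open>s\<close>, since a fixed word is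
  constant on cycles; also the trace, on words, of \<open>s\<close> combined with the diagonal
  matrix of \<open>x\<close>.\<close>

definition psum :: "nat \<Rightarrow> nat set \<Rightarrow> (nat \<Rightarrow> nat) \<Rightarrow> (nat \<Rightarrow> real) \<Rightarrow> real" where
  "psum m I s x = (\<Sum>w\<in>words m I s. wpow I w x)"

lemma finite_words [simp]: "finite I \<Longrightarrow> finite (words m I s)"
  by (rule finite_subset[of _ "I \<rightarrow>\<^sub>E {..<m}"]) (auto simp: words_def intro!: finite_PiE)

lemma wpow_xpow:
  assumes "finite I" "w \<in> I \<rightarrow>\<^sub>E {..<m}"
  shows "wpow I w x = xpow m (ct I w) x"
proof -
  have "wpow I w x = (\<Prod>c<m. \<Prod>i | i \<in> I \<and> w i = c. x (w i))"
    unfolding wpow_def by (rule prod.group[symmetric]) (use assms in auto)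
  also have "\<dots> = xpow m (ct I w) x"
    unfolding xpow_def ct_def by (intro prod.cong refl) simp
  finally show ?thesis .
qed

lemma sum_ct: "finite I \<Longrightarrow> w \<in> I \<rightarrow>\<^sub>E {..<m} \<Longrightarrow> (\<Sum>c<m. ct I w c) = card I"
  unfolding ct_def card_eq_sum by (rule sum.group) auto

lemma sum_words_perm:
  fixes h :: "(nat \<Rightarrow> nat) \<Rightarrow> real"
  assumes I: "finite I" and s: "s permutes I" and u: "u permutes {..<m}"
  shows "(\<Sum>w\<in>words m I s. wpow I w (x \<circ> u) * h (ct I w)) = (\<Sum>w\<in>words m I s. wpow I w x * h (ct I w \<circ> u))"
proof (rule sum.reindex_bij_witness[of _ "\<lambda>w. restrict (inv u \<circ> w) I" "\<lambda>w. restrict (u \<circ> w) I"])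
  have sI: "s i \<in> I" if "i \<in> I" for i using permutes_in_image[OF s] that by simp
  have um: "u c < m" if "c < m" for c using permutes_in_image[OF u, of c] that by simp
  have ium: "inv u c < m" if "c < m" for c using permutes_in_image[OF permutes_inv[OF u], of c] that by simp
  fix w assume w: "w \<in> words m I s"
  then have wE: "w \<in> extensional I" by (auto simp: words_def PiE_def)
  have wm: "w i < m" if "i \<in> I" for i using w that by (auto simp: words_def)
  show "restrict (inv u \<circ> restrict (u \<circ> w) I) I = w"
    using wE by (auto simp: fun_eq_iff extensional_def permutes_inverses[OF u])
  show "restrict (u \<circ> restrict (inv u \<circ> w) I) I = w"
    using wE by (auto simp: fun_eq_iff extensional_def permutes_inverses[OF u])
  show "restrict (u \<circ> w) I \<in> words m I s" "restrict (inv u \<circ> w) I \<in> words m I s"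
    using w by (auto simp: words_def sI um ium wm)
  have "ct I w = ct I (restrict (u \<circ> w) I) \<circ> u"
    unfolding ct_def using permutes_inj[OF u] by (auto simp: fun_eq_iff inj_eq intro!: arg_cong[where f = card])
  moreover have "wpow I (restrict (u \<circ> w) I) x = wpow I w (x \<circ> u)"
    unfolding wpow_def by (intro prod.cong) auto
  ultimately show "wpow I (restrict (u \<circ> w) I) x * h (ct I (restrict (u \<circ> w) I) \<circ> u) = wpow I w (x \<circ> u) * h (ct I w)"
    by simp
qed

text \<open>The statistic is twisted by \<open>u\<close> so that after relabelling the letters its
  value no longer depends on \<open>u\<close>, and the sum over \<open>u\<close> collapses to
  alternants. Constant \<open>h\<close> gives the product with \<open>psum\<close>; other
  \<open>h\<close> record weights that depend on the letter counts.\<close>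

lemma sum_words_alternant:
  assumes I: "finite I" and s: "s permutes I"
  shows "(\<Sum>u | u permutes {..<m}. of_int (sign u) * xpow m b (x \<circ> u) * (\<Sum>w\<in>words m I s. wpow I w x * h (ct I w \<circ> u)))
    = (\<Sum>w\<in>words m I s. h (ct I w) * alternant m (b \<boxplus> ct I w) x)"
proof -
  have "(\<Sum>u | u permutes {..<m}. of_int (sign u) * xpow m b (x \<circ> u) * (\<Sum>w\<in>words m I s. wpow I w x * h (ct I w \<circ> u)))
    = (\<Sum>u | u permutes {..<m}. \<Sum>w\<in>words m I s. h (ct I w) * (of_int (sign u) * xpow m (b \<boxplus> ct I w) (x \<circ> u)))"
    (is "(\<Sum>u\<in>?U. ?l u) = (\<Sum>u\<in>?U. ?r u)")
  proof (intro sum.cong refl)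
    fix u assume "u \<in> ?U"
    then have "?l u = of_int (sign u) * xpow m b (x \<circ> u) * (\<Sum>w\<in>words m I s. wpow I w (x \<circ> u) * h (ct I w))"
      using sum_words_perm[OF I s, of u m x h] by simp
    also have "\<dots> = ?r u"
      unfolding sum_distrib_left using I
      by (intro sum.cong refl) (auto simp: xpow_add words_def wpow_xpow[of I _ m])
    finally show "?l u = ?r u" .
  qed
  also have "\<dots> = (\<Sum>w\<in>words m I s. h (ct I w) * alternant m (b \<boxplus> ct I w) x)"
    unfolding alternant_def sum_distrib_left by (rule sum.swap)
  finally show ?thesis .
qed

lemma psum_times_alternant:
  assumes I: "finite I" and s: "s permutes I"
  shows "psum m I s x * alternant m b x = (\<Sum>w\<in>words m I s. alternant m (b \<boxplus> ct I w) x)"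
proof -
  have "psum m I s x * alternant m b x = (\<Sum>u | u permutes {..<m}. of_int (sign u) * xpow m b (x \<circ> u) * psum m I s x)"
    by (simp add: alternant_def sum_distrib_right mult.commute[of "psum m I s x"])
  then show ?thesis using sum_words_alternant[OF I s, of m b x "\<lambda>_. 1"] by (simp add: psum_def)
qed

section \<open>The sum of all transpositions\<close>

text \<open>
  As a polynomial in \<open>x c\<close> the alternant has degree at most \<open>m - 1\<close> and the roots \<open>x d\<close>, \<open>d \<noteq> c\<close>; the
  formula is its logarithmic derivative.
\<close>

lemma euler_staircase:
  assumes x: "generic m x" and c: "c < m"
  shows "(\<Sum>u | u permutes {..<m}. of_int (sign u) * real (staircase m (inv u c)) * xpow m (staircase m) (x \<circ> u))
     = alternant m (staircase m) x * (\<Sum>d\<in>{..<m} - {c}. x c / (x c - x d))"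
proof -
  let ?U = "{u. u permutes {..<m}}"
  let ?D = "{..<m} - {c}"
  \<comment> \<open>The part of the term of \<open>u\<close> that is free of \<open>x c\<close>;
    \<open>inv u c\<close> is the position at which this variable stands.\<close>
  define C where "C u = of_int (sign u) * (\<Prod>k\<in>{..<m} - {inv u c}. x (u k) ^ staircase m k)" for u
  define P where "P = (\<Sum>u\<in>?U. monom (C u) (staircase m (inv u c)))"
  have xpow: "of_int (sign u) * xpow m (staircase m) (x(c := t) \<circ> u) = C u * t ^ staircase m (inv u c)" if "u \<in> ?U" for u t
  proof -
    have u: "u permutes {..<m}" using that by simp
    have i: "inv u c < m" "u (inv u c) = c"
      using permutes_in_image[OF permutes_inv[OF u], of c] c permutes_inverses[OF u] by auto
    have ne: "u k \<noteq> c" if "k \<noteq> inv u c" for k using that permutes_inverses(2)[OF u, of k] by auto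
    have "xpow m (staircase m) (x(c := t) \<circ> u) = t ^ staircase m (inv u c) *
        (\<Prod>k\<in>{..<m} - {inv u c}. (x(c := t) \<circ> u) k ^ staircase m k)"
      unfolding xpow_def using i by (subst prod.remove[of _ "inv u c"]) auto
    also have "(\<Prod>k\<in>{..<m} - {inv u c}. (x(c := t) \<circ> u) k ^ staircase m k) = (\<Prod>k\<in>{..<m} - {inv u c}. x (u k) ^ staircase m k)"
      by (intro prod.cong refl) (auto simp: ne)
    finally have e: "xpow m (staircase m) (x(c := t) \<circ> u) = t ^ staircase m (inv u c) *
        (\<Prod>k\<in>{..<m} - {inv u c}. x (u k) ^ staircase m k)" .
    show ?thesis unfolding e C_def by (simp only: mult_ac)
  qed
  have P: "poly P t = alternant m (staircase m) (x(c := t))" for t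
    unfolding P_def poly_sum alternant_def by (intro sum.cong refl) (simp add: poly_monom xpow)
  have deg: "degree P \<le> m - 1"
    unfolding P_def
    by (intro degree_sum_le) (auto simp: staircase_def intro!: order.trans[OF degree_monom_le])
  define Q where "Q = (\<Prod>d\<in>?D. [:- x d, 1:])"
  have degQ: "degree Q = m - 1" unfolding Q_def using c by (subst degree_prod_sum_eq) auto
  have "lead_coeff Q = 1" unfolding Q_def by (subst lead_coeff_prod) simp
  then have cQ: "coeff Q (m - 1) = 1" by (simp add: degQ)
  define a where "a = coeff P (m - 1)"
  have zero: "poly P (x d) = 0" if "d \<in> ?D" for d
  proof -
    have "alternant m (staircase m) (x(c := x d)) =
        alternant m (staircase m) (x(c := x d) \<circ> swp c d)"
      by (rule arg_cong[where f = "alternant m (staircase m)"]) (auto simp: fun_eq_iff Transposition.transpose_def)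
    also have "\<dots> = of_int (sign (swp c d)) * alternant m (staircase m) (x(c := x d))"
      using that c by (intro alternant_perm_var permutes_swap_id) auto
    finally show ?thesis using that by (simp add: P sign_swap_id)
  qed
  have PQ: "P = Polynomial.smult a Q"
  proof (rule ccontr)
    assume ne: "P \<noteq> Polynomial.smult a Q"
    define R where "R = P - Polynomial.smult a Q"
    have R0: "R \<noteq> 0" using ne by (simp add: R_def)
    have "degree R \<le> m - 1" unfolding R_def using deg degQ by (intro degree_diff_le) (auto intro: order.trans[OF degree_smult_le])
    moreover have "coeff R (m - 1) = 0" using cQ by (simp add: R_def a_def)
    ultimately have "degree R < m - 1" using R0 by (metis le_neq_implies_less leading_coeff_0_iff)
    moreover have "card {t. poly R t = 0} \<le> degree R" using R0 by (rule poly_roots_degree)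
    moreover have "card (x ` ?D) \<le> card {t. poly R t = 0}"
      using zero by (intro card_mono poly_roots_finite R0) (auto simp: R_def Q_def poly_prod)
    moreover have "card (x ` ?D) = m - 1"
    proof -
      have "inj_on x ?D" using x by (auto simp: generic_def inj_on_def)
      then show ?thesis using c by (simp add: card_image)
    qed
    ultimately show False by simp
  qed
  have xc: "x c \<noteq> 0" using x c by (auto simp: generic_def)
  have ne: "x c - x d \<noteq> 0" if "d \<in> ?D" for d using x c that by (auto simp: generic_def inj_on_def)
  \<comment> \<open>Multiplying the derivative by the variable scales each monomial by its exponent
    of \<open>x c\<close>, which in the term of \<open>u\<close> is
    \<open>staircase m (inv u c)\<close>.\<close>
  have "(\<Sum>u\<in>?U. of_int (sign u) * real (staircase m (inv u c)) * xpow m (staircase m) (x \<circ> u)) =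
      x c * poly (pderiv P) (x c)"
  proof -
    have "x c * poly (pderiv P) (x c) = (\<Sum>u\<in>?U. x c * poly (pderiv (monom (C u) (staircase m (inv u c)))) (x c))"
      unfolding P_def by (simp add: pderiv_sum poly_sum sum_distrib_left del: pderiv_monom)
    also have "\<dots> = (\<Sum>u\<in>?U. of_int (sign u) * real (staircase m (inv u c)) * xpow m (staircase m) (x \<circ> u))"
    proof (intro sum.cong refl)
      fix u assume u: "u \<in> ?U"
      show "x c * poly (pderiv (monom (C u) (staircase m (inv u c)))) (x c) =
          of_int (sign u) * real (staircase m (inv u c)) * xpow m (staircase m) (x \<circ> u)"
        using xpow[OF u, of "x c"]
        by (cases "staircase m (inv u c)") (auto simp: pderiv_monom poly_monom mult_ac)
    qed
    finally show ?thesis by simp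
  qed
  also have "poly (pderiv P) (x c) = a * (\<Sum>d\<in>?D. \<Prod>d'\<in>?D - {d}. x c - x d')"
    unfolding PQ Q_def by (simp add: pderiv_smult pderiv_prod poly_sum poly_prod pderiv_pCons)
  also have "(\<Sum>d\<in>?D. \<Prod>d'\<in>?D - {d}. x c - x d') = (\<Sum>d\<in>?D. (\<Prod>d'\<in>?D. x c - x d') / (x c - x d))"
  proof (rule sum.cong[OF refl])
    fix d assume d: "d \<in> ?D"
    then have "(\<Prod>d'\<in>?D. x c - x d') = (x c - x d) * (\<Prod>d'\<in>?D - {d}. x c - x d')"
      by (intro prod.remove) auto
    then show "(\<Prod>d'\<in>?D - {d}. x c - x d') = (\<Prod>d'\<in>?D. x c - x d') / (x c - x d)"
      using ne[OF d] by simp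
  qed
  also have "x c * (a * \<dots>) = (a * (\<Prod>d'\<in>?D. x c - x d')) * (\<Sum>d\<in>?D. x c / (x c - x d))"
    by (simp add: sum_distrib_left mult_ac)
  also have "a * (\<Prod>d'\<in>?D. x c - x d') = alternant m (staircase m) x"
    using P[of "x c"] unfolding PQ Q_def by (simp add: poly_prod)
  finally show ?thesis .
qed

section \<open>Words fixed after composing with a transposition\<close>

lemma card_offdiag: "finite X \<Longrightarrow> card {(i, j). i \<in> X \<and> j \<in> X \<and> i \<noteq> j} = card X * card X - card X"
proof -
  assume X: "finite X"
  have "{(i, j). i \<in> X \<and> j \<in> X \<and> i \<noteq> j} = X \<times> X - (\<lambda>i. (i, i)) ` X" by auto
  then show ?thesis using X by (simp add: card_Diff_subset card_image inj_on_def card_cartesian_product image_subset_iff)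
qed

context
  fixes m :: nat and I :: "nat set" and s :: "nat \<Rightarrow> nat" and x :: "nat \<Rightarrow> real"
  assumes I: "finite I" and s: "s permutes I" and x: "generic m x"
begin

text \<open>
  The sum of the monomials over \<open>moves c d\<close> is the trace of \<open>s E\<^sub>c\<^sub>d E\<^sub>d\<^sub>c\<close> on words, where \<open>E\<^sub>d\<^sub>c\<close> replaces
  one letter \<open>c\<close> by \<open>d\<close> in all possible ways. Since \<open>s\<close> commutes with these operators, cyclicity of the
  trace relates \<open>moves c d\<close> to \<open>moves d c\<close>.
\<close>

definition moves :: "nat \<Rightarrow> nat \<Rightarrow> ((nat \<Rightarrow> nat) \<times> nat \<times> nat) set" where
  "moves c d = {(w, i, j). w \<in> I \<rightarrow>\<^sub>E {..<m} \<and> i \<in> I \<and> j \<in> I \<and> w i = c \<and> (w(i := d)) j = d \<and>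
     (\<forall>k\<in>I. w (s k) = (w(i := d, j := c)) k)}"

definition swaps :: "nat \<Rightarrow> nat \<Rightarrow> ((nat \<Rightarrow> nat) \<times> nat \<times> nat) set" where
  "swaps c d = {(w, i, j). i \<in> I \<and> j \<in> I \<and> i \<noteq> j \<and> w \<in> words m I (s \<circ> swp i j) \<and> w i = c \<and> w j = d}"

lemma s_in: "i \<in> I \<Longrightarrow> s i \<in> I" "i \<in> I \<Longrightarrow> inv s i \<in> I"
  using permutes_in_image[OF s] permutes_in_image[OF permutes_inv[OF s]] by simp_all

lemma words_transpose:
  assumes "i \<in> I" "j \<in> I"
  shows "w \<in> words m I (s \<circ> swp i j) \<longleftrightarrow>
    w \<in> I \<rightarrow>\<^sub>E {..<m} \<and> (\<forall>k\<in>I. w (s k) = w (swp i j k))"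
proof -
  have t: "swp i j k \<in> I" if "k \<in> I" for k
    using assms that by (auto simp: Transposition.transpose_def)
  show ?thesis unfolding words_def using t
    by (auto simp: transpose_involutory) (metis transpose_involutory)
qed

lemma finite_triples: "finite ((I \<rightarrow>\<^sub>E {..<m}) \<times> I \<times> I)"
  using I by (intro finite_cartesian_product finite_PiE) auto

lemma finite_swaps: "finite (swaps c d)"
  by (rule finite_subset[OF _ finite_triples]) (auto simp: swaps_def words_def)

text \<open>That is, \<open>x c\<close> times the partial derivative of \<open>psum m I s\<close> in
  the variable \<open>x c\<close>.\<close>

definition deg_sum :: "nat \<Rightarrow> real" where
  "deg_sum c = (\<Sum>w\<in>words m I s. real (ct I w c) * wpow I w x)"

definition swap_sum :: "nat \<Rightarrow> nat \<Rightarrow> real" where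
  "swap_sum c d = (\<Sum>(w, i, j)\<in>swaps c d. wpow I w x)"

text \<open>Moves through two different positions are exactly the \<open>swaps\<close>; a move that
  comes back at the same position is a word fixed by \<open>s\<close> with one letter
  \<open>c\<close> marked.\<close>

lemma sum_moves:
  assumes cd: "c \<noteq> d" "c < m"
  shows "(\<Sum>(w, i, j)\<in>moves c d. wpow I w x) = swap_sum c d + deg_sum c"
proof -
  let ?E = "(\<lambda>(w, i). (w, i, i)) ` (SIGMA w:words m I s. {i \<in> I. w i = c})"
  have "moves c d = swaps c d \<union> ?E"
  proof (intro equalityI subsetI)
    fix t assume "t \<in> moves c d"
    then obtain w i j where t: "t = (w, i, j)" and w: "w \<in> I \<rightarrow>\<^sub>E {..<m}" "i \<in> I" "j \<in> I" "w i = c" "(w(i := d)) j = d"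
      "\<forall>k\<in>I. w (s k) = (w(i := d, j := c)) k" by (auto simp: moves_def)
    show "t \<in> swaps c d \<union> ?E"
    proof (cases "i = j")
      case True
      then have "\<forall>k\<in>I. w (s k) = w k" using w by auto
      then show ?thesis using w t True by (auto simp: words_def image_iff)
    next
      case False
      then have "w j = d" using w by simp
      moreover have "\<forall>k\<in>I. w (s k) = w (swp i j k)"
        using w False \<open>w j = d\<close> by (auto simp: Transposition.transpose_def)
      ultimately show ?thesis using w t False by (simp add: swaps_def words_transpose)
    qed
  next
    fix t assume "t \<in> swaps c d \<union> ?E"
    then show "t \<in> moves c d"
    proof
      assume "t \<in> swaps c d"
      then obtain w i j where t: "t = (w, i, j)" and w: "i \<in> I" "j \<in> I" "i \<noteq> j"
        "w \<in> words m I (s \<circ> swp i j)" "w i = c" "w j = d" by (auto simp: swaps_def)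
      then have "w \<in> I \<rightarrow>\<^sub>E {..<m}" "\<forall>k\<in>I. w (s k) = w (swp i j k)"
        by (simp_all add: words_transpose)
      then show ?thesis using w t by (auto simp: moves_def Transposition.transpose_def)
    next
      assume "t \<in> ?E"
      then show ?thesis by (auto simp: moves_def words_def)
    qed
  qed
  moreover have "swaps c d \<inter> ?E = {}" by (auto simp: swaps_def)
  moreover have "finite ?E" using I by (intro finite_imageI finite_SigmaI) auto
  ultimately have "(\<Sum>(w, i, j)\<in>moves c d. wpow I w x) = swap_sum c d + (\<Sum>(w, i, j)\<in>?E. wpow I w x)"
    by (simp add: sum.union_disjoint finite_swaps swap_sum_def)
  also have "(\<Sum>(w, i, j)\<in>?E. wpow I w x) = (\<Sum>(w, i)\<in>(SIGMA w:words m I s. {i \<in> I. w i = c}). wpow I w x)"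
    by (subst sum.reindex) (auto simp: inj_on_def case_prod_unfold)
  also have "\<dots> = deg_sum c"
    using I by (subst sum.Sigma[symmetric]) (auto simp: deg_sum_def ct_def)
  finally show ?thesis .
qed

lemma wpow_upd: "i \<in> I \<Longrightarrow> wpow I (w(i := d)) x * x (w i) = wpow I w x * x d"
  unfolding wpow_def using I by (subst (1 2) prod.remove[of I i]) auto

text \<open>Cyclicity of the trace as a bijection: starting the cycle after the first replacement
  turns a move between \<open>c\<close> and \<open>d\<close> into one between \<open>d\<close> and
  \<open>c\<close>, and one factor \<open>x c\<close> of the monomial becomes \<open>x d\<close>.
  The position \<open>i\<close> reappears as \<open>inv s i\<close> because \<open>s\<close> has
  been passed.\<close>

lemma sum_moves_swap:
  assumes cd: "c < m" "d < m"
  shows "x d * (\<Sum>(w, i, j)\<in>moves c d. wpow I w x) = x c * (\<Sum>(w, i, j)\<in>moves d c. wpow I w x)"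
  unfolding sum_distrib_left
proof (rule sum.reindex_bij_witness[of _ "\<lambda>(u, k, l). (u(s l := c), s l, k)" "\<lambda>(w, i, j). (w(i := d), j, inv s i)"])
  fix t assume "t \<in> moves c d"
  then obtain w i j where t: "t = (w, i, j)" and w: "w \<in> I \<rightarrow>\<^sub>E {..<m}" "i \<in> I" "j \<in> I" "w i = c" "(w(i := d)) j = d"
    and e: "\<And>k. k \<in> I \<Longrightarrow> w (s k) = (w(i := d, j := c)) k" by (auto simp: moves_def)
  have si: "s (inv s i) = i" using permutes_inverses[OF s] by simp
  show "(case case t of (w, i, j) \<Rightarrow> (w(i := d), j, inv s i) of (u, k, l) \<Rightarrow> (u(s l := c), s l, k)) = t"
    using w by (auto simp: t si)
  have "(w(i := d)) (s k) = (w(i := d, j := c, inv s i := d)) k" if "k \<in> I" for k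
  proof (cases "k = inv s i")
    case False
    then have "s k \<noteq> i" using permutes_inverses[OF s] by auto
    then show ?thesis using e[OF that] False by simp
  qed (simp add: si)
  moreover have "(w(i := d, j := c)) (inv s i) = c"
    using e[of "inv s i"] s_in(2)[OF w(2)] w si by simp
  ultimately show "(case t of (w, i, j) \<Rightarrow> (w(i := d), j, inv s i)) \<in> moves d c"
    using w cd s_in by (auto simp: moves_def t)
  show "x c * (case case t of (w, i, j) \<Rightarrow> (w(i := d), j, inv s i) of (w, i, j) \<Rightarrow> wpow I w x) =
      x d * (case t of (w, i, j) \<Rightarrow> wpow I w x)"
    using wpow_upd[OF w(2), of w d] w by (simp add: t mult.commute)
next
  fix t assume "t \<in> moves d c"
  then obtain u k l where t: "t = (u, k, l)" and u: "u \<in> I \<rightarrow>\<^sub>E {..<m}" "k \<in> I" "l \<in> I" "u k = d" "(u(k := c)) l = c"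
    and e: "\<And>k'. k' \<in> I \<Longrightarrow> u (s k') = (u(k := c, l := d)) k'" by (auto simp: moves_def)
  have usl: "u (s l) = d" using e[OF u(3)] by simp
  have isl: "inv s (s l) = l" using permutes_inverses[OF s] by simp
  show "(case case t of (u, k, l) \<Rightarrow> (u(s l := c), s l, k) of (w, i, j) \<Rightarrow> (w(i := d), j, inv s i)) = t"
    using usl isl by (auto simp: t)
  have "(u(s l := c)) (s k') = (u(s l := c, s l := d, k := c)) k'" if "k' \<in> I" for k'
  proof (cases "k' = l")
    case True
    then show ?thesis using u usl by auto
  next
    case False
    then have "s k' \<noteq> s l" using permutes_inj[OF s] by (auto simp: inj_eq)
    then show ?thesis using e[OF that] False usl by auto
  qed
  then show "(case t of (u, k, l) \<Rightarrow> (u(s l := c), s l, k)) \<in> moves c d"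
    using u cd s_in usl by (auto simp: moves_def t)
qed

lemma swap_sum_sym: "swap_sum c d = swap_sum d c"
  unfolding swap_sum_def
  by (rule sum.reindex_bij_witness[of _ "\<lambda>(w, i, j). (w, j, i)" "\<lambda>(w, i, j). (w, j, i)"])
    (auto simp: swaps_def transpose_commute)

text \<open>Since \<open>S = swap_sum c d\<close> is symmetric, the two preceding identities give
  \<open>x d * (S + deg_sum c) = x c * (S + deg_sum d)\<close>, which is solvable at generic points.
  The split into two fractions prepares the sum over \<open>c\<close> and \<open>d\<close>.\<close>

lemma swap_sum_eq:
  assumes cd: "c \<noteq> d" "c < m" "d < m"
  shows "swap_sum c d = x c * deg_sum d / (x d - x c) + x d * deg_sum c / (x c - x d)"
proof -
  have "x d * (swap_sum c d + deg_sum c) = x c * (swap_sum c d + deg_sum d)"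
    using sum_moves_swap[of c d] sum_moves[of c d] sum_moves[of d c] swap_sum_sym[of c d] cd by simp
  then have "swap_sum c d * (x d - x c) = x c * deg_sum d - x d * deg_sum c" by (simp add: algebra_simps)
  moreover have ne: "x d - x c \<noteq> 0" "x c - x d \<noteq> 0" using x cd by (auto simp: generic_def inj_on_def)
  ultimately have "swap_sum c d = (x c * deg_sum d - x d * deg_sum c) / (x d - x c)" by (simp add: eq_divide_eq)
  also have "\<dots> = x c * deg_sum d / (x d - x c) + x d * deg_sum c / (x c - x d)"
    using ne by (simp add: diff_divide_distrib) (simp add: field_simps)
  finally show ?thesis .
qed

lemma swap_sum_pairs:
  "swap_sum c d = (\<Sum>(i, j)\<in>{(i, j). i \<in> I \<and> j \<in> I \<and> i \<noteq> j}.
     \<Sum>w | w \<in> words m I (s \<circ> swp i j) \<and> w i = c \<and> w j = d. wpow I w x)"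
proof -
  let ?O = "{(i, j). i \<in> I \<and> j \<in> I \<and> i \<noteq> j}"
  let ?W = "\<lambda>(i, j). {w \<in> words m I (s \<circ> swp i j). w i = c \<and> w j = d}"
  have fO: "finite ?O" by (rule finite_subset[of _ "I \<times> I"]) (use I in auto)
  have "swap_sum c d = (\<Sum>(p, w)\<in>Sigma ?O ?W. wpow I w x)"
    unfolding swap_sum_def
    by (rule sum.reindex_bij_witness[of _ "\<lambda>((i, j), w). (w, i, j)" "\<lambda>(w, i, j). ((i, j), w)"])
      (auto simp: swaps_def)
  also have "\<dots> = (\<Sum>p\<in>?O. \<Sum>w\<in>?W p. wpow I w x)"
    using fO I by (subst sum.Sigma) auto
  finally show ?thesis by (simp add: case_prod_unfold)
qed

text \<open>Exchanging two positions with the same letter leaves the word alone, so being fixed is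
  the condition for \<open>s\<close> itself; the coefficient counts ordered pairs of distinct
  positions carrying \<open>c\<close>.\<close>

lemma swap_sum_diag:
  "swap_sum c c = (\<Sum>w\<in>words m I s. (real (ct I w c) ^ 2 - real (ct I w c)) * wpow I w x)"
proof -
  let ?O = "{(i, j). i \<in> I \<and> j \<in> I \<and> i \<noteq> j}"
  have fO: "finite ?O" by (rule finite_subset[of _ "I \<times> I"]) (use I in auto)
  have *: "{w \<in> words m I (s \<circ> swp i j). w i = c \<and> w j = c} = {w \<in> words m I s. w i = c \<and> w j = c}"
    if "i \<in> I" "j \<in> I" for i j
  proof -
    have "w \<in> words m I (s \<circ> swp i j) \<longleftrightarrow> w \<in> words m I s" if "w i = c" "w j = c" for w
    proof -
      have "w (swp i j k) = w k" for k
        using that by (simp add: Transposition.transpose_def)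
      then show ?thesis unfolding words_transpose[OF \<open>i \<in> I\<close> \<open>j \<in> I\<close>] by (simp add: words_def)
    qed
    then show ?thesis by blast
  qed
  have "swap_sum c c = (\<Sum>(i, j)\<in>?O. \<Sum>w | w \<in> words m I s \<and> w i = c \<and> w j = c. wpow I w x)"
    unfolding swap_sum_pairs by (intro sum.cong refl) (auto simp: *)
  also have "\<dots> = (\<Sum>p\<in>?O. \<Sum>w\<in>words m I s. if w (fst p) = c \<and> w (snd p) = c then wpow I w x else 0)"
    using I by (simp add: case_prod_unfold sum.inter_filter)
  also have "\<dots> = (\<Sum>w\<in>words m I s. \<Sum>p\<in>?O. if w (fst p) = c \<and> w (snd p) = c then wpow I w x else 0)"
    by (rule sum.swap)
  also have "\<dots> = (\<Sum>w\<in>words m I s. (real (ct I w c) ^ 2 - real (ct I w c)) * wpow I w x)"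
  proof (intro sum.cong refl)
    fix w
    have "(\<Sum>p\<in>?O. if w (fst p) = c \<and> w (snd p) = c then wpow I w x else 0) =
        real (card {p \<in> ?O. w (fst p) = c \<and> w (snd p) = c}) * wpow I w x"
      using fO by (simp add: sum.inter_filter[symmetric])
    also have "{p \<in> ?O. w (fst p) = c \<and> w (snd p) = c} =
        {(i, j). i \<in> {i \<in> I. w i = c} \<and> j \<in> {i \<in> I. w i = c} \<and> i \<noteq> j}" by auto
    also have "card \<dots> = ct I w c * ct I w c - ct I w c"
      unfolding ct_def using I by (intro card_offdiag) simp
    also have "real \<dots> = real (ct I w c) ^ 2 - real (ct I w c)"
      by (simp add: of_nat_diff power2_eq_square)
    finally show "(\<Sum>p\<in>?O. if w (fst p) = c \<and> w (snd p) = c then wpow I w x else 0) =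
        (real (ct I w c) ^ 2 - real (ct I w c)) * wpow I w x" .
  qed
  finally show ?thesis .
qed

lemma sum_psum_transposes:
  "(\<Sum>(i, j)\<in>{(i, j). i \<in> I \<and> j \<in> I \<and> i \<noteq> j}. psum m I (s \<circ> swp i j) x)
    = (\<Sum>c<m. \<Sum>d<m. swap_sum c d)"
proof -
  let ?O = "{(i, j). i \<in> I \<and> j \<in> I \<and> i \<noteq> j}"
  let ?W = "\<lambda>p. words m I (s \<circ> swp (fst p) (snd p))"
  have "(\<Sum>c<m. \<Sum>d<m. swap_sum c d) = (\<Sum>q\<in>{..<m} \<times> {..<m}. \<Sum>p\<in>?O. \<Sum>w | w \<in> ?W p \<and> (w (fst p), w (snd p)) = q. wpow I w x)"
  proof -
    have "(\<Sum>c<m. \<Sum>d<m. f c d) = (\<Sum>q\<in>{..<m} \<times> {..<m}. f (fst q) (snd q))" for f :: "nat \<Rightarrow> nat \<Rightarrow> real"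
      by (simp add: sum.cartesian_product case_prod_unfold)
    then show ?thesis unfolding swap_sum_pairs by (simp add: case_prod_unfold prod_eq_iff)
  qed
  also have "\<dots> = (\<Sum>p\<in>?O. \<Sum>q\<in>{..<m} \<times> {..<m}. \<Sum>w | w \<in> ?W p \<and> (w (fst p), w (snd p)) = q. wpow I w x)"
    by (rule sum.swap)
  also have "\<dots> = (\<Sum>p\<in>?O. \<Sum>w\<in>?W p. wpow I w x)"
  proof (intro sum.cong refl)
    fix p assume p: "p \<in> ?O"
    show "(\<Sum>q\<in>{..<m} \<times> {..<m}. \<Sum>w | w \<in> ?W p \<and> (w (fst p), w (snd p)) = q. wpow I w x) = (\<Sum>w\<in>?W p. wpow I w x)"
    proof (rule sum.group)
      show "(\<lambda>w. (w (fst p), w (snd p))) ` ?W p \<subseteq> {..<m} \<times> {..<m}"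
        using p by (fastforce simp: words_def PiE_iff)
    qed (use I in auto)
  qed
  finally show ?thesis by (simp add: case_prod_unfold psum_def)
qed

lemma sum_deg_sum: "(\<Sum>c<m. deg_sum c) = real (card I) * psum m I s x"
proof -
  have "(\<Sum>c<m. deg_sum c) = (\<Sum>w\<in>words m I s. (\<Sum>c<m. real (ct I w c)) * wpow I w x)"
    unfolding deg_sum_def sum_distrib_right by (rule sum.swap)
  also have "\<dots> = (\<Sum>w\<in>words m I s. real (card I) * wpow I w x)"
  proof (intro sum.cong refl)
    fix w assume "w \<in> words m I s"
    then have "(\<Sum>c<m. ct I w c) = card I" using I by (intro sum_ct) (auto simp: words_def)
    then have "(\<Sum>c<m. real (ct I w c)) = real (card I)" by (metis of_nat_sum)
    then show "(\<Sum>c<m. real (ct I w c)) * wpow I w x = real (card I) * wpow I w x" by simp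
  qed
  finally show ?thesis by (simp add: psum_def sum_distrib_left)
qed

text \<open>The logarithmic derivative of the Vandermonde alternant brings down
  \<open>staircase m (inv u c)\<close> in the term of \<open>u\<close>. Summed against
  \<open>deg_sum c\<close>, this is a statistic of \<open>ct I w \<circ> u\<close>, the form that
  \<open>sum_words_alternant\<close> requires.\<close>

lemma sum_deg_sum_euler:
  "alternant m (staircase m) x * (\<Sum>c<m. deg_sum c * (\<Sum>d\<in>{..<m} - {c}. x c / (x c - x d)))
   = (\<Sum>w\<in>words m I s. (\<Sum>c<m. real (ct I w c) * real (staircase m c)) * alternant m (staircase m \<boxplus> ct I w) x)"
proof -
  let ?h = "\<lambda>g. \<Sum>c<m. real (g c) * real (staircase m c)"
  let ?U = "{u. u permutes {..<m}}"
  have "alternant m (staircase m) x * (\<Sum>c<m. deg_sum c * (\<Sum>d\<in>{..<m} - {c}. x c / (x c - x d)))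
      = (\<Sum>c<m. deg_sum c * (\<Sum>u\<in>?U. of_int (sign u) * real (staircase m (inv u c)) * xpow m (staircase m) (x \<circ> u)))"
    unfolding sum_distrib_left[where r = "alternant m (staircase m) x"]
    by (intro sum.cong refl) (simp add: euler_staircase[OF x])
  also have "\<dots> = (\<Sum>c<m. \<Sum>u\<in>?U. of_int (sign u) * xpow m (staircase m) (x \<circ> u) * (deg_sum c * real (staircase m (inv u c))))"
    by (simp add: sum_distrib_left mult_ac)
  also have "\<dots> = (\<Sum>u\<in>?U. of_int (sign u) * xpow m (staircase m) (x \<circ> u) * (\<Sum>c<m. deg_sum c * real (staircase m (inv u c))))"
    unfolding sum_distrib_left by (rule sum.swap)
  also have "\<dots> = (\<Sum>u\<in>?U. of_int (sign u) * xpow m (staircase m) (x \<circ> u) * (\<Sum>w\<in>words m I s. wpow I w x * ?h (ct I w \<circ> u)))"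
  proof (rule sum.cong[OF refl], rule arg_cong2[where f = "(*)", OF refl])
    fix u assume "u \<in> ?U"
    then have u: "u permutes {..<m}" by simp
    have "(\<Sum>c<m. deg_sum c * real (staircase m (inv u c))) =
        (\<Sum>w\<in>words m I s. \<Sum>c<m. wpow I w x * (real (ct I w c) * real (staircase m (inv u c))))"
      unfolding deg_sum_def sum_distrib_right by (subst sum.swap) (simp add: mult_ac)
    also have "\<dots> = (\<Sum>w\<in>words m I s. wpow I w x * ?h (ct I w \<circ> u))"
      unfolding sum_distrib_left[symmetric]
    proof (rule sum.cong[OF refl], rule arg_cong2[where f = "(*)", OF refl])
      fix w
      show "(\<Sum>c<m. real (ct I w c) * real (staircase m (inv u c))) = ?h (ct I w \<circ> u)"
        using sum.permute[OF u, of "\<lambda>c. real (ct I w c) * real (staircase m (inv u c))"]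
        by (simp add: permutes_inverses[OF u])
    qed
    finally show "(\<Sum>c<m. deg_sum c * real (staircase m (inv u c))) = (\<Sum>w\<in>words m I s. wpow I w x * ?h (ct I w \<circ> u))" .
  qed
  also have "\<dots> = (\<Sum>w\<in>words m I s. ?h (ct I w) * alternant m (staircase m \<boxplus> ct I w) x)"
    by (rule sum_words_alternant[OF I s])
  finally show ?thesis .
qed

lemma sum_diag_alternant:
  "alternant m (staircase m) x * (\<Sum>c<m. swap_sum c c)
   = (\<Sum>w\<in>words m I s. (\<Sum>c<m. real (ct I w c) ^ 2 - real (ct I w c)) * alternant m (staircase m \<boxplus> ct I w) x)"
proof -
  let ?h = "\<lambda>g :: nat \<Rightarrow> nat. \<Sum>c<m. real (g c) ^ 2 - real (g c)"
  let ?U = "{u. u permutes {..<m}}"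
  have "(\<Sum>c<m. swap_sum c c) = (\<Sum>w\<in>words m I s. wpow I w x * ?h (ct I w))"
    unfolding swap_sum_diag sum_distrib_left by (subst sum.swap) (simp add: mult_ac)
  then have "alternant m (staircase m) x * (\<Sum>c<m. swap_sum c c) =
      (\<Sum>u\<in>?U. of_int (sign u) * xpow m (staircase m) (x \<circ> u) * (\<Sum>w\<in>words m I s. wpow I w x * ?h (ct I w)))"
    by (simp add: alternant_def sum_distrib_right)
  also have "\<dots> = (\<Sum>u\<in>?U. of_int (sign u) * xpow m (staircase m) (x \<circ> u) * (\<Sum>w\<in>words m I s. wpow I w x * ?h (ct I w \<circ> u)))"
  proof (rule sum.cong[OF refl])
    fix u assume u: "u \<in> ?U"
    have "?h (ct I w) = ?h (ct I w \<circ> u)" for w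
      using sum.permute[of u "{..<m}" "\<lambda>c. real (ct I w c) ^ 2 - real (ct I w c)"] u by simp
    then show "of_int (sign u) * xpow m (staircase m) (x \<circ> u) * (\<Sum>w\<in>words m I s. wpow I w x * ?h (ct I w)) =
        of_int (sign u) * xpow m (staircase m) (x \<circ> u) * (\<Sum>w\<in>words m I s. wpow I w x * ?h (ct I w \<circ> u))"
      by simp
  qed
  also have "\<dots> = (\<Sum>w\<in>words m I s. ?h (ct I w) * alternant m (staircase m \<boxplus> ct I w) x)"
    by (rule sum_words_alternant[OF I s])
  finally show ?thesis .
qed

text \<open>Both halves of \<open>swap_sum_eq\<close> contribute equally by symmetry, and
  \<open>x d / (x c - x d) = x c / (x c - x d) - 1\<close>; the \<open>m - 1\<close> values of
  \<open>d\<close> produce the last term.\<close>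

lemma sum_swap_sum_off_diag:
  "(\<Sum>c<m. \<Sum>d\<in>{..<m} - {c}. swap_sum c d) =
   2 * (\<Sum>c<m. deg_sum c * (\<Sum>d\<in>{..<m} - {c}. x c / (x c - x d))) - 2 * (real m - 1) * (\<Sum>c<m. deg_sum c)"
proof -
  have conv: "(\<Sum>c<m. \<Sum>d\<in>{..<m} - {c}. f c d) = (\<Sum>c<m. \<Sum>d<m. if c = d then 0 else f c d)" for f :: "nat \<Rightarrow> nat \<Rightarrow> real"
  proof (rule sum.cong[OF refl])
    fix c assume c: "c \<in> {..<m}"
    have "(\<Sum>d<m. if c = d then 0 else f c d) = (\<Sum>d\<in>{..<m} - {c}. if c = d then 0 else f c d)"
      using c by (subst sum.remove[of _ c]) auto
    also have "\<dots> = (\<Sum>d\<in>{..<m} - {c}. f c d)" by (rule sum.cong) auto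
    finally show "(\<Sum>d\<in>{..<m} - {c}. f c d) = (\<Sum>d<m. if c = d then 0 else f c d)" ..
  qed
  have flip: "(\<Sum>c<m. \<Sum>d\<in>{..<m} - {c}. f c d) = (\<Sum>c<m. \<Sum>d\<in>{..<m} - {c}. f d c)" for f :: "nat \<Rightarrow> nat \<Rightarrow> real"
    unfolding conv by (subst sum.swap) (simp only: eq_commute)
  have "(\<Sum>c<m. \<Sum>d\<in>{..<m} - {c}. swap_sum c d) =
      (\<Sum>c<m. \<Sum>d\<in>{..<m} - {c}. x c * deg_sum d / (x d - x c)) + (\<Sum>c<m. \<Sum>d\<in>{..<m} - {c}. x d * deg_sum c / (x c - x d))"
    unfolding sum.distrib[symmetric] by (intro sum.cong refl) (auto intro!: swap_sum_eq)
  also have "(\<Sum>c<m. \<Sum>d\<in>{..<m} - {c}. x c * deg_sum d / (x d - x c)) = (\<Sum>c<m. \<Sum>d\<in>{..<m} - {c}. x d * deg_sum c / (x c - x d))"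
    by (rule flip)
  finally have "(\<Sum>c<m. \<Sum>d\<in>{..<m} - {c}. swap_sum c d) = 2 * (\<Sum>c<m. \<Sum>d\<in>{..<m} - {c}. x d * deg_sum c / (x c - x d))"
    by simp
  also have "(\<Sum>c<m. \<Sum>d\<in>{..<m} - {c}. x d * deg_sum c / (x c - x d)) =
      (\<Sum>c<m. deg_sum c * (\<Sum>d\<in>{..<m} - {c}. x c / (x c - x d)) - (real m - 1) * deg_sum c)"
  proof (intro sum.cong refl)
    fix c assume c: "c \<in> {..<m}"
    have "(\<Sum>d\<in>{..<m} - {c}. x d * deg_sum c / (x c - x d)) = (\<Sum>d\<in>{..<m} - {c}. deg_sum c * (x c / (x c - x d)) - deg_sum c)"
    proof (intro sum.cong refl)
      fix d assume "d \<in> {..<m} - {c}"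
      then have "x c - x d \<noteq> 0" using x c by (auto simp: generic_def inj_on_def)
      then show "x d * deg_sum c / (x c - x d) = deg_sum c * (x c / (x c - x d)) - deg_sum c"
        by (simp add: divide_simps) (simp add: algebra_simps)
    qed
    also have "\<dots> = deg_sum c * (\<Sum>d\<in>{..<m} - {c}. x c / (x c - x d)) - (real m - 1) * deg_sum c"
      using c by (simp add: sum_subtractf sum_distrib_left of_nat_diff)
    finally show "(\<Sum>d\<in>{..<m} - {c}. x d * deg_sum c / (x c - x d)) =
        deg_sum c * (\<Sum>d\<in>{..<m} - {c}. x c / (x c - x d)) - (real m - 1) * deg_sum c" .
  qed
  finally show ?thesis by (simp add: sum_subtractf sum.distrib sum_distrib_left algebra_simps)
qed

text \<open>Equal letters at the two positions contribute the quadratic part, different letters the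
  rest. The factor depends on a word only through its letter counts, and
  \<open>content_weight\<close> shows that it agrees for all words straightening to the same
  partition.\<close>

theorem sum_transposes_times_staircase:
  "(\<Sum>(i, j)\<in>{(i, j). i \<in> I \<and> j \<in> I \<and> i \<noteq> j}. psum m I (s \<circ> swp i j) x) * alternant m (staircase m) x
   = (\<Sum>w\<in>words m I s. ((\<Sum>c<m. real (ct I w c) ^ 2 - real (ct I w c)) + 2 * (\<Sum>c<m. real (ct I w c) * real (staircase m c))
        - 2 * (real m - 1) * real (card I)) * alternant m (staircase m \<boxplus> ct I w) x)"
proof -
  have "(\<Sum>c<m. \<Sum>d<m. swap_sum c d) = (\<Sum>c<m. swap_sum c c + (\<Sum>d\<in>{..<m} - {c}. swap_sum c d))"
    by (intro sum.cong refl) (auto intro!: sum.remove)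
  then have T: "(\<Sum>c<m. \<Sum>d<m. swap_sum c d) = (\<Sum>c<m. swap_sum c c) +
      (2 * (\<Sum>c<m. deg_sum c * (\<Sum>d\<in>{..<m} - {c}. x c / (x c - x d))) - 2 * (real m - 1) * (real (card I) * psum m I s x))"
    by (simp only: sum.distrib sum_swap_sum_off_diag sum_deg_sum)
  have "(\<Sum>(i, j)\<in>{(i, j). i \<in> I \<and> j \<in> I \<and> i \<noteq> j}. psum m I (s \<circ> swp i j) x) * alternant m (staircase m) x
    = alternant m (staircase m) x * (\<Sum>c<m. swap_sum c c) + 2 * (alternant m (staircase m) x * (\<Sum>c<m. deg_sum c * (\<Sum>d\<in>{..<m} - {c}. x c / (x c - x d))))
      - 2 * (real m - 1) * real (card I) * (psum m I s x * alternant m (staircase m) x)"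
    unfolding sum_psum_transposes T by (simp only: algebra_simps)
  moreover have "(\<Sum>w\<in>W. (q w + 2 * r w - k) * A w) = (\<Sum>w\<in>W. q w * A w) + 2 * (\<Sum>w\<in>W. r w * A w) - k * (\<Sum>w\<in>W. A w)"
    for W and q r A :: "(nat \<Rightarrow> nat) \<Rightarrow> real" and k
    by (simp add: algebra_simps sum.distrib sum_subtractf sum_distrib_left)
  ultimately show ?thesis
    by (simp only: sum_diag_alternant sum_deg_sum_euler psum_times_alternant[OF I s])
qed

end

section \<open>Characters\<close>

text \<open>The coefficients chosen here are unique by \<open>alternants_independent\<close>.\<close>

definition chi :: "nat \<Rightarrow> nat set \<Rightarrow> (nat \<Rightarrow> nat) \<Rightarrow> (nat \<Rightarrow> nat) \<Rightarrow> real" where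
  "chi m I s = (SOME c. \<forall>x. psum m I s x * alternant m (staircase m) x =
     (\<Sum>l\<in>Par m (card I). c l * alternant m (l \<boxplus> staircase m) x))"

text \<open>The sum of \<open>j - c\<close> over the cells \<open>(c, j)\<close>, evaluated row by
  row; \<open>Diag_content\<close> identifies it with \<open>Diag\<close>.\<close>

definition content :: "nat \<Rightarrow> (nat \<Rightarrow> nat) \<Rightarrow> real" where
  "content m l = (\<Sum>c<m. real (l c) * (real (l c) - 1) / 2 - real c * real (l c))"

lemma alternants_unique:
  assumes "\<And>x. generic m x \<Longrightarrow> (\<Sum>l\<in>Par m n. f l * alternant m (l \<boxplus> staircase m) x) = (\<Sum>l\<in>Par m n. g l * alternant m (l \<boxplus> staircase m) x)"
    and "l \<in> Par m n"
  shows "f l = g l"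
proof -
  have "f l - g l = 0"
  proof (rule alternants_independent[where f = "\<lambda>l. f l - g l", OF _ assms(2)])
    fix x assume "generic m x"
    from assms(1)[OF this] show "(\<Sum>l\<in>Par m n. (f l - g l) * alternant m (l \<boxplus> staircase m) x) = 0"
      by (simp add: left_diff_distrib sum_subtractf)
  qed
  then show ?thesis by simp
qed

lemma words_expansion:
  assumes I: "finite I" and s: "s permutes I"
  obtains C where
    "\<And>w x. w \<in> words m I s \<Longrightarrow> alternant m (staircase m \<boxplus> ct I w) x = (\<Sum>l\<in>Par m (card I). C w l * alternant m (l \<boxplus> staircase m) x)"
    "\<And>w l. w \<in> words m I s \<Longrightarrow> C w l \<noteq> (0::real) \<Longrightarrow>
      \<exists>u. u permutes {..<m} \<and> (\<forall>k<m. staircase m k + ct I w k = ((l \<boxplus> staircase m) \<circ> u) k)"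
proof -
  have "\<exists>c :: (nat \<Rightarrow> nat) \<Rightarrow> real. (\<forall>x. alternant m (staircase m \<boxplus> ct I w) x = (\<Sum>l\<in>Par m (card I). c l * alternant m (l \<boxplus> staircase m) x)) \<and>
     (\<forall>l. c l \<noteq> 0 \<longrightarrow> (\<exists>u. u permutes {..<m} \<and> (\<forall>k<m. staircase m k + ct I w k = ((l \<boxplus> staircase m) \<circ> u) k)))"
    if "w \<in> words m I s" for w
  proof -
    have "(\<Sum>k<m. ct I w k) = card I" using that I by (intro sum_ct) (auto simp: words_def)
    then have "(\<Sum>k<m. staircase m k + ct I w k) = card I + (\<Sum>k<m. staircase m k)" by (simp add: sum.distrib)
    from alternant_straighten[OF this] obtain c :: "(nat \<Rightarrow> nat) \<Rightarrow> real" where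
      c: "\<And>x. alternant m (staircase m \<boxplus> ct I w) x = (\<Sum>l\<in>Par m (card I). c l * alternant m (l \<boxplus> staircase m) x)"
      "\<And>l. c l \<noteq> 0 \<Longrightarrow> l \<in> Par m (card I) \<and> (\<exists>u. u permutes {..<m} \<and> (\<forall>k<m. staircase m k + ct I w k = ((l \<boxplus> staircase m) \<circ> u) k))"
      by blast
    show ?thesis by (rule exI[of _ c]) (use c in blast)
  qed
  then have "\<forall>w\<in>words m I s. \<exists>c :: (nat \<Rightarrow> nat) \<Rightarrow> real. (\<forall>x. alternant m (staircase m \<boxplus> ct I w) x = (\<Sum>l\<in>Par m (card I). c l * alternant m (l \<boxplus> staircase m) x)) \<and>
     (\<forall>l. c l \<noteq> 0 \<longrightarrow> (\<exists>u. u permutes {..<m} \<and> (\<forall>k<m. staircase m k + ct I w k = ((l \<boxplus> staircase m) \<circ> u) k)))"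
    by (rule ballI)
  from bchoice[OF this] obtain C where
    "\<forall>w\<in>words m I s. (\<forall>x. alternant m (staircase m \<boxplus> ct I w) x = (\<Sum>l\<in>Par m (card I). C w l * alternant m (l \<boxplus> staircase m) x)) \<and>
     (\<forall>l. C w l \<noteq> (0::real) \<longrightarrow> (\<exists>u. u permutes {..<m} \<and> (\<forall>k<m. staircase m k + ct I w k = ((l \<boxplus> staircase m) \<circ> u) k)))"
    by (rule exE)
  then show ?thesis using that by blast
qed

lemma psum_times_staircase:
  assumes I: "finite I" and s: "s permutes I"
  shows "psum m I s x * alternant m (staircase m) x = (\<Sum>l\<in>Par m (card I). chi m I s l * alternant m (l \<boxplus> staircase m) x)"
proof -
  obtain C :: "(nat \<Rightarrow> nat) \<Rightarrow> (nat \<Rightarrow> nat) \<Rightarrow> real" where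
    C: "\<And>w x. w \<in> words m I s \<Longrightarrow> alternant m (staircase m \<boxplus> ct I w) x = (\<Sum>l\<in>Par m (card I). C w l * alternant m (l \<boxplus> staircase m) x)"
    and "\<And>w l. w \<in> words m I s \<Longrightarrow> C w l \<noteq> 0 \<Longrightarrow>
      \<exists>u. u permutes {..<m} \<and> (\<forall>k<m. staircase m k + ct I w k = ((l \<boxplus> staircase m) \<circ> u) k)"
    by (rule words_expansion[OF I s, of m]) (rule that)
  have "psum m I s x * alternant m (staircase m) x =
      (\<Sum>l\<in>Par m (card I). (\<Sum>w\<in>words m I s. C w l) * alternant m (l \<boxplus> staircase m) x)" for x
  proof -
    have "psum m I s x * alternant m (staircase m) x =
        (\<Sum>w\<in>words m I s. \<Sum>l\<in>Par m (card I). C w l * alternant m (l \<boxplus> staircase m) x)"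
      unfolding psum_times_alternant[OF I s] by (rule sum.cong[OF refl]) (rule C)
    also have "\<dots> = (\<Sum>l\<in>Par m (card I). (\<Sum>w\<in>words m I s. C w l) * alternant m (l \<boxplus> staircase m) x)"
      unfolding sum_distrib_right by (rule sum.swap)
    finally show ?thesis .
  qed
  then have "\<exists>c. \<forall>x. psum m I s x * alternant m (staircase m) x =
     (\<Sum>l\<in>Par m (card I). c l * alternant m (l \<boxplus> staircase m) x)"
    by (intro exI[of _ "\<lambda>l. \<Sum>w\<in>words m I s. C w l"] allI)
  from someI_ex[OF this] show ?thesis unfolding chi_def by (rule spec)
qed

lemma chi_eqI:
  assumes I: "finite I" and s: "s permutes I" and l: "l \<in> Par m (card I)"
    and c: "\<And>x. generic m x \<Longrightarrow> psum m I s x * alternant m (staircase m) x = (\<Sum>l\<in>Par m (card I). c l * alternant m (l \<boxplus> staircase m) x)"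
  shows "chi m I s l = c l"
proof (rule alternants_unique[where f = "chi m I s" and g = c, OF _ l])
  fix x assume "generic m x"
  from c[OF this] show "(\<Sum>l\<in>Par m (card I). chi m I s l * alternant m (l \<boxplus> staircase m) x) = (\<Sum>l\<in>Par m (card I). c l * alternant m (l \<boxplus> staircase m) x)"
    by (simp only: psum_times_staircase[OF I s])
qed

text \<open>Up to terms free of \<open>g\<close>, the left side is
  \<open>\<Sum> (g + \<delta>)\<^sup>2 - \<Sum> g\<close>. Both sums are determined by the multiset
  of values of \<open>g + \<delta>\<close>, so \<open>g\<close> may be replaced by \<open>l\<close>,
  and the staircase then turns into the row index of the contents.\<close>

lemma content_weight:
  assumes l: "l \<in> Par m n" and u: "u permutes {..<m}"
    and eq: "\<forall>k<m. staircase m k + g k = ((l \<boxplus> staircase m) \<circ> u) k"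
  shows "(\<Sum>c<m. real (g c) ^ 2 - real (g c)) + 2 * (\<Sum>c<m. real (g c) * real (staircase m c)) - 2 * (real m - 1) * real n
    = 2 * content m l"
proof -
  let ?d = "\<lambda>c. real (staircase m c)"
  have sq: "(\<Sum>c<m. (?d c + real (g c)) ^ 2) = (\<Sum>c<m. (?d c + real (l c)) ^ 2)"
  proof -
    have "(\<Sum>c<m. (?d c + real (g c)) ^ 2) = (\<Sum>c<m. (real ((l \<boxplus> staircase m) (u c))) ^ 2)"
    proof (rule sum.cong[OF refl])
      fix c assume "c \<in> {..<m}"
      then have "staircase m c + g c = (l \<boxplus> staircase m) (u c)" using eq by simp
      then show "(?d c + real (g c)) ^ 2 = (real ((l \<boxplus> staircase m) (u c))) ^ 2"
        by (simp only: of_nat_add[symmetric])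
    qed
    also have "\<dots> = (\<Sum>c<m. (real ((l \<boxplus> staircase m) c)) ^ 2)"
      using sum.permute[OF u, of "\<lambda>c. (real ((l \<boxplus> staircase m) c)) ^ 2"] by (simp add: o_def)
    finally show ?thesis by (simp add: add.commute)
  qed
  have lin: "(\<Sum>c<m. real (g c)) = (\<Sum>c<m. real (l c))"
  proof -
    have "(\<Sum>c<m. staircase m c + g c) = (\<Sum>c<m. (l \<boxplus> staircase m) (u c))"
      using eq by (intro sum.cong) auto
    also have "\<dots> = (\<Sum>c<m. (l \<boxplus> staircase m) c)"
      using sum.permute[OF u, of "l \<boxplus> staircase m"] by (simp add: o_def)
    finally have "(\<Sum>c<m. g c) = (\<Sum>c<m. l c)" by (simp add: sum.distrib)
    then show ?thesis by (simp flip: of_nat_sum)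
  qed
  have n: "(\<Sum>c<m. real (l c)) = real n" using l by (simp add: Par_def flip: of_nat_sum)
  have d: "(\<Sum>c<m. real (l c) * ?d c) = (real m - 1) * real n - (\<Sum>c<m. real c * real (l c))"
  proof -
    have "(\<Sum>c<m. real (l c) * ?d c) = (\<Sum>c<m. (real m - 1) * real (l c) - real c * real (l c))"
      by (intro sum.cong refl) (auto simp: staircase_def of_nat_diff algebra_simps)
    then show ?thesis by (simp add: sum_subtractf sum_distrib_left[symmetric] n)
  qed
  have "(\<Sum>c<m. real (g c) ^ 2) + 2 * (\<Sum>c<m. real (g c) * ?d c) = (\<Sum>c<m. real (l c) ^ 2) + 2 * (\<Sum>c<m. real (l c) * ?d c)"
    using sq by (simp add: power2_sum sum.distrib sum_distrib_left mult_ac)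
  then have "(\<Sum>c<m. real (g c) ^ 2 - real (g c)) + 2 * (\<Sum>c<m. real (g c) * ?d c) - 2 * (real m - 1) * real n
     = (\<Sum>c<m. real (l c) ^ 2) - (\<Sum>c<m. real (l c)) - 2 * (\<Sum>c<m. real c * real (l c))"
    using d by (simp add: sum_subtractf lin algebra_simps)
  also have "\<dots> = 2 * content m l"
    unfolding content_def sum_distrib_left sum_subtractf[symmetric]
    by (intro sum.cong refl) (simp add: power2_eq_square algebra_simps)
  finally show ?thesis .
qed

text \<open>Every word that contributes to the coefficient of \<open>l\<close> carries the factor
  \<open>2 * content m l\<close>, so weighting word by word amounts to one scalar; uniqueness of
  coefficients of alternants transfers this to \<open>chi\<close>. The \<open>2\<close> comes from
  ordered pairs.\<close>

theorem chi_transposes: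
  assumes I: "finite I" and s: "s permutes I" and l: "l \<in> Par m (card I)"
  shows "(\<Sum>(i, j)\<in>{(i, j). i \<in> I \<and> j \<in> I \<and> i \<noteq> j}. chi m I (s \<circ> swp i j) l) = 2 * content m l * chi m I s l"
proof -
  let ?O = "{(i, j). i \<in> I \<and> j \<in> I \<and> i \<noteq> j}"
  let ?a = "\<lambda>l x. alternant m (l \<boxplus> staircase m) x"
  let ?t = "\<lambda>p. s \<circ> swp (fst p) (snd p)"
  obtain C :: "(nat \<Rightarrow> nat) \<Rightarrow> (nat \<Rightarrow> nat) \<Rightarrow> real" where
    C: "\<And>w x. w \<in> words m I s \<Longrightarrow> alternant m (staircase m \<boxplus> ct I w) x = (\<Sum>l\<in>Par m (card I). C w l * ?a l x)"
    and C0: "\<And>w l. w \<in> words m I s \<Longrightarrow> C w l \<noteq> 0 \<Longrightarrow>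
      \<exists>u. u permutes {..<m} \<and> (\<forall>k<m. staircase m k + ct I w k = ((l \<boxplus> staircase m) \<circ> u) k)"
    by (rule words_expansion[OF I s, of m]) (rule that)
  define e where "e w = (\<Sum>c<m. real (ct I w c) ^ 2 - real (ct I w c)) + 2 * (\<Sum>c<m. real (ct I w c) * real (staircase m c))
        - 2 * (real m - 1) * real (card I)" for w
  have eC: "e w * C w l = 2 * content m l * C w l" if "w \<in> words m I s" "l \<in> Par m (card I)" for w l
    using C0[OF that(1), of l] content_weight[OF that(2), of _ "ct I w"] by (cases "C w l = 0") (auto simp: e_def)
  have expand: "(\<Sum>w\<in>words m I s. h w * alternant m (staircase m \<boxplus> ct I w) x) = (\<Sum>l\<in>Par m (card I). (\<Sum>w\<in>words m I s. h w * C w l) * ?a l x)" for h x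
  proof -
    have "(\<Sum>w\<in>words m I s. h w * alternant m (staircase m \<boxplus> ct I w) x) = (\<Sum>w\<in>words m I s. \<Sum>l\<in>Par m (card I). h w * C w l * ?a l x)"
      by (rule sum.cong[OF refl]) (simp add: C sum_distrib_left mult.assoc)
    also have "\<dots> = (\<Sum>l\<in>Par m (card I). (\<Sum>w\<in>words m I s. h w * C w l) * ?a l x)"
      unfolding sum_distrib_right by (rule sum.swap)
    finally show ?thesis .
  qed
  have chi: "chi m I s l = (\<Sum>w\<in>words m I s. C w l)" if "l \<in> Par m (card I)" for l
    using expand[of "\<lambda>_. 1"] psum_times_alternant[OF I s] by (intro chi_eqI[OF I s that]) simp
  have "(\<lambda>l. \<Sum>p\<in>?O. chi m I (?t p) l) l = (\<lambda>l. \<Sum>w\<in>words m I s. e w * C w l) l"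
  proof (rule alternants_unique[OF _ l])
    fix x assume x: "generic m x"
    have "(\<Sum>l\<in>Par m (card I). (\<Sum>p\<in>?O. chi m I (?t p) l) * ?a l x) = (\<Sum>p\<in>?O. \<Sum>l\<in>Par m (card I). chi m I (?t p) l * ?a l x)"
      unfolding sum_distrib_right by (rule sum.swap)
    also have "\<dots> = (\<Sum>p\<in>?O. psum m I (?t p) x * alternant m (staircase m) x)"
    proof (rule sum.cong[OF refl])
      fix p assume "p \<in> ?O"
      then have "?t p permutes I" by (intro permutes_compose permutes_swap_id s) auto
      then show "(\<Sum>l\<in>Par m (card I). chi m I (?t p) l * ?a l x) = psum m I (?t p) x * alternant m (staircase m) x"
        by (simp only: psum_times_staircase[OF I])
    qed
    also have "\<dots> = (\<Sum>w\<in>words m I s. e w * alternant m (staircase m \<boxplus> ct I w) x)"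
      using sum_transposes_times_staircase[OF I s x] by (simp add: e_def sum_distrib_right case_prod_unfold)
    also have "\<dots> = (\<Sum>l\<in>Par m (card I). (\<Sum>w\<in>words m I s. e w * C w l) * ?a l x)" by (rule expand)
    finally show "(\<Sum>l\<in>Par m (card I). (\<Sum>p\<in>?O. chi m I (?t p) l) * ?a l x) =
        (\<Sum>l\<in>Par m (card I). (\<Sum>w\<in>words m I s. e w * C w l) * ?a l x)" .
  qed
  then show ?thesis using l by (simp add: chi eC sum_distrib_left case_prod_unfold)
qed

text \<open>Different indices may share an exponent vector, so only the total coefficient of each
  monomial vanishes. The alternant is cancelled here on the level of polynomials, so its zeros do no
  harm.\<close>

lemma monomial_sum_coefficients:
  assumes T: "finite T" and d: "inj_on d {..<m}"
    and zero: "\<And>x. generic m x \<Longrightarrow> (\<Sum>t\<in>T. f t * xpow m (g t) x) * alternant m d x = 0"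
  shows "(\<Sum>t | t \<in> T \<and> (\<forall>k<m. g t k = b k). f t) = 0"
proof (cases "\<exists>t\<in>T. \<forall>k<m. g t k = b k")
  case False
  then have "{t \<in> T. \<forall>k<m. g t k = b k} = {}" by blast
  then show ?thesis by (simp only: sum.empty)
next
  case True
  define r where "r t k = (if k < m then g t k else 0)" for t k
  define b' where "b' k = (if k < m then b k else 0)" for k
  have b': "b' \<in> r ` T"
  proof -
    obtain t where t: "t \<in> T" "\<forall>k<m. g t k = b k" using True by blast
    then have "b' = r t" by (auto simp: r_def b'_def fun_eq_iff)
    then show ?thesis using t by blast
  qed
  have "(\<lambda>c. \<Sum>t | t \<in> T \<and> r t = c. f t) b' = 0"
  proof (rule monomials_times_alternant_independent[where g = "\<lambda>c. c", OF _ _ d _ b'])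
    show "finite (r ` T)" using T by simp
    show "c = c'" if "c \<in> r ` T" "c' \<in> r ` T" "\<And>k. k < m \<Longrightarrow> c k = c' k" for c c'
      using that by (auto simp: r_def fun_eq_iff)
    fix x assume x: "generic m x"
    have "(\<Sum>c\<in>r ` T. (\<Sum>t | t \<in> T \<and> r t = c. f t) * xpow m c x) = (\<Sum>c\<in>r ` T. \<Sum>t | t \<in> T \<and> r t = c. f t * xpow m (r t) x)"
      by (simp add: sum_distrib_right)
    also have "\<dots> = (\<Sum>t\<in>T. f t * xpow m (r t) x)" by (rule sum.group[OF T]) (use T in auto)
    also have "\<dots> = (\<Sum>t\<in>T. f t * xpow m (g t) x)"
      by (intro sum.cong refl arg_cong2[where f = "(*)"] xpow_cong) (auto simp: r_def)
    finally show "(\<Sum>c\<in>r ` T. (\<Sum>t | t \<in> T \<and> r t = c. f t) * xpow m c x) * alternant m d x = 0"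
      using zero[OF x] by simp
  qed
  moreover have "{t \<in> T. r t = b'} = {t \<in> T. \<forall>k<m. g t k = b k}"
    by (auto simp: r_def b'_def fun_eq_iff)
  ultimately show ?thesis by simp
qed

section \<open>Schur expansion of power sums and the restriction rule\<close>

lemma inj_on_staircase: "inj_on (staircase m) {..<m}"
  by (auto simp: inj_on_def staircase_def)

lemma psum_schur_staircase:
  assumes I: "finite I" and s: "s permutes I"
  shows "psum m I s x * alternant m (staircase m) x = (\<Sum>\<nu>\<in>Par m (card I). chi m I s \<nu> * schur m \<nu> x) * alternant m (staircase m) x"
  unfolding psum_times_staircase[OF I s] sum_distrib_right
  by (intro sum.cong refl) (simp add: schur_times_staircase[symmetric])

text \<open>The hypothesis concerns generic points only, but it makes all total coefficients zero,
  and with them the sum at every point.\<close>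

lemma monomial_sum_zero:
  assumes T: "finite T" and d: "inj_on d {..<m}"
    and zero: "\<And>x. generic m x \<Longrightarrow> (\<Sum>t\<in>T. f t * xpow m (g t) x) * alternant m d x = 0"
  shows "(\<Sum>t\<in>T. f t * xpow m (g t) y) = 0"
proof -
  define r where "r t k = (if k < m then g t k else 0)" for t k
  have "(\<Sum>t\<in>T. f t * xpow m (g t) y) = (\<Sum>t\<in>T. f t * xpow m (r t) y)"
    by (intro sum.cong refl arg_cong2[where f = "(*)"] xpow_cong) (auto simp: r_def)
  also have "\<dots> = (\<Sum>c\<in>r ` T. \<Sum>t | t \<in> T \<and> r t = c. f t * xpow m (r t) y)"
    by (rule sum.group[OF T, symmetric]) (use T in auto)
  also have "\<dots> = (\<Sum>c\<in>r ` T. (\<Sum>t | t \<in> T \<and> (\<forall>k<m. g t k = c k). f t) * xpow m c y)"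
  proof (rule sum.cong[OF refl])
    fix c assume "c \<in> r ` T"
    then have "{t \<in> T. r t = c} = {t \<in> T. \<forall>k<m. g t k = c k}" by (auto simp: r_def fun_eq_iff)
    then have "(\<Sum>t | t \<in> T \<and> (\<forall>k<m. g t k = c k). f t) * xpow m c y = (\<Sum>t | t \<in> T \<and> r t = c. f t * xpow m c y)"
      by (simp add: sum_distrib_right)
    also have "\<dots> = (\<Sum>t | t \<in> T \<and> r t = c. f t * xpow m (r t) y)" by (rule sum.cong) auto
    finally show "(\<Sum>t | t \<in> T \<and> r t = c. f t * xpow m (r t) y) = (\<Sum>t | t \<in> T \<and> (\<forall>k<m. g t k = c k). f t) * xpow m c y" ..
  qed
  also have "\<dots> = 0" by (simp add: monomial_sum_coefficients[OF T d zero])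
  finally show ?thesis .
qed

context
  fixes m :: nat and I :: "nat set" and s :: "nat \<Rightarrow> nat"
  assumes I: "finite I" and s: "s permutes I"
begin

text \<open>Both sides of the Schur expansion are put into one signed sum of monomials, over fixed
  words and over pairs of a partition and a pattern. Its product with the Vandermonde alternant
  vanishes, which yields both the expansion and each of its coefficients.\<close>

private abbreviation "Idx \<equiv> words m I s <+> (SIGMA \<nu>:Par m (card I). GT m \<nu>)"

private definition coef :: "(nat \<Rightarrow> nat) + ((nat \<Rightarrow> nat) \<times> (nat \<Rightarrow> nat \<Rightarrow> nat)) \<Rightarrow> real"
  where "coef = case_sum (\<lambda>w. 1) (\<lambda>(\<nu>, G). - chi m I s \<nu>)"

private definition expo :: "(nat \<Rightarrow> nat) + ((nat \<Rightarrow> nat) \<times> (nat \<Rightarrow> nat \<Rightarrow> nat)) \<Rightarrow> nat \<Rightarrow> nat"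
  where "expo = case_sum (\<lambda>w. ct I w) (\<lambda>(\<nu>, G). wt m G)"

private lemma sum_Idx: "(\<Sum>t\<in>Idx. F t) = (\<Sum>w\<in>words m I s. F (Inl w)) + (\<Sum>\<nu>\<in>Par m (card I). \<Sum>G\<in>GT m \<nu>. F (Inr (\<nu>, G)))"
  for F :: "_ \<Rightarrow> real"
  using I by (simp add: sum.Plus sum.Sigma case_prod_unfold)

private lemma finite_Idx: "finite Idx"
  using I by simp

private lemma sum_coef: "(\<Sum>t\<in>Idx. coef t * xpow m (expo t) x) = psum m I s x - (\<Sum>\<nu>\<in>Par m (card I). chi m I s \<nu> * schur m \<nu> x)"
proof -
  have "(\<Sum>w\<in>words m I s. xpow m (ct I w) x) = psum m I s x"
    unfolding psum_def using I by (intro sum.cong) (auto simp: words_def wpow_xpow[of I _ m])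
  then show ?thesis unfolding sum_Idx
    by (simp add: coef_def expo_def schur_def sum_distrib_left sum_negf)
qed

private lemma sum_coef_zero: "(\<Sum>t\<in>Idx. coef t * xpow m (expo t) x) * alternant m (staircase m) x = 0"
  unfolding sum_coef left_diff_distrib psum_schur_staircase[OF I s] by simp

lemma psum_eq_schur: "psum m I s x = (\<Sum>\<nu>\<in>Par m (card I). chi m I s \<nu> * schur m \<nu> x)"
  using monomial_sum_zero[OF finite_Idx inj_on_staircase sum_coef_zero, of x] unfolding sum_coef by simp

text \<open>Comparison of the coefficients of the monomial with exponent \<open>b\<close>. With
  \<open>b\<close> constantly \<open>1\<close> and as many variables as points, this becomes the
  regular character.\<close>

lemma words_schur_coefficients:
  "real (card {w \<in> words m I s. \<forall>k<m. ct I w k = b k}) =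
     (\<Sum>\<nu>\<in>Par m (card I). chi m I s \<nu> * real (card {G \<in> GT m \<nu>. \<forall>k<m. wt m G k = b k}))"
proof -
  have "(\<Sum>t | t \<in> Idx \<and> (\<forall>k<m. expo t k = b k). coef t) = 0"
    by (rule monomial_sum_coefficients[OF finite_Idx inj_on_staircase sum_coef_zero])
  then have "(\<Sum>t\<in>Idx. if \<forall>k<m. expo t k = b k then coef t else 0) = 0"
    by (simp only: sum.inter_filter[OF finite_Idx])
  then have "(\<Sum>w\<in>words m I s. if \<forall>k<m. ct I w k = b k then 1 else 0) =
      (\<Sum>\<nu>\<in>Par m (card I). \<Sum>G\<in>GT m \<nu>. if \<forall>k<m. wt m G k = b k then chi m I s \<nu> else 0)"
    unfolding sum_Idx
    by (simp add: coef_def expo_def if_distrib[of uminus] sum_negf[symmetric] eq_neg_iff_add_eq_0[symmetric] cong: if_cong)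
  then show ?thesis
    using I by (simp add: mult.commute flip: sum.inter_filter)
qed

end

lemma psum_product:
  assumes I: "finite I" and J: "finite J" and IJ: "I \<inter> J = {}" and s: "s permutes I" and r: "r permutes J"
  shows "psum m (I \<union> J) (s \<circ> r) x = psum m I s x * psum m J r x"
proof -
  have sr: "(s \<circ> r) i = s i" if "i \<in> I" for i
    using that IJ permutes_not_in[OF r, of i] by (metis comp_apply disjoint_iff)
  have rs: "(s \<circ> r) j = r j" if "j \<in> J" for j
    using that IJ permutes_not_in[OF s, of "r j"] permutes_in_image[OF r, of j] by (metis comp_apply disjoint_iff)
  have sI: "s i \<in> I" if "i \<in> I" for i using permutes_in_image[OF s] that by simp
  have rJ: "r i \<in> J" if "i \<in> J" for i using permutes_in_image[OF r] that by simp
  have "psum m I s x * psum m J r x = (\<Sum>(w, v)\<in>words m I s \<times> words m J r. wpow I w x * wpow J v x)"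
    by (simp add: psum_def sum_product sum.cartesian_product)
  also have "\<dots> = psum m (I \<union> J) (s \<circ> r) x"
    unfolding psum_def
  proof (rule sum.reindex_bij_witness[of _ "\<lambda>w. (restrict w I, restrict w J)" "\<lambda>(w, v) i. if i \<in> I then w i else v i"])
    fix p assume "p \<in> words m I s \<times> words m J r"
    then obtain w v where p: "p = (w, v)" and w: "w \<in> words m I s" and v: "v \<in> words m J r" by auto
    let ?f = "\<lambda>i. if i \<in> I then w i else v i"
    have f: "(case p of (w, v) \<Rightarrow> \<lambda>i. if i \<in> I then w i else v i) = ?f" by (simp add: p)
    have J': "j \<notin> I" if "j \<in> J" for j using that IJ by auto
    show "(restrict (case p of (w, v) \<Rightarrow> \<lambda>i. if i \<in> I then w i else v i) I,
        restrict (case p of (w, v) \<Rightarrow> \<lambda>i. if i \<in> I then w i else v i) J) = p"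
      unfolding f using w v J' by (auto simp: p words_def PiE_def extensional_def fun_eq_iff)
    show "(case p of (w, v) \<Rightarrow> \<lambda>i. if i \<in> I then w i else v i) \<in> words m (I \<union> J) (s \<circ> r)"
      unfolding f words_def
    proof (intro CollectI conjI ballI)
      show "?f \<in> I \<union> J \<rightarrow>\<^sub>E {..<m}"
        using w v by (auto simp: words_def PiE_def extensional_def)
      fix i assume "i \<in> I \<union> J"
      then show "?f ((s \<circ> r) i) = ?f i"
      proof
        assume "i \<in> I"
        then show ?thesis using w sI unfolding sr[OF \<open>i \<in> I\<close>] by (simp add: words_def)
      next
        assume i: "i \<in> J"
        then have "?f (r i) = v (r i)" "?f i = v i" using J' rJ[OF i] by auto
        then show ?thesis using v i unfolding rs[OF i] by (simp add: words_def)
      qed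
    qed
    have "wpow (I \<union> J) ?f x = wpow I ?f x * wpow J ?f x"
      unfolding wpow_def by (rule prod.union_disjoint[OF I J IJ])
    also have "wpow I ?f x = wpow I w x" unfolding wpow_def by (rule prod.cong) auto
    also have "wpow J ?f x = wpow J v x" unfolding wpow_def using J' by (intro prod.cong) auto
    finally show "wpow (I \<union> J) (case p of (w, v) \<Rightarrow> \<lambda>i. if i \<in> I then w i else v i) x =
        (case p of (w, v) \<Rightarrow> wpow I w x * wpow J v x)" unfolding f by (simp add: p)
  next
    fix w assume w: "w \<in> words m (I \<union> J) (s \<circ> r)"
    show "(case (restrict w I, restrict w J) of (w, v) \<Rightarrow> \<lambda>i. if i \<in> I then w i else v i) = w"
      using w by (auto simp: words_def PiE_def extensional_def fun_eq_iff)
    have "w ((s \<circ> r) i) = w i" if "i \<in> I \<union> J" for i using w that unfolding words_def by blast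
    then have "w (s i) = w i" if "i \<in> I" for i using that sr[OF that] by (metis UnI1)
    moreover have "w (r i) = w i" if "i \<in> J" for i using that rs[OF that] \<open>\<And>i. i \<in> I \<union> J \<Longrightarrow> w ((s \<circ> r) i) = w i\<close> by (metis UnI2)
    ultimately show "(restrict w I, restrict w J) \<in> words m I s \<times> words m J r"
      using w sI rJ by (auto simp: words_def)
  qed
  finally show ?thesis ..
qed

text \<open>Power sums multiply over disjoint supports. Expanding one factor, times the Vandermonde
  alternant, in alternants and the other in Schur polynomials makes the product rule
  applicable.\<close>

theorem chi_product:
  assumes I: "finite I" and J: "finite J" and IJ: "I \<inter> J = {}" and s: "s permutes I" and r: "r permutes J"
    and l: "l \<in> Par m (card I + card J)"
  shows "chi m (I \<union> J) (s \<circ> r) l =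
    (\<Sum>\<mu>\<in>Par m (card I). \<Sum>\<nu>\<in>Par m (card J). real (lr_number m l \<mu> \<nu>) * chi m I s \<mu> * chi m J r \<nu>)"
proof (rule chi_eqI)
  show "finite (I \<union> J)" using I J by simp
  have card: "card (I \<union> J) = card I + card J" by (rule card_Un_disjoint[OF I J IJ])
  show "l \<in> Par m (card (I \<union> J))" using l card by simp
  show "s \<circ> r permutes I \<union> J"
    by (intro permutes_compose) (use s r in \<open>auto intro: permutes_subset\<close>)
  fix x
  let ?a = "\<lambda>l. alternant m (l \<boxplus> staircase m) x"
  let ?P = "Par m (card I)" and ?Q = "Par m (card J)" and ?R = "Par m (card I + card J)"
  have "psum m (I \<union> J) (s \<circ> r) x * alternant m (staircase m) x =
      psum m J r x * (\<Sum>\<mu>\<in>?P. chi m I s \<mu> * ?a \<mu>)"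
    unfolding psum_product[OF I J IJ s r] by (simp add: psum_times_staircase[OF I s, symmetric] mult_ac)
  also have "\<dots> = (\<Sum>\<mu>\<in>?P. \<Sum>\<nu>\<in>?Q. chi m I s \<mu> * chi m J r \<nu> * (schur m \<nu> x * ?a \<mu>))"
    unfolding psum_eq_schur[OF J r] by (subst sum.swap) (simp add: sum_product mult_ac)
  also have "\<dots> = (\<Sum>\<mu>\<in>?P. \<Sum>\<nu>\<in>?Q. \<Sum>l\<in>?R. chi m I s \<mu> * chi m J r \<nu> * (real (lr_number m l \<mu> \<nu>) * ?a l))"
    by (intro sum.cong refl) (simp add: schur_times_alternant_lr_number sum_distrib_left)
  also have "\<dots> = (\<Sum>l\<in>?R. \<Sum>\<mu>\<in>?P. \<Sum>\<nu>\<in>?Q. chi m I s \<mu> * chi m J r \<nu> * (real (lr_number m l \<mu> \<nu>) * ?a l))"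
    by (subst sum.swap[of _ ?R], subst sum.swap[of _ ?R]) simp
  also have "\<dots> = (\<Sum>l\<in>Par m (card (I \<union> J)). (\<Sum>\<mu>\<in>?P. \<Sum>\<nu>\<in>?Q. real (lr_number m l \<mu> \<nu>) * chi m I s \<mu> * chi m J r \<nu>) * ?a l)"
    unfolding card sum_distrib_right by (intro sum.cong refl) (simp only: mult_ac)
  finally show "psum m (I \<union> J) (s \<circ> r) x * alternant m (staircase m) x =
     (\<Sum>l\<in>Par m (card (I \<union> J)). (\<Sum>\<mu>\<in>?P. \<Sum>\<nu>\<in>?Q. real (lr_number m l \<mu> \<nu>) * chi m I s \<mu> * chi m J r \<nu>) * ?a l)" .
qed

section \<open>Dimensions\<close>

text \<open>For a partition \<open>l\<close>, the partitions of \<open>n\<close> that it covers in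
  Young's lattice.\<close>

definition lower :: "nat \<Rightarrow> nat \<Rightarrow> (nat \<Rightarrow> nat) \<Rightarrow> (nat \<Rightarrow> nat) set" where
  "lower m n l = {\<mu> \<in> Par m n. \<exists>c. l = \<mu>(c := Suc (\<mu> c))}"

text \<open>Only meaningful for \<open>l \<in> Par m n\<close>: the base case does not inspect \<open>l\<close>.\<close>

primrec paths :: "nat \<Rightarrow> nat \<Rightarrow> (nat \<Rightarrow> nat) \<Rightarrow> nat" where
  "paths m 0 l = 1"
| "paths m (Suc n) l = (\<Sum>\<mu>\<in>lower m n l. paths m n \<mu>)"

lemma finite_lower [simp]: "finite (lower m n l)"
  by (rule finite_subset[of _ "Par m n"]) (auto simp: lower_def)

lemma Par_0: "Par m 0 = {\<lambda>_. 0}"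
proof -
  have "f = (\<lambda>_. 0)" if "f \<in> Par m 0" for f
  proof
    fix k show "f k = 0" using that by (cases "k < m") (auto simp: Par_def)
  qed
  then show ?thesis by (auto simp: Par_def)
qed

lemma Par_upd_bound:
  assumes "l = \<mu>(c := Suc (\<mu> c))" "l \<in> Par m n"
  shows "c < m"
proof (rule ccontr)
  assume "\<not> c < m"
  then have "l c = 0" using assms(2) by (auto simp: Par_def)
  then show False using assms(1) by simp
qed

lemma sum_upd_Suc: "c < m \<Longrightarrow> (\<Sum>k<m. (\<mu>(c := Suc (\<mu> c))) k) = Suc (\<Sum>k<m. \<mu> k)" for \<mu> :: "nat \<Rightarrow> nat"
proof -
  assume c: "c < m"
  have "(\<Sum>k<m. (\<mu>(c := Suc (\<mu> c))) k) = (\<Sum>k<m. \<mu> k + (if k = c then 1 else 0))"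
    by (rule sum.cong) auto
  also have "\<dots> = Suc (\<Sum>k<m. \<mu> k)" using c by (subst sum.distrib) simp
  finally show ?thesis .
qed

lemma psum_insert:
  assumes I: "finite I" and i: "i \<notin> I"
  shows "psum m (insert i I) id x = (\<Sum>c<m. x c) * psum m I id x"
proof -
  have "psum m {i} id x = (\<Sum>c<m. x c)"
    unfolding psum_def
    by (rule sum.reindex_bij_witness[of _ "\<lambda>c. restrict (\<lambda>_. c) {i}" "\<lambda>w. w i"])
      (auto simp: words_def wpow_def PiE_def extensional_def fun_eq_iff)
  then show ?thesis
    using psum_product[OF _ I, of "{i}" id id m x] i by (simp add: permutes_id)
qed

lemma linear_times_alternant:
  "(\<Sum>c<m. x c) * alternant m b x = (\<Sum>c<m. alternant m (b \<boxplus> (\<lambda>k. if k = c then 1 else 0)) x)"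
proof (rule symmetric_times_alternant[where F = "\<lambda>x. \<Sum>c<m. x c"])
  show "(\<Sum>c<m. x c) = (\<Sum>c<m. xpow m (\<lambda>k. if k = c then 1 else 0) x)" for x :: "nat \<Rightarrow> real"
    unfolding xpow_def by (rule sum.cong) (auto simp: if_distrib[of "power _"] cong: if_cong)
  show "(\<Sum>c<m. (x \<circ> u) c) = (\<Sum>c<m. x c)" if "u permutes {..<m}" for u and x :: "nat \<Rightarrow> real"
    using sum.permute[OF that, of x] by simp
qed

text \<open>Pieri's rule for a single cell: each exponent in turn is raised by one, and the choices
  that break the partition shape drop out.\<close>

lemma linear_times_alternant_Par:
  assumes \<mu>: "\<mu> \<in> Par m n"
  shows "(\<Sum>c<m. x c) * alternant m (\<mu> \<boxplus> staircase m) x =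
    (\<Sum>l | l \<in> Par m (Suc n) \<and> \<mu> \<in> lower m n l. alternant m (l \<boxplus> staircase m) x)"
proof -
  let ?u = "\<lambda>c. \<mu>(c := Suc (\<mu> c))"
  let ?C = "{c. c < m \<and> ?u c \<in> Par m (Suc n)}"
  have "(\<Sum>c<m. x c) * alternant m (\<mu> \<boxplus> staircase m) x = (\<Sum>c<m. alternant m (?u c \<boxplus> staircase m) x)"
    unfolding linear_times_alternant
    by (intro sum.cong refl alternant_cong) auto
  also have "\<dots> = (\<Sum>c\<in>?C. alternant m (?u c \<boxplus> staircase m) x)"
  proof (rule sum.mono_neutral_right)
    show "\<forall>c\<in>{..<m} - ?C. alternant m (?u c \<boxplus> staircase m) x = 0"
    proof
      fix c assume c: "c \<in> {..<m} - ?C"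
      then have "?u c \<notin> Par m (Suc n)" and "c < m" by auto
      moreover have "?u c \<in> Par m (Suc n)" if "\<forall>k. ?u c (Suc k) \<le> ?u c k"
        unfolding Par_def
      proof (intro CollectI conjI)
        show "(\<Sum>k<m. ?u c k) = Suc n" using sum_upd_Suc[OF \<open>c < m\<close>, of \<mu>] \<mu> by (simp add: Par_def)
        show "\<forall>k\<ge>m. ?u c k = 0" using \<open>c < m\<close> \<mu> by (simp add: Par_def)
      qed (rule that)
      ultimately obtain k where k: "?u c k < ?u c (Suc k)" by (meson not_le)
      have le: "\<mu> (Suc k) \<le> \<mu> k" using \<mu> by (simp add: Par_def)
      have c': "c = Suc k" using k le by (auto split: if_splits)
      then have "\<mu> k = \<mu> (Suc k)" using k le by simp
      \<comment> \<open>Rows \<open>k\<close> and \<open>Suc k\<close> had equal length, so the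
        extra cell in the lower one makes up for the step of the staircase and two exponents
        coincide.\<close>
      then have "(?u c \<boxplus> staircase m) k = (?u c \<boxplus> staircase m) (Suc k)"
        using c' \<open>c < m\<close> by (simp add: staircase_def)
      then have "\<not> inj_on (?u c \<boxplus> staircase m) {..<m}"
        using c' \<open>c < m\<close> inj_onD[of "?u c \<boxplus> staircase m" "{..<m}" k "Suc k"] by auto
      then show "alternant m (?u c \<boxplus> staircase m) x = 0" by (rule alternant_eq_0)
    qed
  qed auto
  also have "\<dots> = (\<Sum>l | l \<in> Par m (Suc n) \<and> \<mu> \<in> lower m n l. alternant m (l \<boxplus> staircase m) x)"
  proof -
    have inj: "c = d" if "?u c = ?u d" for c d
      using fun_cong[OF that, of c] by (auto split: if_splits)
    have "{l. l \<in> Par m (Suc n) \<and> \<mu> \<in> lower m n l} = ?u ` ?C"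
      using \<mu> Par_upd_bound[of _ \<mu> _ m "Suc n"] by (auto simp: lower_def)
    then show ?thesis using inj by (simp add: sum.reindex inj_on_def)
  qed
  finally show ?thesis .
qed

text \<open>At the identity \<open>psum\<close> is a power of the sum of the variables, so adding a
  point to the set adds a cell to the partition, which is the recursion of
  \<open>paths\<close>.\<close>

theorem chi_id:
  assumes "finite I" "l \<in> Par m (card I)"
  shows "chi m I id l = real (paths m (card I) l)"
  using assms
proof (induction I arbitrary: l rule: finite_induct)
  case empty
  have "psum m {} id x = 1" for x
  proof -
    have "words m {} id = {\<lambda>_. undefined}" by (auto simp: words_def)
    then show ?thesis by (simp add: psum_def wpow_def)
  qed
  then have "chi m {} id l = 1"
    by (intro chi_eqI[where c = "\<lambda>_. 1"]) (use empty in \<open>auto simp: permutes_id Par_0\<close>)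
  then show ?case by (simp only: card.empty paths.simps of_nat_1)
next
  case (insert i I)
  let ?n = "card I"
  have card: "card (insert i I) = Suc ?n" using insert by simp
  have "chi m (insert i I) id l = (\<lambda>l. real (paths m (Suc ?n) l)) l"
  proof (rule chi_eqI)
    fix x
    let ?a = "\<lambda>l. alternant m (l \<boxplus> staircase m) x"
    have "psum m (insert i I) id x * alternant m (staircase m) x =
        (\<Sum>\<mu>\<in>Par m ?n. chi m I id \<mu> * ((\<Sum>c<m. x c) * ?a \<mu>))"
      using psum_times_staircase[OF insert(1), of id m x]
      by (simp add: psum_insert[OF insert(1,2)] permutes_id mult.assoc sum_distrib_left mult_ac)
    also have "\<dots> = (\<Sum>\<mu>\<in>Par m ?n. \<Sum>l | l \<in> Par m (Suc ?n) \<and> \<mu> \<in> lower m ?n l. real (paths m ?n \<mu>) * ?a l)"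
      by (intro sum.cong refl) (simp add: linear_times_alternant_Par insert.IH sum_distrib_left)
    also have "\<dots> = (\<Sum>l\<in>Par m (Suc ?n). \<Sum>\<mu> | \<mu> \<in> Par m ?n \<and> \<mu> \<in> lower m ?n l. real (paths m ?n \<mu>) * ?a l)"
      by (rule sum.swap_restrict) simp_all
    also have "\<dots> = (\<Sum>l\<in>Par m (Suc ?n). real (paths m (Suc ?n) l) * ?a l)"
    proof (rule sum.cong[OF refl])
      fix l
      have "{\<mu>. \<mu> \<in> Par m ?n \<and> \<mu> \<in> lower m ?n l} = lower m ?n l" by (auto simp: lower_def)
      then show "(\<Sum>\<mu> | \<mu> \<in> Par m ?n \<and> \<mu> \<in> lower m ?n l. real (paths m ?n \<mu>) * ?a l) = real (paths m (Suc ?n) l) * ?a l"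
        by (simp add: sum_distrib_right)
    qed
    finally show "psum m (insert i I) id x * alternant m (staircase m) x =
       (\<Sum>l\<in>Par m (card (insert i I)). real (paths m (Suc ?n) l) * ?a l)" unfolding card .
    show "finite (insert i I)" using insert by simp
    show "id permutes insert i I" by (rule permutes_id)
    show "l \<in> Par m (card (insert i I))" by (rule insert.prems)
  qed
  then show ?case by (simp only: card)
qed

section \<open>Patterns of weight one\<close>

text \<open>A nonempty row \<open>k \<ge> n\<close> would force \<open>k + 1 > n\<close> nonempty
  rows. This decouples the number of variables from the size of the partition.\<close>

lemma Par_eq_Par_self: "n \<le> m \<Longrightarrow> Par m n = Par n n"
proof (intro equalityI subsetI)
  fix l assume nm: "n \<le> m" and l: "l \<in> Par m n"
  have z: "l k = 0" if "n \<le> k" for k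
  proof (rule ccontr)
    assume "l k \<noteq> 0"
    then have "1 \<le> l j" if "j \<le> k" for j using Par_antimono[OF l that] by simp
    moreover have "k < m" using l \<open>l k \<noteq> 0\<close> not_less[of k m] by (auto simp: Par_def)
    ultimately have "(\<Sum>j<Suc k. 1) \<le> (\<Sum>j<Suc k. l j)" by (intro sum_mono) auto
    also have "\<dots> \<le> (\<Sum>j<m. l j)" using \<open>k < m\<close> by (intro sum_mono2) auto
    finally show False using l that by (simp add: Par_def)
  qed
  have "(\<Sum>k<n. l k) = (\<Sum>k<m. l k)" using nm z by (intro sum.mono_neutral_left) auto
  then show "l \<in> Par n n" using l z by (simp add: Par_def)
next
  fix l assume nm: "n \<le> m" and l: "l \<in> Par n n"
  have "(\<Sum>k<n. l k) = (\<Sum>k<m. l k)" using nm l by (intro sum.mono_neutral_left) (auto simp: Par_def)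
  then show "l \<in> Par m n" using l nm by (simp add: Par_def)
qed

text \<open>Standard tableaux, as chains of partitions growing by one cell.\<close>

definition GT1 :: "nat \<Rightarrow> (nat \<Rightarrow> nat) \<Rightarrow> (nat \<Rightarrow> nat \<Rightarrow> nat) set" where
  "GT1 L \<nu> = {G \<in> GT L \<nu>. \<forall>i<L. wt L G i = 1}"

lemma GT1_0: "GT1 0 (\<lambda>_. 0) = {\<lambda>_ _. 0}"
proof -
  have "G \<in> GT1 0 (\<lambda>_. 0) \<longleftrightarrow> (\<forall>i. G i = (\<lambda>_. 0))" for G by (auto simp add: GT1_def GT_def)
  then show ?thesis by auto
qed

lemma GT_restrict:
  assumes G: "G \<in> GT (Suc L) \<nu>"
  shows "(\<lambda>i. G (min i L)) \<in> GT L (G L)"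
proof -
  have "G (Suc i) (Suc k) \<le> G i k \<and> G i k \<le> G (Suc i) k" if "i < L" for i k
    using G that by (simp add: GT_def)
  moreover have "G 0 = (\<lambda>_. 0)" using G by (simp add: GT_def)
  ultimately show ?thesis by (simp add: GT_def)
qed

lemma GT_extend:
  assumes G: "G \<in> GT L \<kappa>" and \<nu>: "\<And>k. \<kappa> k \<le> \<nu> k" "\<And>k. \<nu> (Suc k) \<le> \<kappa> k"
  shows "(\<lambda>i. if i \<le> L then G i else \<nu>) \<in> GT (Suc L) \<nu>"
proof -
  have "G (Suc i) (Suc k) \<le> G i k \<and> G i k \<le> G (Suc i) k" if "i < L" for i k
    using G that by (simp add: GT_def)
  moreover have "G 0 = (\<lambda>_. 0)" "G L = \<kappa>" using G by (simp_all add: GT_def)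
  ultimately show ?thesis using \<nu> by (auto simp: GT_def less_Suc_eq)
qed

lemma interlace_lower:
  assumes \<kappa>: "\<kappa> \<in> lower m n \<nu>" and \<nu>: "\<nu> \<in> Par m (Suc n)"
  shows "\<kappa> k \<le> \<nu> k" "\<nu> (Suc k) \<le> \<kappa> k"
proof -
  obtain c where c: "\<nu> = \<kappa>(c := Suc (\<kappa> c))" and p: "\<kappa> \<in> Par m n" using \<kappa> by (auto simp: lower_def)
  show "\<kappa> k \<le> \<nu> k" using c by simp
  have "\<kappa> (Suc k) \<le> \<kappa> k" "\<nu> (Suc k) \<le> \<nu> k" using p \<nu> by (auto simp: Par_def)
  then show "\<nu> (Suc k) \<le> \<kappa> k" using c by (auto split: if_splits)
qed

lemma lower_if_sum:
  assumes le: "\<And>k. \<kappa> k \<le> \<nu> k" and \<kappa>: "\<kappa> \<in> Par m n" and \<nu>: "\<nu> \<in> Par m (Suc n)"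
  shows "\<kappa> \<in> lower m n \<nu>"
proof -
  have "(\<Sum>k<m. \<kappa> k) < (\<Sum>k<m. \<nu> k)" using \<kappa> \<nu> by (simp add: Par_def)
  then have "\<exists>c\<in>{..<m}. \<kappa> c < \<nu> c"
    using sum_mono[of "{..<m}" \<nu> \<kappa>] by (meson not_less)
  then obtain c where c: "c < m" "\<kappa> c < \<nu> c" by auto
  let ?k = "\<kappa>(c := Suc (\<kappa> c))"
  have le': "?k k \<le> \<nu> k" for k using le[of k] c by auto
  have "?k k = \<nu> k" if "k < m" for k
  proof (rule ccontr)
    assume "?k k \<noteq> \<nu> k"
    then have "?k k < \<nu> k" using le'[of k] by simp
    then have "(\<Sum>k<m. ?k k) < (\<Sum>k<m. \<nu> k)"
    proof (intro sum_strict_mono_ex1)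
      show "\<exists>k\<in>{..<m}. ?k k < \<nu> k" using that \<open>?k k < \<nu> k\<close> by blast
    qed (use le' in auto)
    then show False using sum_upd_Suc[OF c(1), of \<kappa>] \<kappa> \<nu> by (simp add: Par_def)
  qed
  moreover have "?k k = \<nu> k" if "m \<le> k" for k using that c \<kappa> \<nu> by (simp add: Par_def)
  ultimately have "\<nu> k = ?k k" for k by (cases "k < m") (simp_all only: not_less)
  then have "\<nu> = ?k" by (rule ext)
  then show ?thesis using \<kappa> by (auto simp: lower_def)
qed

lemma wt_restrict:
  assumes G: "G \<in> GT (Suc L) \<nu>" and i: "i < L"
  shows "wt L (\<lambda>i. G (min i L)) i = wt (Suc L) G i"
proof -
  have "G (Suc i) L = 0" "G i L = 0" using GT_zero[OF G, of "Suc i" L] GT_zero[OF G, of i L] i by auto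
  then show ?thesis using i by (simp add: wt_def min_def)
qed

lemma GT1_Par:
  assumes G: "G \<in> GT1 L \<nu>" and \<nu>: "\<And>k. \<nu> (Suc k) \<le> \<nu> k"
  shows "\<nu> \<in> Par L L"
proof -
  have g: "G \<in> GT L \<nu>" using G by (simp add: GT1_def)
  have "(\<Sum>i<L. wt L G i) = L" using G by (simp add: GT1_def)
  then have "(\<Sum>k<L. \<nu> k) = L" using sum_wt[OF g, of L] g by (simp add: GT_def)
  moreover have "\<nu> k = 0" if "L \<le> k" for k using GT_zero[OF g, of L k] that g by (simp add: GT_def)
  ultimately show ?thesis using \<nu> by (simp add: Par_def)
qed

text \<open>Deleting the top layer removes one cell from the shape, so the recursion is that of
  \<open>paths\<close>. The multilinear coefficient of a Schur polynomial is thereby a number of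
  paths.\<close>

theorem card_GT1:
  assumes "n \<le> m" "\<nu> \<in> Par n n"
  shows "card (GT1 n \<nu>) = paths m n \<nu>"
  using assms
proof (induction n arbitrary: \<nu>)
  case 0
  then show ?case using GT1_0 by (simp add: Par_0)
next
  case (Suc n)
  have \<nu>: "\<nu> \<in> Par m (Suc n)" using Suc.prems Par_eq_Par_self[of "Suc n" m] by simp
  have low: "lower m n \<nu> \<subseteq> Par n n" using Par_eq_Par_self[of n m] Suc.prems by (auto simp: lower_def)
  let ?ext = "\<lambda>G i. if i \<le> n then G i else \<nu>"
  let ?S = "SIGMA \<kappa>:lower m n \<nu>. GT1 n \<kappa>"
  have "bij_betw (\<lambda>(\<kappa>, G). ?ext G) ?S (GT1 (Suc n) \<nu>)"
  proof (rule bij_betw_byWitness[where f' = "\<lambda>G. (G n, \<lambda>i. G (min i n))"])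
    show "\<forall>p\<in>?S. (\<lambda>G. (G n, \<lambda>i. G (min i n))) ((\<lambda>(\<kappa>, G). ?ext G) p) = p"
      by (auto simp: GT1_def GT_def fun_eq_iff min_def)
    show "\<forall>G\<in>GT1 (Suc n) \<nu>. (\<lambda>(\<kappa>, G). ?ext G) ((\<lambda>G. (G n, \<lambda>i. G (min i n))) G) = G"
      by (auto simp: GT1_def GT_def fun_eq_iff min_def)
    show "(\<lambda>(\<kappa>, G). ?ext G) ` ?S \<subseteq> GT1 (Suc n) \<nu>"
    proof safe
      fix \<kappa> G assume k: "\<kappa> \<in> lower m n \<nu>" and G1: "G \<in> GT1 n \<kappa>"
      then have G: "G \<in> GT n \<kappa>" by (simp add: GT1_def)
      have E: "?ext G \<in> GT (Suc n) \<nu>" by (rule GT_extend[OF G interlace_lower[OF k \<nu>]])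
      have "wt (Suc n) (?ext G) i = 1" if "i < Suc n" for i
      proof (cases "i < n")
        case True
        have "(\<lambda>i. ?ext G (min i n)) = G" using G by (auto simp: fun_eq_iff min_def GT_def)
        then show ?thesis using wt_restrict[OF E True] G1 True by (simp add: GT1_def)
      next
        case False
        then have i: "i = n" using that by simp
        have "\<kappa> \<in> Par n n" using k low by auto
        then show ?thesis using Suc.prems G unfolding wt_def i by (simp add: Par_def GT_def)
      qed
      then show "?ext G \<in> GT1 (Suc n) \<nu>" using E by (simp add: GT1_def)
    qed
    show "(\<lambda>G. (G n, \<lambda>i. G (min i n))) ` GT1 (Suc n) \<nu> \<subseteq> ?S"
    proof (clarify, intro conjI)
      fix G assume G1: "G \<in> GT1 (Suc n) \<nu>"
      then have G: "G \<in> GT (Suc n) \<nu>" by (simp add: GT1_def)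
      have R: "(\<lambda>i. G (min i n)) \<in> GT1 n (G n)"
        using GT_restrict[OF G] wt_restrict[OF G] G1 by (simp add: GT1_def)
      then show "(\<lambda>i. G (min i n)) \<in> GT1 n (G n)" .
      have i: "G (Suc n) = \<nu>" "\<And>k. G (Suc n) (Suc k) \<le> G n k" "\<And>k. G n k \<le> G (Suc n) k"
        using G by (auto simp: GT_def)
      have "G n (Suc k) \<le> G n k" for k using i(2)[of k] i(3)[of "Suc k"] by simp
      then have "G n \<in> Par n n" using R GT1_Par by blast
      then have "G n \<in> Par m n" using Par_eq_Par_self[of n m] Suc.prems by simp
      then show "G n \<in> lower m n \<nu>" using i \<nu> by (intro lower_if_sum) auto
    qed
  qed
  then have "card (GT1 (Suc n) \<nu>) = card ?S" by (simp add: bij_betw_same_card)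
  also have "\<dots> = (\<Sum>\<kappa>\<in>lower m n \<nu>. card (GT1 n \<kappa>))"
    by (rule card_SigmaI) (auto simp: GT1_def)
  also have "\<dots> = paths m (Suc n) \<nu>" using Suc.IH low Suc.prems by (auto intro!: sum.cong)
  finally show ?case .
qed

section \<open>Standard tableaux\<close>

definition shape_cells :: "(nat \<Rightarrow> nat) \<Rightarrow> (nat \<times> nat) set" where
  "shape_cells l = {(i, j). j < l i}"

definition standard_fillings :: "nat \<Rightarrow> (nat \<Rightarrow> nat) \<Rightarrow> (nat \<times> nat \<Rightarrow> nat) set" where
  "standard_fillings n l = {T \<in> extensional (shape_cells l). bij_betw T (shape_cells l) {1..n} \<and>
     (\<forall>i j j'. j < j' \<and> j' < l i \<longrightarrow> T (i, j) < T (i, j')) \<and>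
     (\<forall>i i' j. i < i' \<and> j < l i \<and> j < l i' \<longrightarrow> T (i, j) < T (i', j))}"

lemma cells_eq: "cells l = shape_cells (part l)"
  by (auto simp: cells_def shape_cells_def part_def split: if_splits)

lemma num_SYT_eq: "num_SYT l = card (standard_fillings (sum_list l) (part l))"
proof -
  have "standard_tableaux l = standard_fillings (sum_list l) (part l)"
    unfolding standard_tableaux_def standard_fillings_def cells_eq
    by (auto simp: shape_cells_def)
  then show ?thesis by (simp add: num_SYT_def)
qed

lemma finite_shape_cells: "l \<in> Par m n \<Longrightarrow> finite (shape_cells l)"
proof -
  assume l: "l \<in> Par m n"
  have "l i = 0" if "\<not> i < m" for i using l that by (simp add: Par_def)
  then have "shape_cells l = (SIGMA i:{..<m}. {..<l i})" by (fastforce simp: shape_cells_def)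
  then show ?thesis by simp
qed

lemma finite_standard_fillings: "l \<in> Par m n \<Longrightarrow> finite (standard_fillings n l)"
proof (rule finite_subset)
  show "standard_fillings n l \<subseteq> shape_cells l \<rightarrow>\<^sub>E {1..n}"
    by (auto simp: standard_fillings_def PiE_def dest: bij_betwE)
  show "finite (shape_cells l \<rightarrow>\<^sub>E {1..n})" if "l \<in> Par m n"
    using finite_shape_cells[OF that] by (intro finite_PiE) auto
qed

lemma shape_cells_upd: "shape_cells (k(c := Suc (k c))) = insert (c, k c) (shape_cells k)"
  by (auto simp: shape_cells_def split: if_splits)

definition add_cell :: "nat \<Rightarrow> (nat \<Rightarrow> nat) \<Rightarrow> (nat \<Rightarrow> nat) \<Rightarrow> (nat \<times> nat \<Rightarrow> nat) \<Rightarrow> nat \<times> nat \<Rightarrow> nat" where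
  "add_cell n l k T p = (if p \<in> shape_cells k then T p else if p \<in> shape_cells l then Suc n else undefined)"

lemma add_cell_standard_fillings:
  assumes k: "k \<in> lower m n l" and l: "l \<in> Par m (Suc n)" and T: "T \<in> standard_fillings n k"
  shows "add_cell n l k T \<in> standard_fillings (Suc n) l"
proof -
  obtain c where c: "l = k(c := Suc (k c))" and kP: "k \<in> Par m n" using k by (auto simp: lower_def)
  let ?T = "add_cell n l k T"
  have D: "shape_cells l = insert (c, k c) (shape_cells k)" unfolding c by (rule shape_cells_upd)
  have new: "(c, k c) \<notin> shape_cells k" by (simp add: shape_cells_def)
  have old: "?T p = T p" if "p \<in> shape_cells k" for p using that by (simp add: add_cell_def)
  have newv: "?T (c, k c) = Suc n" using new D by (simp add: add_cell_def)
  have bij: "bij_betw T (shape_cells k) {1..n}" using T by (simp add: standard_fillings_def)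
  have le: "T p \<le> n" if "p \<in> shape_cells k" for p using bij_betwE[OF bij] that by auto
  have row: "T (i, j) < T (i, j')" if "j < j'" "j' < k i" for i j j' using T that by (simp add: standard_fillings_def)
  have col: "T (i, j) < T (i', j)" if "i < i'" "j < k i" "j < k i'" for i i' j using T that by (simp add: standard_fillings_def)
  have "bij_betw ?T (shape_cells k) {1..n}" using bij by (simp add: old cong: bij_betw_cong)
  then have "bij_betw ?T (shape_cells k \<union> {(c, k c)}) ({1..n} \<union> {?T (c, k c)})"
    using new by (subst notIn_Un_bij_betw3[symmetric]) (auto simp: newv)
  moreover have "{1..n} \<union> {Suc n} = {1..Suc n}" by auto
  ultimately have B: "bij_betw ?T (shape_cells l) {1..Suc n}" by (simp add: D newv)
  have val: "?T (i, j) = (if j < k i then T (i, j) else Suc n)" if "j < l i" for i j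
    using that by (simp add: add_cell_def shape_cells_def)
  have lt: "T (i, j) < Suc n" if "j < k i" for i j using le[of "(i, j)"] that by (simp add: shape_cells_def)
  have lc: "l c = Suc (k c)" using c by simp
  have eq: "i = c \<and> j = k c" if "j < l i" "\<not> j < k i" for i j
    using that c by (auto split: if_splits)
  have jk: "j < k i" if "j < j'" "j' < l i" for i j j'
  proof (rule ccontr)
    assume "\<not> j < k i"
    then have "i = c \<and> j = k c" using that by (intro eq) auto
    then show False using that lc by simp
  qed
  have "?T (i, j) < ?T (i, j')" if "j < j'" "j' < l i" for i j j'
    using that jk[OF that] val[of j i] val[of j' i] row[of j j' i] lt[of j i] eq[of j i] eq[of j' i] lc by auto
  moreover have "?T (i, j) < ?T (i', j)" if "i < i'" "j < l i" "j < l i'" for i i' j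
    using that val[of j i] val[of j i'] col[of i i' j] lt[of j i] eq[of j i] eq[of j i'] Par_antimono[OF kP, of i i']
    by auto
  ultimately show ?thesis using B by (simp add: standard_fillings_def extensional_def add_cell_def D)
qed

definition below :: "nat \<Rightarrow> (nat \<Rightarrow> nat) \<Rightarrow> (nat \<times> nat \<Rightarrow> nat) \<Rightarrow> nat \<Rightarrow> nat" where
  "below n l T i = card {j. j < l i \<and> T (i, j) \<le> n}"

text \<open>The largest entry ends its row and, as columns increase, has no cell beneath it; so
  removing its cell leaves a partition, whose row lengths \<open>below\<close> recovers from the
  entries.\<close>

lemma standard_fillings_remove:
  assumes l: "l \<in> Par m (Suc n)" and T: "T \<in> standard_fillings (Suc n) l"
  obtains c where "l = (below n l T)(c := Suc (below n l T c))" "below n l T \<in> lower m n l"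
    "T (c, below n l T c) = Suc n" "restrict T (shape_cells (below n l T)) \<in> standard_fillings n (below n l T)"
proof -
  have bij: "bij_betw T (shape_cells l) {1..Suc n}" using T by (simp add: standard_fillings_def)
  have row: "T (i, j) < T (i, j')" if "j < j'" "j' < l i" for i j j' using T that by (simp add: standard_fillings_def)
  have col: "T (i, j) < T (i', j)" if "i < i'" "j < l i" "j < l i'" for i i' j using T that by (simp add: standard_fillings_def)
  have le: "T (i, j) \<le> Suc n" if "j < l i" for i j using bij_betwE[OF bij] that by (auto simp: shape_cells_def)
  have "Suc n \<in> T ` shape_cells l" using bij by (simp add: bij_betw_def)
  then obtain c j0 where c: "j0 < l c" "T (c, j0) = Suc n" by (auto simp: shape_cells_def)
  have uniq: "i = c \<and> j = j0" if "j < l i" "T (i, j) = Suc n" for i j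
    using bij c that unfolding bij_betw_def inj_on_def shape_cells_def by fastforce
  have j0: "l c = Suc j0"
    using c row[of j0 "Suc j0" c] le[of "Suc j0" c] by (cases "Suc j0 < l c") auto
  have b: "below n l T i = (if i = c then j0 else l i)" for i
  proof -
    have "{j. j < l i \<and> T (i, j) \<le> n} = {..<(if i = c then j0 else l i)}"
    proof (rule Set.set_eqI)
      fix j
      have "(j < l i \<and> T (i, j) \<le> n) \<longleftrightarrow> j < (if i = c then j0 else l i)"
      proof (cases "i = c")
        case True
        have "T (c, j) \<le> n" if "j < j0" using row[of j j0 c] that c by simp
        moreover have "j < j0" if "j < Suc j0" "T (c, j) \<le> n" using that c by (cases "j = j0") auto
        ultimately show ?thesis using True j0 by auto
      next
        case False
        have "T (i, j) \<le> n" if "j < l i" using le[OF that] uniq[OF that] False by (cases "T (i, j) = Suc n") auto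
        then show ?thesis using False by auto
      qed
      then show "j \<in> {j. j < l i \<and> T (i, j) \<le> n} \<longleftrightarrow> j \<in> {..<(if i = c then j0 else l i)}" by simp
    qed
    then show ?thesis by (simp add: below_def)
  qed
  define k where "k = below n l T"
  have lk: "l = k(c := Suc (k c))" by (auto simp: k_def b j0)
  have cm: "c < m" using c l by (metis (mono_tags, lifting) Par_upd_bound lk)
  have "k (Suc i) \<le> k i" for i
  proof -
    have "l (Suc i) \<le> l i" using l by (simp add: Par_def)
    moreover have "l (Suc c) \<noteq> l c"
    proof
      assume "l (Suc c) = l c"
      then have "T (c, j0) < T (Suc c, j0)" "T (Suc c, j0) \<le> Suc n" using c col[of c "Suc c" j0] le[of j0 "Suc c"] by auto
      then show False using c by simp
    qed
    ultimately show ?thesis using j0 by (cases "i = c") (auto simp: k_def b)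
  qed
  moreover have "\<forall>i\<ge>m. k i = 0" using l cm by (auto simp: k_def b Par_def)
  moreover have "(\<Sum>i<m. k i) = n" using sum_upd_Suc[OF cm, of k] l unfolding lk[symmetric] by (simp add: Par_def)
  ultimately have kP: "k \<in> Par m n" by (simp add: Par_def)
  then have low: "k \<in> lower m n l" using lk by (auto simp: lower_def)
  have kc: "k c = j0" by (simp add: k_def b)
  have D: "shape_cells l = insert (c, j0) (shape_cells k)" using shape_cells_upd[of k c] lk kc by simp
  have new: "(c, j0) \<notin> shape_cells k" using kc by (simp add: shape_cells_def)
  have "bij_betw T (shape_cells l - {(c, j0)}) ({1..Suc n} - {T (c, j0)})"
    using bij c by (intro bij_betw_DiffI) (auto simp: shape_cells_def)
  moreover have "shape_cells l - {(c, j0)} = shape_cells k" using D new by auto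
  moreover have "{1..Suc n} - {T (c, j0)} = {1..n}" using c by auto
  ultimately have "bij_betw T (shape_cells k) {1..n}" by simp
  then have "bij_betw (restrict T (shape_cells k)) (shape_cells k) {1..n}" by (simp cong: bij_betw_cong)
  have kl: "k i \<le> l i" for i by (simp add: k_def b j0)
  have "restrict T (shape_cells k) \<in> standard_fillings n k"
  proof -
    have "T (i, j) < T (i, j')" if "j < j'" "j' < k i" for i j j'
      using that kl[of i] by (intro row) auto
    moreover have "T (i, j) < T (i', j)" if "i < i'" "j < k i" "j < k i'" for i i' j
      using that kl[of i] kl[of i'] by (intro col) auto
    ultimately show ?thesis
      using \<open>bij_betw (restrict T (shape_cells k)) (shape_cells k) {1..n}\<close> by (simp add: standard_fillings_def shape_cells_def)
  qed
  then show ?thesis using that[of c] lk low c kc unfolding k_def by simp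
qed

text \<open>Removing the largest entry and adding it back are inverse to each other, so standard
  tableaux obey the same recursion as the patterns of weight one and the characters at the
  identity.\<close>

theorem card_standard_fillings:
  assumes "l \<in> Par m n"
  shows "card (standard_fillings n l) = paths m n l"
  using assms
proof (induction n arbitrary: l)
  case 0
  then have "l = (\<lambda>_. 0)" by (simp add: Par_0)
  then have "standard_fillings 0 l = {\<lambda>_. undefined}" by (auto simp: standard_fillings_def shape_cells_def bij_betw_def)
  then show ?case by simp
next
  case (Suc n)
  let ?S = "SIGMA k:lower m n l. standard_fillings n k"
  have "bij_betw (\<lambda>(k, T). add_cell n l k T) ?S (standard_fillings (Suc n) l)"
  proof (rule bij_betw_byWitness[where f' = "\<lambda>T. (below n l T, restrict T (shape_cells (below n l T)))"])
    show "\<forall>p\<in>?S. (\<lambda>T. (below n l T, restrict T (shape_cells (below n l T)))) ((\<lambda>(k, T). add_cell n l k T) p) = p"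
    proof safe
      fix k T assume k: "k \<in> lower m n l" and T: "T \<in> standard_fillings n k"
      have kl: "k i \<le> l i" for i using interlace_lower[OF k Suc.prems] by simp
      have bij: "bij_betw T (shape_cells k) {1..n}" using T by (simp add: standard_fillings_def)
      have "{j. j < l i \<and> add_cell n l k T (i, j) \<le> n} = {..<k i}" for i
        using bij_betwE[OF bij] kl[of i] by (auto simp: add_cell_def shape_cells_def split: if_splits)
      then have b: "below n l (add_cell n l k T) = k" by (simp add: below_def fun_eq_iff)
      show "below n l (add_cell n l k T) = k" by (rule b)
      show "restrict (add_cell n l k T) (shape_cells (below n l (add_cell n l k T))) = T"
        unfolding b using T by (auto simp: fun_eq_iff add_cell_def standard_fillings_def extensional_def)
    qed
    show "\<forall>T\<in>standard_fillings (Suc n) l. (\<lambda>(k, T). add_cell n l k T) ((\<lambda>T. (below n l T, restrict T (shape_cells (below n l T)))) T) = T"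
    proof
      fix T assume T: "T \<in> standard_fillings (Suc n) l"
      obtain c where c: "l = (below n l T)(c := Suc (below n l T c))" "T (c, below n l T c) = Suc n"
        by (rule standard_fillings_remove[OF Suc.prems T])
      have D: "shape_cells l = insert (c, below n l T c) (shape_cells (below n l T))"
        by (subst c(1)) (rule shape_cells_upd)
      have "T \<in> extensional (shape_cells l)" using T by (simp add: standard_fillings_def)
      then have "T p = undefined" if "p \<notin> shape_cells l" for p using that by (rule extensional_arb)
      then show "(\<lambda>(k, T). add_cell n l k T) ((\<lambda>T. (below n l T, restrict T (shape_cells (below n l T)))) T) = T"
        using c(2) D by (auto simp: fun_eq_iff add_cell_def)
    qed
    show "(\<lambda>(k, T). add_cell n l k T) ` ?S \<subseteq> standard_fillings (Suc n) l"
      using add_cell_standard_fillings[OF _ Suc.prems] by auto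
    show "(\<lambda>T. (below n l T, restrict T (shape_cells (below n l T)))) ` standard_fillings (Suc n) l \<subseteq> ?S"
    proof safe
      fix T assume T: "T \<in> standard_fillings (Suc n) l"
      show "below n l T \<in> lower m n l" by (rule standard_fillings_remove[OF Suc.prems T])
      show "restrict T (shape_cells (below n l T)) \<in> standard_fillings n (below n l T)" by (rule standard_fillings_remove[OF Suc.prems T])
    qed
  qed
  then have "card (standard_fillings (Suc n) l) = card ?S" by (simp add: bij_betw_same_card)
  also have "\<dots> = (\<Sum>k\<in>lower m n l. card (standard_fillings n k))"
    by (rule card_SigmaI) (auto simp: lower_def intro: finite_standard_fillings)
  also have "\<dots> = paths m (Suc n) l"
    using Suc.IH by (auto simp: lower_def intro!: sum.cong)
  finally show ?case .
qed

section \<open>Partitions as lists and as zero-padded functions\<close>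

lemma part_Par:
  assumes l: "l \<in> partitions_of n" and nm: "n \<le> m"
  shows "part l \<in> Par m n"
proof -
  have len: "length l \<le> n"
  proof -
    have "length l \<le> sum_list l" if "\<forall>p\<in>set l. 0 < p" for l :: "nat list"
      using that by (induction l) auto
    then show ?thesis using l by (auto simp: partitions_of_def)
  qed
  have "part l (Suc k) \<le> part l k" for k
    using l sorted_wrt_nth_less[of "(\<ge>)" l k "Suc k"] by (auto simp: part_def partitions_of_def)
  moreover have "(\<Sum>k<m. part l k) = (\<Sum>k<length l. l ! k)"
    using len nm by (intro sum.mono_neutral_cong_right) (auto simp: part_def)
  moreover have "(\<Sum>k<length l. l ! k) = n" using l by (simp add: partitions_of_def sum_list_sum_nth atLeast0LessThan)
  ultimately show ?thesis using len nm by (simp add: Par_def part_def)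
qed

lemma bij_betw_part:
  assumes nm: "n \<le> m"
  shows "bij_betw part (partitions_of n) (Par m n)"
proof (rule bij_betwI')
  fix l l' assume l: "l \<in> partitions_of n" and l': "l' \<in> partitions_of n"
  have pos: "l ! k > 0" if "k < length l" "l \<in> partitions_of n" for k and l :: "nat list"
    using that nth_mem[of k l] by (auto simp: partitions_of_def)
  have "length l = length l'" if eq: "part l = part l'"
  proof (rule ccontr)
    assume "length l \<noteq> length l'"
    then consider "length l < length l'" | "length l' < length l" by linarith
    then show False
      using fun_cong[OF eq, of "length l"] fun_cong[OF eq, of "length l'"] pos[of "length l" l'] pos[of "length l'" l] l l'
      by cases (auto simp: part_def)
  qed
  moreover have "l ! k = l' ! k" if "part l = part l'" "k < length l" "k < length l'" for k
    using fun_cong[OF that(1), of k] that(2,3) by (simp add: part_def)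
  ultimately have "l = l'" if "part l = part l'"
    using that by (intro nth_equalityI) simp_all
  then show "(part l = part l') = (l = l')" by blast
next
  fix l assume "l \<in> partitions_of n"
  then show "part l \<in> Par m n" using nm by (rule part_Par)
next
  fix f assume f: "f \<in> Par m n"
  define r where "r = card {k. 0 < f k}"
  have sub: "{k. 0 < f k} \<subseteq> {..<m}" 
  proof (rule subsetI, rule ccontr)
    fix k assume "k \<in> {k. 0 < f k}" "k \<notin> {..<m}"
    then show False using f by (simp add: Par_def)
  qed
  have fin: "finite {k. 0 < f k}" using sub finite_subset by blast
  have "{k. 0 < f k} = {..<r}"
  proof -
    have closed: "j \<in> {k. 0 < f k}" if "k \<in> {k. 0 < f k}" "j \<le> k" for j k
      using that Par_antimono[OF f, of j k] by auto
    have "\<not> 0 < f m" using f by (simp add: Par_def)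
    \<comment> \<open>The support is closed downwards, hence an initial segment that ends at its
      first gap.\<close>
    define a where "a = (LEAST k. \<not> 0 < f k)"
    have "\<not> 0 < f a" unfolding a_def by (rule LeastI) fact
    moreover have "0 < f k" if "k < a" for k 
    proof -
      have "\<not> \<not> 0 < f k" using that unfolding a_def by (rule not_less_Least)
      then show ?thesis by simp
    qed
    ultimately have "{k. 0 < f k} = {..<a}" 
    proof (intro equalityI subsetI)
      fix k assume k: "k \<in> {k. 0 < f k}"
      show "k \<in> {..<a}"
      proof (rule ccontr)
        assume "k \<notin> {..<a}"
        then have "a \<in> {k. 0 < f k}" using k by (intro closed[of k a]) auto
        then show False using \<open>\<not> 0 < f a\<close> by simp
      qed
    qed simp

    then show ?thesis by (simp add: r_def)
  qed
  then have pos: "0 < f k \<longleftrightarrow> k < r" for k by auto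
  define l where "l = map f [0..<r]"
  have rm: "r \<le> m" using card_mono[OF _ sub] by (simp add: r_def)
  have "part l = f" using pos by (auto simp: part_def l_def fun_eq_iff)
  moreover have "l \<in> partitions_of n"
  proof -
    have "(\<Sum>k<r. f k) = (\<Sum>k<m. f k)" 
    proof (rule sum.mono_neutral_left)
      show "\<forall>k\<in>{..<m} - {..<r}. f k = 0" using pos by (metis DiffE gr0I lessThan_iff)
    qed (use rm in auto)
    then have "sum_list l = n" using f by (simp add: l_def Par_def interv_sum_list_conv_sum_set_nat atLeast0LessThan)
    moreover have "sorted_wrt (\<ge>) l"
      using Par_antimono[OF f] by (simp add: l_def sorted_wrt_iff_nth_less)
    ultimately show ?thesis using pos by (auto simp: partitions_of_def l_def)
  qed
  ultimately show "\<exists>l\<in>partitions_of n. f = part l" by (intro bexI[of _ l]) simp_all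
qed

lemma num_SYT_paths: "l \<in> partitions_of n \<Longrightarrow> n \<le> m \<Longrightarrow> num_SYT l = paths m n (part l)"
  using card_standard_fillings[OF part_Par, of l n m] num_SYT_eq[of l] by (auto simp: partitions_of_def)

text \<open>A column of height \<open>r\<close> contributes \<open>0 + ... + (r - 1)\<close>, the
  row indices of its cells; exchanging the sums collects each row index once for every cell of the
  row.\<close>

lemma sum_choose_2_conj_partition: "(\<Sum>p\<leftarrow>conj_partition l. int (p choose 2)) = (\<Sum>i<length l. int i * int (part l i))"
  if l: "l \<in> partitions_of n"
proof -
  let ?L = "length l"
  have anti: "part l j \<le> part l i" if "i \<le> j" for i j using Par_antimono[OF part_Par[OF l order_refl] that] .
  have cnt: "length (filter (\<lambda>p. j < p) l) = card {i. i < ?L \<and> j < part l i}" for j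
    by (simp add: length_filter_conv_card part_def cong: conj_cong)
  have gauss: "int (card {i. i < ?L \<and> j < part l i} choose 2) = (\<Sum>i<?L. if j < part l i then int i else 0)" for j
  proof -
    define r where "r = card {i. i < ?L \<and> j < part l i}"
    have closed: "{i. i < ?L \<and> j < part l i} = {..<r}"
    proof -
      have "\<exists>a. {i. i < ?L \<and> j < part l i} = {..<a}"
      proof (cases "\<exists>i. \<not> (i < ?L \<and> j < part l i)")
        case True
        define a where "a = (LEAST i. \<not> (i < ?L \<and> j < part l i))"
        have "\<not> (a < ?L \<and> j < part l a)" unfolding a_def by (rule LeastI_ex[OF True])
        moreover have "i < ?L \<and> j < part l i" if "i < a" for i
          using not_less_Least[of i "\<lambda>i. \<not> (i < ?L \<and> j < part l i)"] that unfolding a_def by blast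
        ultimately have "{i. i < ?L \<and> j < part l i} = {..<a}"
        proof (intro equalityI subsetI)
          fix i assume i: "i \<in> {i. i < ?L \<and> j < part l i}"
          show "i \<in> {..<a}"
          proof (rule ccontr)
            assume "i \<notin> {..<a}"
            then have "a \<le> i" by simp
            then have "a < ?L \<and> j < part l a" using i anti[of a i] by simp
            then show False using \<open>\<not> (a < ?L \<and> j < part l a)\<close> by blast
          qed
        qed blast
        then show ?thesis by blast
      next
        case False
        then have "?L < ?L" by blast
        then show ?thesis by simp
      qed
      then obtain a where "{i. i < ?L \<and> j < part l i} = {..<a}" by (rule exE)
      then show ?thesis unfolding r_def by (simp only: card_lessThan)
    qed
    have "(\<Sum>i<?L. if j < part l i then int i else 0) = (\<Sum>i\<in>{i. i < ?L \<and> j < part l i}. int i)"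
    proof -
      have "{i. i < ?L \<and> j < part l i} = {i \<in> {..<?L}. j < part l i}" by simp
      then show ?thesis by (simp only: sum.inter_filter[OF finite_lessThan])
    qed
    also have "\<dots> = (\<Sum>i<r. int i)" unfolding closed ..
    also have "\<dots> = int (r choose 2)"
      by (induction r) (auto simp: numeral_2_eq_2)
    finally show ?thesis by (simp add: r_def)
  qed
  have "(\<Sum>p\<leftarrow>conj_partition l. int (p choose 2)) = (\<Sum>j<part l 0. \<Sum>i<?L. if j < part l i then int i else 0)"
    by (simp add: conj_partition_def cnt gauss o_def interv_sum_list_conv_sum_set_nat atLeast0LessThan)
  also have "\<dots> = (\<Sum>i<?L. \<Sum>j<part l 0. if j < part l i then int i else 0)" by (rule sum.swap)
  also have "\<dots> = (\<Sum>i<?L. int i * int (part l i))"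
  proof (rule sum.cong[OF refl])
    fix i
    have "(\<Sum>j<part l 0. if j < part l i then int i else 0) = (\<Sum>j\<in>{j\<in>{..<part l 0}. j < part l i}. int i)"
      by (simp only: sum.inter_filter[OF finite_lessThan])
    also have "{j\<in>{..<part l 0}. j < part l i} = {..<part l i}" using anti[of 0 i] by auto
    finally show "(\<Sum>j<part l 0. if j < part l i then int i else 0) = int i * int (part l i)" by simp
  qed
  finally show ?thesis by simp
qed

lemma Diag_content:
  assumes l: "l \<in> partitions_of n" and nm: "n \<le> m"
  shows "of_int (Diag l) = content m (part l)"
proof -
  have P: "part l \<in> Par m n" using part_Par[OF l nm] .
  have len: "length l \<le> m"
  proof (rule ccontr)
    assume "\<not> length l \<le> m"
    then have "part l m = l ! m" "l ! m \<in> set l" by (auto simp: part_def)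
    then show False using P l by (auto simp: Par_def partitions_of_def)
  qed
  have c2: "real (p choose 2) = real p * (real p - 1) / 2" for p
    by (induction p) (auto simp: numeral_2_eq_2 field_simps)
  have "(\<Sum>p\<leftarrow>l. int (p choose 2)) = (\<Sum>i<length l. int (part l i choose 2))"
    by (simp add: sum_list_sum_nth atLeast0LessThan part_def)
  moreover have "(\<Sum>p\<leftarrow>conj_partition l. int (p choose 2)) = (\<Sum>i<length l. int i * int (part l i))"
    using sum_choose_2_conj_partition[OF l] by simp
  ultimately have "of_int (Diag l) = (\<Sum>i<length l. real (part l i) * (real (part l i) - 1) / 2 - real i * real (part l i))"
    by (simp add: Diag_def c2 sum_subtractf)
  also have "\<dots> = content m (part l)"
    unfolding content_def using len by (intro sum.mono_neutral_left) (auto simp: part_def)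
  finally show ?thesis .
qed

section \<open>Littlewood--Richardson tableaux as patterns\<close>

lemma count_list_map: "count_list (map f xs) t = length (filter (\<lambda>x. f x = t) xs)"
  by (induction xs) auto

lemma count_list_row: "count_list (map f (rev [j..<q])) t = card {x. j \<le> x \<and> x < q \<and> f x = t}"
proof -
  have "count_list (map f (rev [j..<q])) t = length (filter (\<lambda>x. f x = t) [j..<q])"
    by (simp add: count_list_map rev_filter[symmetric])
  also have "\<dots> = card (set (filter (\<lambda>x. f x = t) [j..<q]))"
    by (rule distinct_card[symmetric]) simp
  also have "set (filter (\<lambda>x. f x = t) [j..<q]) = {x. j \<le> x \<and> x < q \<and> f x = t}" by auto
  finally show ?thesis .
qed

lemma count_list_concat: "count_list (concat xss) t = (\<Sum>xs\<leftarrow>xss. count_list xs t)"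
  by (induction xss) simp_all

lemma take_concat:
  "xss \<noteq> [] \<Longrightarrow> \<exists>i<length xss. \<exists>r. take k (concat xss) = concat (take i xss) @ take r (xss ! i)"
proof (induction xss arbitrary: k)
  case (Cons xs xss)
  show ?case
  proof (cases "k \<le> length xs \<or> xss = []")
    case True
    then show ?thesis by (intro exI[of _ 0]) auto
  next
    case False
    then obtain i r where "i < length xss" "take (k - length xs) (concat xss) = concat (take i xss) @ take r (xss ! i)"
      using Cons.IH by blast
    then show ?thesis using False by (intro exI[of _ "Suc i"]) auto
  qed
qed simp

lemma take_concat_prefix:
  "i < length xss \<Longrightarrow> \<exists>k\<le>length (concat xss). take k (concat xss) = concat (take i xss) @ take r (xss ! i)"
proof (induction xss arbitrary: i)
  case (Cons xs xss)
  show ?case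
  proof (cases i)
    case 0
    then show ?thesis by (intro exI[of _ "min r (length xs)"]) (auto simp: min_def)
  next
    case (Suc i')
    then obtain k where "k \<le> length (concat xss)" "take k (concat xss) = concat (take i' xss) @ take r (xss ! i')"
      using Cons by auto
    then show ?thesis using Suc by (intro exI[of _ "length xs + k"]) auto
  qed
qed simp

text \<open>A prefix of a concatenation consists of complete blocks and a prefix of the next one,
  and all of these occur, so the condition can be checked row by row.\<close>

lemma lattice_word_concat:
  "lattice_word (concat xss) \<longleftrightarrow> (\<forall>i<length xss. \<forall>r. \<forall>t\<ge>1.
     count_list (concat (take i xss) @ take r (xss ! i)) (Suc t) \<le> count_list (concat (take i xss) @ take r (xss ! i)) t)"
proof (cases "xss = []")
  case False
  show ?thesis
  proof
    assume "lattice_word (concat xss)"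
    then show "\<forall>i<length xss. \<forall>r. \<forall>t\<ge>1.
     count_list (concat (take i xss) @ take r (xss ! i)) (Suc t) \<le> count_list (concat (take i xss) @ take r (xss ! i)) t"
      using take_concat_prefix[of _ xss] unfolding lattice_word_def by metis
  next
    assume R: "\<forall>i<length xss. \<forall>r. \<forall>t\<ge>1.
     count_list (concat (take i xss) @ take r (xss ! i)) (Suc t) \<le> count_list (concat (take i xss) @ take r (xss ! i)) t"
    show "lattice_word (concat xss)"
      unfolding lattice_word_def
    proof (intro allI impI)
      fix k t :: nat assume "1 \<le> t"
      obtain i r where "i < length xss" "take k (concat xss) = concat (take i xss) @ take r (xss ! i)"
        using take_concat[OF False] by blast
      then show "count_list (take k (concat xss)) (Suc t) \<le> count_list (take k (concat xss)) t"
        using R \<open>1 \<le> t\<close> by simp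
    qed
  qed
qed (simp add: lattice_word_def)

lemma all_ge_1: "(\<forall>t\<ge>1. Q t) \<longleftrightarrow> (\<forall>k. Q (Suc k))"
  by (metis One_nat_def Suc_le_D le0 Suc_le_mono)

context
  fixes l m v :: "nat list" and L p q :: nat
  assumes l: "l \<in> partitions_of (p + q)" and m: "m \<in> partitions_of p" and v: "v \<in> partitions_of q"
    and L: "p + q \<le> L" and sub: "\<And>i. part m i \<le> part l i"
begin

text \<open>
  A filling that is weakly increasing along rows is determined by the numbers \<open>arow T i k\<close> of entries
  \<open>k + 1\<close> in row \<open>i\<close>. Under \<open>T \<mapsto> pat T\<close> the lattice condition becomes interlacing, and strictness of
  the columns becomes \<open>good\<close>; \<open>tab\<close> is the inverse map.
\<close>

definition skew :: "(nat \<times> nat) set" where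
  "skew = {(i, j). part m i \<le> j \<and> j < part l i}"

definition arow :: "(nat \<times> nat \<Rightarrow> nat) \<Rightarrow> nat \<Rightarrow> nat \<Rightarrow> nat" where
  "arow T i k = card {j. part m i \<le> j \<and> j < part l i \<and> T (i, j) = Suc k}"

definition pat :: "(nat \<times> nat \<Rightarrow> nat) \<Rightarrow> nat \<Rightarrow> nat \<Rightarrow> nat" where
  "pat T i k = (\<Sum>i'<i. arow T i' k)"

definition row_weak :: "(nat \<times> nat \<Rightarrow> nat) \<Rightarrow> bool" where
  "row_weak T \<longleftrightarrow> T \<in> skew \<rightarrow>\<^sub>E {1..length v} \<and>
     (\<forall>i j j'. part m i \<le> j \<and> j < j' \<and> j' < part l i \<longrightarrow> T (i, j) \<le> T (i, j'))"

text \<open>Row \<open>i\<close> is built from consecutive blocks of equal letters; the entry in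
  column \<open>j\<close> is the first letter whose block ends beyond \<open>j\<close>. The outer
  \<open>Suc\<close> is there because tableau entries start at \<open>1\<close>.\<close>

definition tab :: "(nat \<Rightarrow> nat \<Rightarrow> nat) \<Rightarrow> nat \<times> nat \<Rightarrow> nat" where
  "tab G = (\<lambda>(i, j). if (i, j) \<in> skew then Suc (LEAST k. j < part m i + (\<Sum>k'\<le>k. G (Suc i) k' - G i k')) else undefined)"

lemma skew_eq: "cells l - cells m = skew"
  by (auto simp: cells_eq shape_cells_def skew_def)

lemma Par_l: "part l \<in> Par L (p + q)" and Par_m: "part m \<in> Par L p" and Par_v: "part v \<in> Par L q"
  using l m v L by (auto intro: part_Par)

lemma length_le: "length l \<le> L" "length v \<le> L"
proof -
  have "length w \<le> L" if "w \<in> partitions_of n" "n \<le> L" for w n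
  proof (rule ccontr)
    assume "\<not> length w \<le> L"
    then have "part w L = w ! L" "w ! L \<in> set w" by (auto simp: part_def)
    then show False using part_Par[OF that] that(1) by (auto simp: Par_def partitions_of_def)
  qed
  then show "length l \<le> L" "length v \<le> L" using l v L by auto
qed

lemma part_v_0: "length v \<le> k \<Longrightarrow> part v k = 0" by (simp add: part_def)

lemma part_l_0: "length l \<le> i \<Longrightarrow> part l i = 0" by (simp add: part_def)

lemma row_values: "row_weak T \<Longrightarrow> part m i \<le> j \<Longrightarrow> j < part l i \<Longrightarrow> 1 \<le> T (i, j) \<and> T (i, j) \<le> length v"
  unfolding row_weak_def by (fastforce simp: skew_def PiE_iff)

lemma sum_arow:
  assumes T: "row_weak T"
  shows "(\<Sum>k'\<le>k. arow T i k') = card {j. part m i \<le> j \<and> j < part l i \<and> T (i, j) \<le> Suc k}"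
proof -
  have "card {j. part m i \<le> j \<and> j < part l i \<and> T (i, j) \<le> Suc k} =
      card (\<Union>k'\<in>{..k}. {j. part m i \<le> j \<and> j < part l i \<and> T (i, j) = Suc k'})"
  proof (rule arg_cong[where f = card], intro equalityI subsetI)
    fix j assume j: "j \<in> {j. part m i \<le> j \<and> j < part l i \<and> T (i, j) \<le> Suc k}"
    then obtain t where "T (i, j) = Suc t" using row_values[OF T, of i j] by (cases "T (i, j)") auto
    then show "j \<in> (\<Union>k'\<in>{..k}. {j. part m i \<le> j \<and> j < part l i \<and> T (i, j) = Suc k'})" using j by auto
  qed auto
  also have "\<dots> = (\<Sum>k'\<le>k. arow T i k')"
    unfolding arow_def by (rule card_UN_disjoint) auto
  finally show ?thesis ..
qed

text \<open>In a weakly increasing row the entries that are at most \<open>Suc k\<close> form an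
  initial segment, whose length is given by \<open>sum_arow\<close>.\<close>

lemma row_prefix:
  assumes T: "row_weak T" and j: "part m i \<le> j" "j < part l i"
  shows "T (i, j) \<le> Suc k \<longleftrightarrow> j < part m i + (\<Sum>k'\<le>k. arow T i k')"
proof -
  let ?X = "{j. part m i \<le> j \<and> j < part l i \<and> T (i, j) \<le> Suc k}"
  have mono: "T (i, j) \<le> T (i, j')" if "part m i \<le> j" "j \<le> j'" "j' < part l i" for j j'
    using T that unfolding row_weak_def by (cases "j = j'") auto
  have fin: "finite ?X" by (rule finite_subset[of _ "{..<part l i}"]) auto
  show ?thesis
  proof
    assume "T (i, j) \<le> Suc k"
    then have "T (i, j') \<le> Suc k" if "j' \<in> {part m i..j}" for j'
      using mono[of j' j] j that by simp
    then have "{part m i..j} \<subseteq> ?X" using j by auto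
    then have "card {part m i..j} \<le> card ?X" by (rule card_mono[OF fin])
    then show "j < part m i + (\<Sum>k'\<le>k. arow T i k')" unfolding sum_arow[OF T] using j by simp
  next
    assume lt: "j < part m i + (\<Sum>k'\<le>k. arow T i k')"
    show "T (i, j) \<le> Suc k"
    proof (rule ccontr)
      assume n: "\<not> T (i, j) \<le> Suc k"
      have "?X \<subseteq> {part m i..<j}"
      proof
        fix j' assume j': "j' \<in> ?X"
        then have "\<not> j \<le> j'" using mono[of j j'] n j by auto
        then show "j' \<in> {part m i..<j}" using j' by auto
      qed
      then have "card ?X \<le> card {part m i..<j}" by (rule card_mono[rotated]) simp
      then show False using lt j unfolding sum_arow[OF T] by simp
    qed
  qed
qed

lemma pat_Suc: "pat T (Suc i) k = pat T i k + arow T i k"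
  by (simp add: pat_def)

lemma sum_pat: "(\<Sum>k'\<le>k. pat T (Suc i) k' - pat T i k') = (\<Sum>k'\<le>k. arow T i k')"
  by (simp add: pat_Suc)

lemma tab_pat:
  assumes T: "row_weak T"
  shows "tab (pat T) = T"
proof
  fix c :: "nat \<times> nat"
  obtain i j where c: "c = (i, j)" by (cases c)
  show "tab (pat T) c = T c"
  proof (cases "c \<in> skew")
    case True
    then have j: "part m i \<le> j" "j < part l i" by (auto simp: c skew_def)
    obtain t where t: "T (i, j) = Suc t" using row_values[OF T j] by (cases "T (i, j)") auto
    have "(LEAST k. j < part m i + (\<Sum>k'\<le>k. arow T i k')) = (LEAST k. T (i, j) \<le> Suc k)"
      by (simp add: row_prefix[OF T j])
    also have "\<dots> = t" unfolding t by (rule Least_equality) auto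
    finally show ?thesis using True t by (simp add: tab_def c sum_pat)
  next
    case False
    then have "T c = undefined" using T unfolding row_weak_def by (blast intro: PiE_arb)
    then show ?thesis using False by (simp add: tab_def c)
  qed
qed

lemma slack_pat:
  "slack (part m) (pat T) (Suc i) K = int (part m (Suc i)) + int (\<Sum>k\<le>K. arow T (Suc i) k)
     - int (part m i) - int (\<Sum>k<K. arow T i k)"
  by (simp add: slack_def pat_Suc sum_negf)

lemma columns_iff:
  assumes T: "row_weak T"
  shows "(\<forall>i i' j. (i, j) \<in> skew \<and> (i', j) \<in> skew \<and> i < i' \<longrightarrow> T (i, j) < T (i', j)) \<longleftrightarrow> good L (part m) (pat T)"
proof
  assume col: "\<forall>i i' j. (i, j) \<in> skew \<and> (i', j) \<in> skew \<and> i < i' \<longrightarrow> T (i, j) < T (i', j)"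
  have "slack (part m) (pat T) (Suc i) K \<le> 0" for i K
  proof (rule ccontr)
    assume "\<not> slack (part m) (pat T) (Suc i) K \<le> 0"
    then have lt: "part m i + (\<Sum>k<K. arow T i k) < part m (Suc i) + (\<Sum>k\<le>K. arow T (Suc i) k)"
      unfolding slack_pat by linarith
    \<comment> \<open>The first column of row \<open>i\<close> after its entries that are at most
      \<open>K\<close>. Positive slack puts an entry that is at most \<open>Suc K\<close> directly
      beneath it, against strictness.\<close>
    define j where "j = part m i + (\<Sum>k<K. arow T i k)"
    have le: "(\<Sum>k\<le>K. arow T (Suc i) k) \<le> part l (Suc i) - part m (Suc i)"
    proof -
      have "{j. part m (Suc i) \<le> j \<and> j < part l (Suc i) \<and> T (Suc i, j) \<le> Suc K} \<subseteq> {part m (Suc i)..<part l (Suc i)}" by auto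
      from card_mono[OF _ this] show ?thesis unfolding sum_arow[OF T] by simp
    qed
    have m1: "part m (Suc i) \<le> part m i" using Par_m by (simp add: Par_def)
    have l1: "part l (Suc i) \<le> part l i" using Par_l by (simp add: Par_def)
    have j1: "part m (Suc i) \<le> j" "j < part l (Suc i)" "part m i \<le> j" "j < part l i"
      using lt le m1 l1 sub[of "Suc i"] unfolding j_def[symmetric] by (auto simp: j_def)
    have "T (Suc i, j) \<le> Suc K" using row_prefix[OF T j1(1,2)] lt by (simp add: j_def)
    moreover have "T (i, j) < T (Suc i, j)" using col j1 by (auto simp: skew_def)
    ultimately have le: "T (i, j) \<le> K" by simp
    then obtain K' where K: "K = Suc K'" using row_values[OF T j1(3,4)] by (cases K) auto
    then have "j < part m i + (\<Sum>k\<le>K'. arow T i k)" using row_prefix[OF T j1(3,4), of K'] le by simp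
    then show False by (simp add: j_def K lessThan_Suc_atMost)
  qed
  then have "\<not> violated L (part m) (pat T) K j" for K j by (cases j) (auto simp: violated_def not_less)
  then show "good L (part m) (pat T)" by (simp add: good_def)
next
  assume good: "good L (part m) (pat T)"
  have adj: "T (i, j) < T (Suc i, j)" if ij: "(i, j) \<in> skew" and Sij: "(Suc i, j) \<in> skew" for i j
  proof -
    have j1: "part m i \<le> j" "j < part l i" and j2: "part m (Suc i) \<le> j" "j < part l (Suc i)"
      using that by (auto simp: skew_def)
    obtain K where K: "T (Suc i, j) = Suc K" using row_values[OF T j2] by (cases "T (Suc i, j)") auto
    have i: "Suc i < L" using j2 Par_l by (auto simp: Par_def) (metis not_less not_less_zero)
    have "K < L" using row_values[OF T j2] K length_le by simp
    then have "slack (part m) (pat T) (Suc i) K \<le> 0"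
      using good[unfolded good_def, rule_format, of K "Suc i"] i by (simp add: violated_def)
    moreover have "j < part m (Suc i) + (\<Sum>k\<le>K. arow T (Suc i) k)" using row_prefix[OF T j2, of K] K by simp
    ultimately have lt: "j < part m i + (\<Sum>k<K. arow T i k)" unfolding slack_pat by linarith
    then obtain K' where K': "K = Suc K'" using j1 by (cases K) auto
    then have "T (i, j) \<le> Suc K'" using row_prefix[OF T j1, of K'] lt by (simp add: lessThan_Suc_atMost)
    then show ?thesis using K K' by simp
  qed
  \<comment> \<open>Comparing adjacent rows suffices: the cells of a column of the skew shape are
    contiguous.\<close>
  show "\<forall>i i' j. (i, j) \<in> skew \<and> (i', j) \<in> skew \<and> i < i' \<longrightarrow> T (i, j) < T (i', j)"
  proof (intro allI impI)
    fix i i' j assume a: "(i, j) \<in> skew \<and> (i', j) \<in> skew \<and> i < i'"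
    have "i < i' \<Longrightarrow> (i', j) \<in> skew \<Longrightarrow> T (i, j) < T (i', j)"
    proof (induction i')
      case (Suc i')
      show ?case
      proof (cases "i = i'")
        case True
        then show ?thesis using adj a Suc.prems by auto
      next
        case False
        then have "i < i'" using Suc.prems by simp
        have "part m i' \<le> part m i" by (rule Par_antimono[OF Par_m]) (use \<open>i < i'\<close> in simp)
        moreover have "part l (Suc i') \<le> part l i'" using Par_l by (simp add: Par_def)
        ultimately have "(i', j) \<in> skew" using a Suc.prems by (auto simp: skew_def)
        then show ?thesis using Suc.IH[OF \<open>i < i'\<close>] adj[of i' j] Suc.prems by simp
      qed
    qed simp
    then show "T (i, j) < T (i', j)" using a by blast
  qed
qed

text \<open>Rows are read from right to left, so within a row larger letters come earlier. For
  \<open>Suc k\<close> and \<open>Suc (Suc k)\<close> the critical prefix stops in row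
  \<open>i\<close> after every \<open>Suc (Suc k)\<close> and before any \<open>Suc k\<close>; its
  condition is the interlacing inequality, which implies the condition at the other prefixes ending
  in that row.\<close>

lemma lattice_iff:
  assumes T: "row_weak T"
  shows "lattice_word (reading_word l m T) \<longleftrightarrow> (\<forall>i<length l. \<forall>k. pat T (Suc i) (Suc k) \<le> pat T i k)"
proof -
  let ?row = "\<lambda>i. map (\<lambda>j. T (i, j)) (rev [part m i..<part l i])"
  let ?xss = "map ?row [0..<length l]"
  have full: "count_list (concat (take i ?xss)) (Suc k) = pat T i k" if "i < length l" for i k
  proof -
    have "take i ?xss = map ?row [0..<i]" using that by (simp add: take_map)
    then show ?thesis
      by (simp add: count_list_concat o_def count_list_row interv_sum_list_conv_sum_set_nat atLeast0LessThan pat_def arow_def)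
  qed
  have partial: "count_list (take r (?row i)) (Suc k) = card {j. part l i - min r (part l i - part m i) \<le> j \<and> j < part l i \<and> T (i, j) = Suc k}" for r i k
  proof -
    have "take r (?row i) = map (\<lambda>j. T (i, j)) (rev [part l i - min r (part l i - part m i)..<part l i])"
      using sub[of i] by (auto simp: take_map take_rev min_def intro!: arg_cong[where f = "map _"] arg_cong[where f = rev])
    then show ?thesis by (simp only: count_list_row)
  qed
  have "lattice_word (reading_word l m T) \<longleftrightarrow> (\<forall>i<length l. \<forall>r k.
      pat T i (Suc k) + card {j. part l i - min r (part l i - part m i) \<le> j \<and> j < part l i \<and> T (i, j) = Suc (Suc k)} \<le>
      pat T i k + card {j. part l i - min r (part l i - part m i) \<le> j \<and> j < part l i \<and> T (i, j) = Suc k})"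
    (is "_ \<longleftrightarrow> ?R")
  proof -
    have "lattice_word (reading_word l m T) \<longleftrightarrow> (\<forall>i<length l. \<forall>r. \<forall>t\<ge>1.
       count_list (concat (take i ?xss) @ take r (?row i)) (Suc t) \<le> count_list (concat (take i ?xss) @ take r (?row i)) t)"
      unfolding reading_word_def lattice_word_concat by simp
    also have "\<dots> \<longleftrightarrow> (\<forall>i<length l. \<forall>r k.
       count_list (concat (take i ?xss) @ take r (?row i)) (Suc (Suc k)) \<le> count_list (concat (take i ?xss) @ take r (?row i)) (Suc k))"
      by (simp only: all_ge_1)
    also have "\<dots> \<longleftrightarrow> ?R" by (simp only: count_list_append full partial cong: imp_cong)
    finally show ?thesis .
  qed
  also have "\<dots> \<longleftrightarrow> (\<forall>i<length l. \<forall>k. pat T (Suc i) (Suc k) \<le> pat T i k)"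
  proof
    assume R: ?R
    show "\<forall>i<length l. \<forall>k. pat T (Suc i) (Suc k) \<le> pat T i k"
    proof (intro allI impI)
      fix i k assume i: "i < length l"
      let ?A = "\<Sum>k'\<le>k. arow T i k'"
      have A: "?A \<le> part l i - part m i"
      proof -
        have "{j. part m i \<le> j \<and> j < part l i \<and> T (i, j) \<le> Suc k} \<subseteq> {part m i..<part l i}" by auto
        from card_mono[OF _ this] show ?thesis unfolding sum_arow[OF T] by simp
      qed
      \<comment> \<open>The number of entries of row \<open>i\<close> larger than
        \<open>Suc k\<close>, which are those read before any \<open>Suc k\<close>.\<close>
      define r where "r = part l i - (part m i + ?A)"
      have r: "part l i - min r (part l i - part m i) = part m i + ?A"
        using A sub[of i] by (simp add: r_def)
      have gt: "Suc k < T (i, j)" if "part m i + ?A \<le> j" "j < part l i" for j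
        using row_prefix[OF T, of i j k] that by simp
      have ge: "part m i + ?A \<le> j" if "part m i \<le> j" "j < part l i" "T (i, j) = Suc (Suc k)" for j
        using row_prefix[OF T that(1,2), of k] that(3) by simp
      have 1: "{j. part m i + ?A \<le> j \<and> j < part l i \<and> T (i, j) = Suc k} = {}"
        using gt by fastforce
      have 2: "{j. part m i + ?A \<le> j \<and> j < part l i \<and> T (i, j) = Suc (Suc k)} =
          {j. part m i \<le> j \<and> j < part l i \<and> T (i, j) = Suc (Suc k)}"
        using ge by (intro Collect_cong) auto
      show "pat T (Suc i) (Suc k) \<le> pat T i k"
        using R[rule_format, OF i, of k r] unfolding r 1 2 pat_Suc by (simp add: arow_def)
    qed
  next
    assume P: "\<forall>i<length l. \<forall>k. pat T (Suc i) (Suc k) \<le> pat T i k"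
    show ?R
    proof (intro allI impI)
      fix i r k assume i: "i < length l"
      have "card {j. part l i - min r (part l i - part m i) \<le> j \<and> j < part l i \<and> T (i, j) = Suc (Suc k)} \<le> arow T i (Suc k)"
        unfolding arow_def
      proof (rule card_mono)
        show "finite {j. part m i \<le> j \<and> j < part l i \<and> T (i, j) = Suc (Suc k)}"
          by (rule finite_subset[of _ "{..<part l i}"]) auto
        show "{j. part l i - min r (part l i - part m i) \<le> j \<and> j < part l i \<and> T (i, j) = Suc (Suc k)}
            \<subseteq> {j. part m i \<le> j \<and> j < part l i \<and> T (i, j) = Suc (Suc k)}"
          using sub[of i] by (auto simp: min_def split: if_splits)
      qed
      then show "pat T i (Suc k) + card {j. part l i - min r (part l i - part m i) \<le> j \<and> j < part l i \<and> T (i, j) = Suc (Suc k)} \<le>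
        pat T i k + card {j. part l i - min r (part l i - part m i) \<le> j \<and> j < part l i \<and> T (i, j) = Suc k}"
        using P[rule_format, OF i, of k] by (simp add: pat_Suc)
    qed
  qed
  finally show ?thesis .
qed

section \<open>The bijection between tableaux and patterns\<close>

definition lr_tableaux :: "(nat \<times> nat \<Rightarrow> nat) set" where
  "lr_tableaux = {T \<in> skew_tableaux l m v. lattice_word (reading_word l m T)}"

definition lr_patterns :: "(nat \<Rightarrow> nat \<Rightarrow> nat) set" where
  "lr_patterns = {G \<in> GT L (part v). good L (part m) G \<and> (\<forall>k<L. part m k + wt L G k = part l k)}"

lemma lr_tableaux_iff:
  "T \<in> lr_tableaux \<longleftrightarrow> row_weak T \<and> (\<forall>i i' j. (i, j) \<in> skew \<and> (i', j) \<in> skew \<and> i < i' \<longrightarrow> T (i, j) < T (i', j)) \<and>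
     (\<forall>k<length v. card {c \<in> skew. T c = Suc k} = part v k) \<and> lattice_word (reading_word l m T)"
proof -
  have rows: "(\<forall>i j j'. (i, j) \<in> skew \<and> (i, j') \<in> skew \<and> j < j' \<longrightarrow> T (i, j) \<le> T (i, j')) \<longleftrightarrow>
      (\<forall>i j j'. part m i \<le> j \<and> j < j' \<and> j' < part l i \<longrightarrow> T (i, j) \<le> T (i, j'))"
    by (auto simp: skew_def)
  have content: "(\<forall>k\<in>{1..length v}. card {c \<in> skew. T c = k} = v ! (k - 1)) \<longleftrightarrow>
      (\<forall>k<length v. card {c \<in> skew. T c = Suc k} = part v k)"
  proof
    assume a: "\<forall>k\<in>{1..length v}. card {c \<in> skew. T c = k} = v ! (k - 1)"
    show "\<forall>k<length v. card {c \<in> skew. T c = Suc k} = part v k"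
      using a by (auto simp: part_def)
  next
    assume a: "\<forall>k<length v. card {c \<in> skew. T c = Suc k} = part v k"
    show "\<forall>k\<in>{1..length v}. card {c \<in> skew. T c = k} = v ! (k - 1)"
    proof
      fix k assume k: "k \<in> {1..length v}"
      then have "Suc (k - 1) = k" "k - 1 < length v" by auto
      then show "card {c \<in> skew. T c = k} = v ! (k - 1)" using a[rule_format, of "k - 1"] by (simp add: part_def)
    qed
  qed
  show ?thesis
    unfolding lr_tableaux_def skew_tableaux_def Let_def skew_eq mem_Collect_eq row_weak_def rows content by blast
qed

lemma finite_row: "finite {j. part m i \<le> j \<and> j < part l i \<and> Q j}"
  by (rule finite_subset[of _ "{..<part l i}"]) auto

lemma card_content: "card {c \<in> skew. T c = Suc k} = pat T L k"
proof -
  have "{c \<in> skew. T c = Suc k} = (SIGMA i:{..<L}. {j. part m i \<le> j \<and> j < part l i \<and> T (i, j) = Suc k})"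
  proof -
    have "i < L" if "(i, j) \<in> skew" for i j
    proof (rule ccontr)
      assume "\<not> i < L"
      then show False using that Par_l by (simp add: skew_def Par_def)
    qed
    then show ?thesis by (auto simp: skew_def)
  qed
  then show ?thesis unfolding pat_def arow_def by (simp add: finite_row)
qed

lemma arow_0: "length l \<le> i \<Longrightarrow> arow T i k = 0"
  by (simp add: arow_def part_l_0)

lemma pat_stable: "length l \<le> i \<Longrightarrow> pat T i k = pat T (length l) k"
proof (induction i rule: dec_induct)
  case (step i)
  then show ?case by (simp add: pat_Suc arow_0)
qed simp

lemma lr_tableaux_pat:
  assumes "T \<in> lr_tableaux"
  shows "pat T \<in> lr_patterns"
proof -
  have T: "row_weak T" and good: "good L (part m) (pat T)"
    and cont: "\<And>k. k < length v \<Longrightarrow> pat T L k = part v k"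
    and lat: "\<And>i k. i < length l \<Longrightarrow> pat T (Suc i) (Suc k) \<le> pat T i k"
    using assms columns_iff lattice_iff unfolding lr_tableaux_iff card_content by auto
  have a0: "arow T i k = 0" if "length v \<le> k" for i k
  proof -
    have "{j. part m i \<le> j \<and> j < part l i \<and> T (i, j) = Suc k} = {}"
      using row_values[OF T] that by fastforce
    then show ?thesis by (simp add: arow_def)
  qed
  have L': "pat T L k = part v k" for k
    using cont a0 part_v_0 by (cases "k < length v") (auto simp: pat_def not_less)
  \<comment> \<open>Rows beyond the list \<open>l\<close> are empty, so the layers have reached
    \<open>part v\<close> there. This supplies interlacing at the indices that the lattice condition
    does not reach.\<close>
  have last: "pat T i = part v" if "length l \<le> i" for i
    using pat_stable[OF that] pat_stable[of L] L' length_le by (auto simp: fun_eq_iff)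
  have "pat T (Suc i) (Suc k) \<le> pat T i k" for i k
  proof (cases "i < length l")
    case False
    then show ?thesis using last[of i] last[of "Suc i"] Par_v by (simp add: Par_def)
  qed (rule lat)
  then have GT: "pat T \<in> GT L (part v)"
    using last length_le by (auto simp: GT_def pat_Suc) (auto simp: pat_def)
  have "part m i + wt L (pat T) i = part l i" if i: "i < L" for i
  proof -
    have "wt L (pat T) i = (\<Sum>k<L. arow T i k)" by (simp add: wt_def pat_Suc sum.distrib)
    also have "\<dots> = (\<Sum>k\<le>L - 1. arow T i k)" using i by (intro sum.cong) auto
    also have "\<dots> = card {j. part m i \<le> j \<and> j < part l i \<and> T (i, j) \<le> Suc (L - 1)}" by (rule sum_arow[OF T])
    also have "{j. part m i \<le> j \<and> j < part l i \<and> T (i, j) \<le> Suc (L - 1)} = {part m i..<part l i}"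
      using row_values[OF T, of i] length_le i by fastforce
    finally show ?thesis using sub[of i] by simp
  qed
  then show ?thesis using GT good by (simp add: lr_patterns_def)
qed

lemma lr_patterns_tab:
  assumes "G \<in> lr_patterns"
  shows "tab G \<in> lr_tableaux" "pat (tab G) = G"
proof -
  have G: "G \<in> GT L (part v)" and good: "good L (part m) G"
    and wt: "\<And>k. k < L \<Longrightarrow> part m k + wt L G k = part l k"
    using assms by (auto simp: lr_patterns_def)
  \<comment> \<open>The intended number of entries that are at most \<open>Suc k\<close> in row
    \<open>i\<close>.\<close>
  define B where "B i k = (\<Sum>k'\<le>k. G (Suc i) k' - G i k')" for i k
  have Bmono: "B i k \<le> B i k'" if "k \<le> k'" for i k k'
    unfolding B_def using that by (intro sum_mono2) auto
  have tot: "(\<Sum>k'<L. G (Suc i) k' - G i k') = wt L G i" for i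
    unfolding wt_def by (rule sum_subtractf_nat) (rule GT_step[OF G])
  have zero: "G i k = 0" if "length v \<le> k" for i k
    using GT_le[OF G, of i k] part_v_0[OF that] by simp
  have Bcut: "B i k = (\<Sum>k'<L. G (Suc i) k' - G i k')" if "L \<le> Suc k" for i k
    unfolding B_def
  proof (rule sum.mono_neutral_right)
    show "{..<L} \<subseteq> {..k}" using that by auto
    show "\<forall>k'\<in>{..k} - {..<L}. G (Suc i) k' - G i k' = 0"
    proof
      fix k' assume "k' \<in> {..k} - {..<L}"
      then have "length v \<le> k'" using length_le by auto
      then show "G (Suc i) k' - G i k' = 0" by (simp add: zero)
    qed
  qed simp
  have Bmax: "B i k \<le> wt L G i" for i k
    using Bmono[of k "max k L" i] Bcut[of "max k L" i] tot[of i] by simp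
  have Bend: "B i (length v - 1) = wt L G i" if "0 < length v" for i
  proof -
    have "(\<Sum>k'<L. G (Suc i) k' - G i k') = (\<Sum>k'\<le>length v - 1. G (Suc i) k' - G i k')"
    proof (rule sum.mono_neutral_right)
      show "{..length v - 1} \<subseteq> {..<L}"
      proof
        fix x assume "x \<in> {..length v - 1}"
        then have "x < length v" using that by (simp only: atMost_iff)
        then show "x \<in> {..<L}" using length_le by simp
      qed
      show "\<forall>k'\<in>{..<L} - {..length v - 1}. G (Suc i) k' - G i k' = 0"
      proof
        fix k' assume "k' \<in> {..<L} - {..length v - 1}"
        then have "length v \<le> k'" by auto
        then show "G (Suc i) k' - G i k' = 0" by (simp add: zero)
      qed
    qed simp
    then show ?thesis using tot[of i] by (simp add: B_def)
  qed
  have wt0: "wt L G i = 0" if "length v = 0" for i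
    using zero that by (simp add: wt_def)
  have skewL: "i < L" if "(i, j) \<in> skew" for i j
  proof (rule ccontr)
    assume "\<not> i < L"
    then show False using that Par_l by (simp add: skew_def Par_def)
  qed
  \<comment> \<open>Every cell is covered by some block, so the \<open>LEAST\<close> in
    \<open>tab\<close> exists and the letters stay between \<open>1\<close> and
    \<open>length v\<close>.\<close>
  have ex: "0 < length v \<and> j < part m i + B i (length v - 1)" if "(i, j) \<in> skew" for i j
  proof -
    have "j < part m i + wt L G i" "part m i \<le> j" using that wt[OF skewL[OF that]] by (auto simp: skew_def)
    moreover from this have "0 < length v" using wt0[of i] by (cases "length v") auto
    ultimately show ?thesis using Bend by simp
  qed
  have tab: "tab G (i, j) = Suc (LEAST k. j < part m i + B i k)" if "(i, j) \<in> skew" for i j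
    using that by (simp add: tab_def B_def)
  have tab_le: "tab G (i, j) \<le> Suc k \<longleftrightarrow> j < part m i + B i k" if "(i, j) \<in> skew" for i j k
  proof -
    let ?P = "\<lambda>k. j < part m i + B i k"
    have P: "?P (LEAST k. ?P k)" by (rule LeastI[of ?P "length v - 1"]) (use ex[OF that] in blast)
    show ?thesis
    proof
      assume "tab G (i, j) \<le> Suc k"
      then have "(LEAST k. ?P k) \<le> k" by (simp add: tab[OF that])
      from Bmono[OF this, of i] P show "?P k" by simp
    next
      assume "?P k"
      then have "(LEAST k. ?P k) \<le> k" by (rule Least_le)
      then show "tab G (i, j) \<le> Suc k" by (simp add: tab[OF that])
    qed
  qed
  have T: "row_weak (tab G)"
    unfolding row_weak_def
  proof (intro conjI allI impI)
    show "tab G \<in> skew \<rightarrow>\<^sub>E {1..length v}"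
    proof (rule PiE_I)
      fix c assume c: "c \<in> skew"
      obtain i j where ij: "c = (i, j)" by (cases c)
      show "tab G c \<in> {1..length v}"
        using ex[of i j] tab_le[of i j "length v - 1"] tab[of i j] c by (auto simp: ij)
    next
      fix c assume "c \<notin> skew"
      then show "tab G c = undefined" by (cases c) (simp add: tab_def)
    qed
    fix i j j' assume j: "part m i \<le> j \<and> j < j' \<and> j' < part l i"
    then have s: "(i, j) \<in> skew" "(i, j') \<in> skew" by (auto simp: skew_def)
    obtain k where k: "tab G (i, j') = Suc k" using tab[OF s(2)] by simp
    then have "j' < part m i + B i k" using tab_le[OF s(2), of k] by simp
    then show "tab G (i, j) \<le> tab G (i, j')" using tab_le[OF s(1), of k] j k by simp
  qed
  have rowsum: "(\<Sum>k'\<le>k. arow (tab G) i k') = B i k" if i: "i < L" for i k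
  proof -
    have "{j. part m i \<le> j \<and> j < part l i \<and> tab G (i, j) \<le> Suc k} = {part m i..<part m i + B i k}"
    proof (intro equalityI subsetI)
      fix j assume "j \<in> {j. part m i \<le> j \<and> j < part l i \<and> tab G (i, j) \<le> Suc k}"
      then show "j \<in> {part m i..<part m i + B i k}" using tab_le[of i j k] by (simp add: skew_def)
    next
      fix j assume j: "j \<in> {part m i..<part m i + B i k}"
      then have "j < part l i" using Bmax[of i k] wt[OF i] by auto
      then show "j \<in> {j. part m i \<le> j \<and> j < part l i \<and> tab G (i, j) \<le> Suc k}" using tab_le[of i j k] j by (simp add: skew_def)
    qed
    then show ?thesis unfolding sum_arow[OF T] by simp
  qed
  have arow: "arow (tab G) i k = G (Suc i) k - G i k" if i: "i < L" for i k
  proof (cases k)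
    case 0
    then show ?thesis using rowsum[OF i, of 0] by (simp add: B_def)
  next
    case (Suc k')
    then show ?thesis using rowsum[OF i, of k] rowsum[OF i, of k'] by (simp add: B_def)
  qed
  have arow': "arow (tab G) i k = G (Suc i) k - G i k" for i k
  proof (cases "i < L")
    case False
    then have "G (Suc i) = G i" using G by (simp add: GT_def)
    then show ?thesis using False length_le arow_0[of i "tab G" k] by simp
  qed (rule arow)
  have "pat (tab G) i k = G i k" for i k
  proof (induction i)
    case 0
    then show ?case using G by (simp add: pat_def GT_def)
  next
    case (Suc i)
    then show ?case using GT_step[OF G, of i k] by (simp add: pat_Suc arow')
  qed
  then show pat: "pat (tab G) = G" by (simp add: fun_eq_iff)
  show "tab G \<in> lr_tableaux"
    unfolding lr_tableaux_iff columns_iff[OF T] lattice_iff[OF T] card_content pat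
    using T good G length_le by (auto simp: GT_def)
qed

lemma card_lr_tableaux: "card lr_tableaux = card lr_patterns"
proof -
  have "bij_betw pat lr_tableaux lr_patterns"
  proof (rule bij_betw_byWitness[where f' = tab])
    show "\<forall>T\<in>lr_tableaux. tab (pat T) = T" using tab_pat by (simp add: lr_tableaux_iff)
    show "\<forall>G\<in>lr_patterns. pat (tab G) = G" using lr_patterns_tab by blast
    show "pat ` lr_tableaux \<subseteq> lr_patterns" using lr_tableaux_pat by blast
    show "tab ` lr_patterns \<subseteq> lr_tableaux" using lr_patterns_tab by blast
  qed
  then show ?thesis by (rule bij_betw_same_card)
qed

end

text \<open>For a contained shape this is the bijection above. Otherwise some row of
  \<open>m\<close> exceeds that of \<open>l\<close>, and no nonnegative weight can make
  \<open>part m + wt\<close> equal \<open>part l\<close>, in agreement with the value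
  \<open>0\<close> of \<open>LR_coeff\<close>.\<close>

theorem LR_coeff_eq_lr_number:
  assumes l: "l \<in> partitions_of (p + q)" and m: "m \<in> partitions_of p" and v: "v \<in> partitions_of q"
    and L: "p + q \<le> L"
  shows "LR_coeff l m v = lr_number L (part l) (part m) (part v)"
proof (cases "cells m \<subseteq> cells l")
  case True
  have sub: "part m i \<le> part l i" for i
  proof (rule ccontr)
    assume "\<not> part m i \<le> part l i"
    then have "(i, part l i) \<in> cells m" by (simp add: cells_eq shape_cells_def)
    then show False using True by (auto simp: cells_eq shape_cells_def)
  qed
  show ?thesis
    using card_lr_tableaux[OF l m v L sub] True
    unfolding lr_tableaux_def[OF l m v L sub] lr_patterns_def[OF l m v L sub] LR_coeff_def lr_number_def
    by (simp only: if_True)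
next
  case False
  then obtain i j where "j < part m i" "\<not> j < part l i" by (auto simp: cells_eq shape_cells_def)
  then have lt: "part l i < part m i" by simp
  have "part m \<in> Par L p" using m L by (intro part_Par) auto
  then have iL: "i < L" using lt by (cases "i < L") (auto simp: Par_def)
  have "\<not> (\<forall>k<L. part m k + wt L G k = part l k)" for G
  proof
    assume "\<forall>k<L. part m k + wt L G k = part l k"
    then have "part m i + wt L G i = part l i" using iL by blast
    then show False using lt by simp
  qed
  then have "{G \<in> GT L (part v). good L (part m) G \<and> (\<forall>k<L. part m k + wt L G k = part l k)} = {}" by blast
  then show ?thesis using False unfolding LR_coeff_def lr_number_def by (simp only: if_False card.empty)
qed

section \<open>Eigenvalues from traces\<close>

lemma sum_mset_poly:
  fixes E :: "'a :: comm_ring_1 multiset"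
  shows "(\<Sum>z\<in>#E. poly q z) = (\<Sum>i\<le>degree q. coeff q i * (\<Sum>z\<in>#E. z ^ i))"
  by (induction E) (simp_all add: poly_altdef distrib_left sum.distrib)

text \<open>Equal power sums give equal sums of every polynomial; one that vanishes on all elements
  except \<open>c\<close> reads off the multiplicity of \<open>c\<close>.\<close>

lemma multiset_eq_if_power_sums_eq:
  fixes E F :: "complex multiset"
  assumes "\<And>k. (\<Sum>z\<in>#E. z ^ k) = (\<Sum>z\<in>#F. z ^ k)"
  shows "E = F"
proof (rule multiset_eqI)
  fix c
  define S where "S = set_mset (E + F) - {c}"
  define q where "q = (\<Prod>s\<in>S. [:- s, 1:])"
  have q0: "poly q z = 0" if "z \<in> S" for z
    using that by (auto simp: q_def poly_prod S_def)
  have qc: "poly q c \<noteq> 0" by (auto simp: q_def poly_prod S_def)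
  have count: "(\<Sum>z\<in>#G. poly q z) = of_nat (count G c) * poly q c" if "set_mset G \<subseteq> set_mset (E + F)" for G
    using that
  proof (induction G)
    case (add z G)
    then have IH: "(\<Sum>z\<in>#G. poly q z) = of_nat (count G c) * poly q c" by simp
    show ?case
    proof (cases "z = c")
      case True
      then show ?thesis using IH by (simp add: algebra_simps)
    next
      case False
      then have "poly q z = 0" using add.prems by (intro q0) (auto simp: S_def)
      then show ?thesis using IH False by simp
    qed
  qed simp
  have "(\<Sum>z\<in>#E. poly q z) = (\<Sum>z\<in>#F. poly q z)"
    unfolding sum_mset_poly assms ..
  then show "count E c = count F c" using qc by (simp add: count)
qed

lemma trace_mult_comm:
  fixes A B :: "'a :: comm_semiring_0 mat"
  assumes A: "A \<in> carrier_mat n n" and B: "B \<in> carrier_mat n n"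
  shows "(\<Sum>i<n. (A * B) $$ (i, i)) = (\<Sum>i<n. (B * A) $$ (i, i))"
proof -
  have "(\<Sum>i<n. (A * B) $$ (i, i)) = (\<Sum>i<n. \<Sum>j<n. A $$ (i, j) * B $$ (j, i))"
    using A B by (intro sum.cong) (auto simp: scalar_prod_def atLeast0LessThan)
  also have "\<dots> = (\<Sum>j<n. \<Sum>i<n. B $$ (j, i) * A $$ (i, j))"
    by (subst sum.swap) (simp add: mult.commute)
  also have "\<dots> = (\<Sum>i<n. (B * A) $$ (i, i))"
    using A B by (intro sum.cong) (auto simp: scalar_prod_def atLeast0LessThan)
  finally show ?thesis .
qed

lemma upper_triangular_pow:
  fixes B :: "'a :: comm_semiring_1 mat"
  assumes B: "B \<in> carrier_mat n n" and U: "upper_triangular B"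
  shows "upper_triangular (B ^\<^sub>m k) \<and> (\<forall>i<n. (B ^\<^sub>m k) $$ (i, i) = (B $$ (i, i)) ^ k)"
proof (induction k)
  case (Suc k)
  have Bk: "B ^\<^sub>m k \<in> carrier_mat n n" using B by simp
  have entry: "(B ^\<^sub>m Suc k) $$ (i, j) = (\<Sum>l<n. (B ^\<^sub>m k) $$ (i, l) * B $$ (l, j))" if "i < n" "j < n" for i j
    using B Bk that by (simp add: scalar_prod_def atLeast0LessThan)
  have zk: "(B ^\<^sub>m k) $$ (i, j) = 0" if "j < i" "i < n" for i j using Suc Bk that by auto
  have z: "B $$ (i, j) = 0" if "j < i" "i < n" for i j using U B that by auto
  have "(B ^\<^sub>m Suc k) $$ (i, j) = 0" if "j < i" "i < n" for i j
  proof -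
    have "(B ^\<^sub>m k) $$ (i, l) * B $$ (l, j) = 0" if l: "l < n" for l
      using zk[of l i] z[of j l] \<open>j < i\<close> \<open>i < n\<close> l by (cases "l < i") auto
    then show ?thesis using entry[of i j] that by simp
  qed
  then have "upper_triangular (B ^\<^sub>m Suc k)" using B by (auto simp: upper_triangular_def simp del: pow_mat.simps)
  moreover have "(B ^\<^sub>m Suc k) $$ (i, i) = (B $$ (i, i)) ^ Suc k" if i: "i < n" for i
  proof -
    have "(B ^\<^sub>m k) $$ (i, l) * B $$ (l, i) = (if l = i then (B $$ (i, i)) ^ Suc k else 0)" if l: "l < n" for l
      using zk[of l i] z[of i l] i l Suc by (cases l i rule: linorder_cases) (auto simp: mult.commute)
    then show ?thesis using entry[OF i i] i by (simp del: pow_mat.simps)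
  qed
  ultimately show ?case by blast
qed (use B in \<open>auto simp: upper_triangular_def\<close>)

text \<open>Schur triangularisation puts the eigenvalues on a diagonal, where powers are taken
  entrywise, and similarity preserves traces of powers.\<close>

lemma trace_pow_eigenvalues:
  fixes A :: "complex mat"
  assumes A: "A \<in> carrier_mat n n"
  shows "(\<Sum>z\<in>#proots (char_poly A). z ^ k) = (\<Sum>i<n. (A ^\<^sub>m k) $$ (i, i))"
proof -
  obtain es where es: "char_poly A = (\<Prod>a\<leftarrow>es. [:- a, 1:])" "length es = n"
    using char_poly_factorized[OF A] by blast
  obtain B P Q where d: "schur_decomposition A es = (B, P, Q)" by (cases "schur_decomposition A es")
  have wit: "similar_mat_wit A B P Q" and U: "upper_triangular B" and diag: "diag_mat B = es"
    using schur_decomposition[OF A es(1) d] by auto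
  note w = similar_mat_witD2[OF A wit]
  have nz: "(\<Prod>a\<leftarrow>es. [:- a, 1:]) \<noteq> 0" for es :: "complex list"
    by (auto simp: prod_list_zero_iff)
  have "proots (\<Prod>a\<leftarrow>es. [:- a, 1:]) = mset es"
  proof (induction es)
    case (Cons a es)
    have "proots ([:- a, 1:] * (\<Prod>a\<leftarrow>es. [:- a, 1:])) = proots [:- a, 1:] + proots (\<Prod>a\<leftarrow>es. [:- a, 1:])"
      by (rule proots_mult[OF _ nz]) simp
    then show ?case using Cons by (simp del: mult_pCons_left)
  qed simp
  then have "(\<Sum>z\<in>#proots (char_poly A). z ^ k) = (\<Sum>z\<leftarrow>es. z ^ k)"
    by (simp add: es(1) sum_mset_sum_list[symmetric] flip: mset_map)
  also have "\<dots> = (\<Sum>i<n. (B $$ (i, i)) ^ k)"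
    using w(5) unfolding diag[symmetric] diag_mat_def
    by (simp add: o_def interv_sum_list_conv_sum_set_nat atLeast0LessThan)
  also have "\<dots> = (\<Sum>i<n. (B ^\<^sub>m k) $$ (i, i))"
    using upper_triangular_pow[OF w(5) U, of k] by simp
  also have "\<dots> = (\<Sum>i<n. (Q * (P * B ^\<^sub>m k)) $$ (i, i))"
    using w by (simp add: assoc_mult_mat[of Q n n P n "B ^\<^sub>m k" n, symmetric])
  also have "\<dots> = (\<Sum>i<n. ((P * B ^\<^sub>m k) * Q) $$ (i, i))"
    using w by (intro trace_mult_comm) auto
  also have "\<dots> = (\<Sum>i<n. (A ^\<^sub>m k) $$ (i, i))"
    unfolding similar_mat_wit_pow_id[OF wit] ..
  finally show ?thesis .
qed

lemma eigenvalue_mset_power_sum: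
  fixes M :: "real mat"
  assumes M: "M \<in> carrier_mat n n"
  shows "(\<Sum>z\<in>#eigenvalue_mset M. z ^ k) = of_real (\<Sum>i<n. (M ^\<^sub>m k) $$ (i, i))"
proof -
  have "map_mat complex_of_real M ^\<^sub>m k = map_mat complex_of_real (M ^\<^sub>m k)"
    by (rule of_real_hom.mat_hom_pow[OF M, symmetric])
  moreover have "map_mat complex_of_real M \<in> carrier_mat n n" using M by simp
  ultimately show ?thesis using M unfolding eigenvalue_mset_def
    by (simp add: trace_pow_eigenvalues)
qed

lemma pow_mat_Suc_left:
  fixes A :: "'a :: semiring_1 mat"
  assumes A: "A \<in> carrier_mat n n"
  shows "A ^\<^sub>m Suc k = A * A ^\<^sub>m k"
proof (induction k)
  case 0
  then show ?case using A by simp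
next
  case (Suc k)
  have "A ^\<^sub>m Suc (Suc k) = (A * A ^\<^sub>m k) * A" using Suc by simp
  also have "\<dots> = A * (A ^\<^sub>m k * A)" by (rule assoc_mult_mat) (use A in auto)
  finally show ?case by simp
qed

section \<open>The shuffle as an operator on functions\<close>

definition offdiag :: "nat set \<Rightarrow> (nat \<times> nat) set" where
  "offdiag X = {(i, j). i \<in> X \<and> j \<in> X \<and> i \<noteq> j}"

definition trans_sum :: "nat set \<Rightarrow> ((nat \<Rightarrow> nat) \<Rightarrow> real) \<Rightarrow> (nat \<Rightarrow> nat) \<Rightarrow> real" where
  "trans_sum X f \<pi> = (\<Sum>(i, j)\<in>offdiag X. f (\<pi> \<circ> swp i j))"

text \<open>
  In \<open>trans_sum\<close> every transposition occurs twice, as \<open>(i, j)\<close> and as \<open>(j, i)\<close>.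
\<close>

definition walk :: "real \<Rightarrow> real \<Rightarrow> real \<Rightarrow> real \<Rightarrow> nat set \<Rightarrow> nat set \<Rightarrow> ((nat \<Rightarrow> nat) \<Rightarrow> real) \<Rightarrow> (nat \<Rightarrow> nat) \<Rightarrow> real" where
  "walk c \<alpha> \<beta> \<gamma> A B f \<pi> = c * f \<pi> + \<alpha> * trans_sum A f \<pi> + \<beta> * trans_sum B f \<pi> + \<gamma> * trans_sum (A \<union> B) f \<pi>"

lemma swp_conj: "bij (t :: 'a \<Rightarrow> 'a) \<Longrightarrow> swp i j \<circ> t = t \<circ> swp (inv t i) (inv t j)"
proof (rule ext)
  fix x assume t: "bij t"
  have eq: "x = inv t k \<longleftrightarrow> t x = k" for k using bij_inv_eq_iff[OF t, of x k] by blast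
  have "t (inv t k) = k" for k using t by (simp add: bij_is_surj surj_f_inv_f)
  then show "(swp i j \<circ> t) x = (t \<circ> swp (inv t i) (inv t j)) x"
    by (simp add: Transposition.transpose_def eq)
qed

text \<open>Conjugation by a transposition inside \<open>Y\<close> permutes the transpositions of
  \<open>Y\<close>, so their sum commutes with every transposition of \<open>X\<close>.\<close>

lemma trans_sum_commute:
  assumes X: "X \<subseteq> Y"
  shows "trans_sum Y (trans_sum X f) \<pi> = trans_sum X (trans_sum Y f) \<pi>"
proof -
  have conj: "(\<Sum>(i, j)\<in>offdiag Y. f (\<pi> \<circ> swp i j \<circ> swp p q)) = (\<Sum>(i, j)\<in>offdiag Y. f (\<pi> \<circ> swp p q \<circ> swp i j))"
    if "p \<in> Y" "q \<in> Y" for p q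
  proof -
    define r where "r = (\<lambda>(i, j). (swp p q i, swp p q j))"
    have in_Y: "swp p q k \<in> Y" if "k \<in> Y" for k
      using that \<open>p \<in> Y\<close> \<open>q \<in> Y\<close> by (simp add: Transposition.transpose_def)
    have rr: "r (r a) = a" for a by (simp add: r_def case_prod_unfold)
    have r_in: "r a \<in> offdiag Y" if "a \<in> offdiag Y" for a
    proof -
      obtain i j where a: "a = (i, j)" "i \<in> Y" "j \<in> Y" "i \<noteq> j" using \<open>a \<in> offdiag Y\<close> by (auto simp: offdiag_def)
      then have "swp p q i \<noteq> swp p q j" by (metis transpose_involutory)
      then show ?thesis using a in_Y by (simp add: offdiag_def r_def)
    qed
    have val: "(case r a of (i, j) \<Rightarrow> f (\<pi> \<circ> swp p q \<circ> swp i j)) = (case a of (i, j) \<Rightarrow> f (\<pi> \<circ> swp i j \<circ> swp p q))" for a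
    proof -
      obtain i j where a: "a = (i, j)" by (cases a)
      have "swp p q \<circ> swp (swp p q i) (swp p q j) = swp i j \<circ> swp p q"
        using swp_conj[of "swp p q" i j] by simp
      then show ?thesis by (simp add: a r_def comp_assoc)
    qed
    show ?thesis
      by (rule sum.reindex_bij_witness[of _ r r]) (simp_all only: rr r_in val)
  qed
  have "trans_sum Y (trans_sum X f) \<pi> = (\<Sum>(p, q)\<in>offdiag X. \<Sum>(i, j)\<in>offdiag Y. f (\<pi> \<circ> swp i j \<circ> swp p q))"
    unfolding trans_sum_def case_prod_unfold by (rule sum.swap)
  also have "\<dots> = trans_sum X (trans_sum Y f) \<pi>"
    unfolding trans_sum_def
  proof (rule sum.cong[OF refl])
    fix a assume "a \<in> offdiag X"
    then have "fst a \<in> Y" "snd a \<in> Y" using X by (auto simp: offdiag_def)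
    from conj[OF this] show "(case a of (p, q) \<Rightarrow> \<Sum>(i, j)\<in>offdiag Y. f (\<pi> \<circ> swp i j \<circ> swp p q)) =
        (case a of (p, q) \<Rightarrow> \<Sum>(i, j)\<in>offdiag Y. f (\<pi> \<circ> swp p q \<circ> swp i j))"
      by (simp add: case_prod_unfold)
  qed
  finally show ?thesis .
qed

lemma trans_sum_linear:
  "trans_sum X (\<lambda>\<pi>. \<Sum>l\<in>S. c l * f l \<pi>) \<pi> = (\<Sum>l\<in>S. c l * trans_sum X (f l) \<pi>)"
  unfolding trans_sum_def case_prod_unfold sum_distrib_left by (rule sum.swap)

lemma walk_linear:
  "walk c \<alpha> \<beta> \<gamma> A B (\<lambda>\<pi>. \<Sum>l\<in>S. g l * f l \<pi>) \<pi> = (\<Sum>l\<in>S. g l * walk c \<alpha> \<beta> \<gamma> A B (f l) \<pi>)"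
  unfolding walk_def trans_sum_linear distrib_left sum.distrib sum_distrib_left
  by (simp only: mult.left_commute)

lemma trans_sum_cong:
  assumes "\<And>\<pi>. \<pi> permutes I \<Longrightarrow> f \<pi> = g \<pi>" "X \<subseteq> I" "\<pi> permutes I"
  shows "trans_sum X f \<pi> = trans_sum X g \<pi>"
  unfolding trans_sum_def
proof (intro sum.cong refl)
  fix p assume "p \<in> offdiag X"
  then have "\<pi> \<circ> swp (fst p) (snd p) permutes I"
    using assms by (intro permutes_compose permutes_swap_id) (auto simp: offdiag_def)
  then show "(case p of (i, j) \<Rightarrow> f (\<pi> \<circ> swp i j)) = (case p of (i, j) \<Rightarrow> g (\<pi> \<circ> swp i j))"
    using assms(1) by (simp add: case_prod_unfold)
qed

lemma walk_cong:
  assumes "\<And>\<pi>. \<pi> permutes (A \<union> B) \<Longrightarrow> f \<pi> = g \<pi>" "\<pi> permutes (A \<union> B)"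
  shows "walk c \<alpha> \<beta> \<gamma> A B f \<pi> = walk c \<alpha> \<beta> \<gamma> A B g \<pi>"
proof -
  have "trans_sum X f \<pi> = trans_sum X g \<pi>" if "X \<subseteq> A \<union> B" for X
    using assms(1) that assms(2) by (rule trans_sum_cong)
  then show ?thesis unfolding walk_def by (simp only: assms Un_upper1 Un_upper2 order_refl)
qed

lemma trans_sum_walk:
  "trans_sum (A \<union> B) (walk c \<alpha> \<beta> \<gamma> A B f) \<pi> = walk c \<alpha> \<beta> \<gamma> A B (trans_sum (A \<union> B) f) \<pi>"
proof -
  have "trans_sum (A \<union> B) (walk c \<alpha> \<beta> \<gamma> A B f) \<pi> = c * trans_sum (A \<union> B) f \<pi> + \<alpha> * trans_sum (A \<union> B) (trans_sum A f) \<pi>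
      + \<beta> * trans_sum (A \<union> B) (trans_sum B f) \<pi> + \<gamma> * trans_sum (A \<union> B) (trans_sum (A \<union> B) f) \<pi>"
    unfolding walk_def trans_sum_def[of "A \<union> B" "\<lambda>\<pi>. _ \<pi>"]
    by (simp add: trans_sum_def[of "A \<union> B"] case_prod_unfold sum.distrib sum_distrib_left)
  then show ?thesis by (simp add: walk_def trans_sum_commute[of A "A \<union> B"] trans_sum_commute[of B "A \<union> B"])
qed

lemma trans_sum_chi:
  "finite I \<Longrightarrow> s permutes I \<Longrightarrow> l \<in> Par m (card I) \<Longrightarrow>
    trans_sum I (\<lambda>s. chi m I s l) s = 2 * content m l * chi m I s l"
  unfolding trans_sum_def offdiag_def by (rule chi_transposes)

context
  fixes A B :: "nat set" and m :: nat and l :: "nat \<Rightarrow> nat" and c \<alpha> \<beta> \<gamma> :: real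
  assumes A: "finite A" and B: "finite B" and AB: "A \<inter> B = {}" and l: "l \<in> Par m (card A + card B)"
begin

text \<open>A power of the walk applied to a character need not be a class function; but
  \<open>trans_sum (A \<union> B)\<close> commutes with \<open>walk\<close>, so the eigenvalue
  equation is inherited from \<open>chi\<close>.\<close>

lemma walk_pow_eigen:
  assumes "\<pi> permutes A \<union> B"
  shows "trans_sum (A \<union> B) ((walk c \<alpha> \<beta> \<gamma> A B ^^ k) (\<lambda>s. chi m (A \<union> B) s l)) \<pi> =
    2 * content m l * (walk c \<alpha> \<beta> \<gamma> A B ^^ k) (\<lambda>s. chi m (A \<union> B) s l) \<pi>"
  using assms
proof (induction k arbitrary: \<pi>)
  case 0
  then show ?case using A B l card_Un_disjoint[OF A B AB] by (simp add: trans_sum_chi)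
next
  case (Suc k)
  let ?h = "(walk c \<alpha> \<beta> \<gamma> A B ^^ k) (\<lambda>s. chi m (A \<union> B) s l)"
  have "trans_sum (A \<union> B) (walk c \<alpha> \<beta> \<gamma> A B ?h) \<pi> = walk c \<alpha> \<beta> \<gamma> A B (trans_sum (A \<union> B) ?h) \<pi>"
    by (rule trans_sum_walk)
  \<comment> \<open>The scalar is written as a sum over one index so that \<open>walk_linear\<close>
    can pull it out.\<close>
  also have "\<dots> = walk c \<alpha> \<beta> \<gamma> A B (\<lambda>\<pi>. \<Sum>_\<in>{()}. 2 * content m l * ?h \<pi>) \<pi>"
    using Suc by (intro walk_cong) auto
  also have "\<dots> = 2 * content m l * walk c \<alpha> \<beta> \<gamma> A B ?h \<pi>"
    unfolding walk_linear by simp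
  finally show ?case by simp
qed

definition eigval :: "(nat \<Rightarrow> nat) \<Rightarrow> (nat \<Rightarrow> nat) \<Rightarrow> real" where
  "eigval \<mu> \<nu> = c + 2 * \<alpha> * content m \<mu> + 2 * \<beta> * content m \<nu> + 2 * \<gamma> * content m l"

text \<open>On \<open>s \<circ> r\<close> the terms for \<open>A\<close> and \<open>B\<close> change
  only \<open>s\<close> or only \<open>r\<close>, and act on the corresponding character factor. The
  term for \<open>A \<union> B\<close> would leave the product form; it is replaced by its
  eigenvalue through \<open>walk_pow_eigen\<close>.\<close>

lemma walk_pow_product:
  assumes "s permutes A" "r permutes B"
  shows "(walk c \<alpha> \<beta> \<gamma> A B ^^ k) (\<lambda>s. chi m (A \<union> B) s l) (s \<circ> r) =
    (\<Sum>\<mu>\<in>Par m (card A). \<Sum>\<nu>\<in>Par m (card B). real (lr_number m l \<mu> \<nu>) * eigval \<mu> \<nu> ^ k * chi m A s \<mu> * chi m B r \<nu>)"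
  using assms
proof (induction k arbitrary: s r)
  case 0
  then show ?case unfolding funpow.simps id_apply power_0 mult_1_right by (intro chi_product[OF A B AB _ _ l])
next
  case (Suc k)
  let ?h = "(walk c \<alpha> \<beta> \<gamma> A B ^^ k) (\<lambda>s. chi m (A \<union> B) s l)"
  let ?P = "Par m (card A)" and ?Q = "Par m (card B)"
  let ?t = "\<lambda>\<mu> \<nu>. real (lr_number m l \<mu> \<nu>) * eigval \<mu> \<nu> ^ k * chi m A s \<mu> * chi m B r \<nu>"
  have sr: "s \<circ> r permutes A \<union> B"
    by (intro permutes_compose) (use Suc.prems in \<open>auto intro: permutes_subset\<close>)
  \<comment> \<open>\<open>r\<close> fixes \<open>A\<close> pointwise, so transpositions of
    \<open>A\<close> pass through it and are absorbed into \<open>s\<close>.\<close>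
  have comm: "s \<circ> r \<circ> swp i j = (s \<circ> swp i j) \<circ> r" if "i \<in> A" "j \<in> A" for i j
  proof -
    have "swp i j \<circ> r = r \<circ> swp i j"
    proof -
      have "inv r i = i" "inv r j = j"
        using that AB permutes_not_in[OF permutes_inv[OF Suc.prems(2)]] by auto
      then show ?thesis using swp_conj[OF permutes_bij[OF Suc.prems(2)], of i j] by simp
    qed
    then show ?thesis by (simp add: comp_assoc)
  qed
  have UA: "trans_sum A ?h (s \<circ> r) = (\<Sum>\<mu>\<in>?P. \<Sum>\<nu>\<in>?Q. 2 * content m \<mu> * ?t \<mu> \<nu>)"
  proof -
    have "trans_sum A ?h (s \<circ> r) = trans_sum A (\<lambda>s. \<Sum>\<mu>\<in>?P. (\<Sum>\<nu>\<in>?Q. real (lr_number m l \<mu> \<nu>) * eigval \<mu> \<nu> ^ k * chi m B r \<nu>) * chi m A s \<mu>) s"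
      unfolding trans_sum_def
    proof (intro sum.cong refl)
      fix p assume "p \<in> offdiag A"
      then obtain i j where p: "p = (i, j)" "i \<in> A" "j \<in> A" by (auto simp: offdiag_def)
      have "s \<circ> swp i j permutes A" using p Suc.prems by (intro permutes_compose permutes_swap_id)
      then have "?h ((s \<circ> swp i j) \<circ> r) = (\<Sum>\<mu>\<in>?P. \<Sum>\<nu>\<in>?Q. real (lr_number m l \<mu> \<nu>) * eigval \<mu> \<nu> ^ k * chi m A (s \<circ> swp i j) \<mu> * chi m B r \<nu>)"
        using Suc.prems(2) by (rule Suc.IH)
      also have "\<dots> = (\<Sum>\<mu>\<in>?P. (\<Sum>\<nu>\<in>?Q. real (lr_number m l \<mu> \<nu>) * eigval \<mu> \<nu> ^ k * chi m B r \<nu>) * chi m A (s \<circ> swp i j) \<mu>)"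
        unfolding sum_distrib_right by (intro sum.cong refl) (simp only: mult_ac)
      finally show "(case p of (i, j) \<Rightarrow> ?h (s \<circ> r \<circ> swp i j)) =
         (case p of (i, j) \<Rightarrow> \<Sum>\<mu>\<in>?P. (\<Sum>\<nu>\<in>?Q. real (lr_number m l \<mu> \<nu>) * eigval \<mu> \<nu> ^ k * chi m B r \<nu>) * chi m A (s \<circ> swp i j) \<mu>)"
        unfolding p(1) prod.case comm[OF p(2,3)] .
    qed
    also have "\<dots> = (\<Sum>\<mu>\<in>?P. (\<Sum>\<nu>\<in>?Q. real (lr_number m l \<mu> \<nu>) * eigval \<mu> \<nu> ^ k * chi m B r \<nu>) * (2 * content m \<mu> * chi m A s \<mu>))"
      unfolding trans_sum_linear by (intro sum.cong refl) (simp add: trans_sum_chi A Suc.prems)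
    finally show ?thesis by (simp add: sum_distrib_right sum_distrib_left mult_ac)
  qed
  have UB: "trans_sum B ?h (s \<circ> r) = (\<Sum>\<mu>\<in>?P. \<Sum>\<nu>\<in>?Q. 2 * content m \<nu> * ?t \<mu> \<nu>)"
  proof -
    have "trans_sum B ?h (s \<circ> r) = trans_sum B (\<lambda>r. \<Sum>\<nu>\<in>?Q. (\<Sum>\<mu>\<in>?P. real (lr_number m l \<mu> \<nu>) * eigval \<mu> \<nu> ^ k * chi m A s \<mu>) * chi m B r \<nu>) r"
      unfolding trans_sum_def
    proof (intro sum.cong refl)
      fix p assume "p \<in> offdiag B"
      then obtain i j where p: "p = (i, j)" "i \<in> B" "j \<in> B" by (auto simp: offdiag_def)
      have "r \<circ> swp i j permutes B" using p Suc.prems by (intro permutes_compose permutes_swap_id)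
      with Suc.prems(1) have "?h (s \<circ> (r \<circ> swp i j)) = (\<Sum>\<mu>\<in>?P. \<Sum>\<nu>\<in>?Q. real (lr_number m l \<mu> \<nu>) * eigval \<mu> \<nu> ^ k * chi m A s \<mu> * chi m B (r \<circ> swp i j) \<nu>)"
        by (rule Suc.IH)
      also have "\<dots> = (\<Sum>\<nu>\<in>?Q. (\<Sum>\<mu>\<in>?P. real (lr_number m l \<mu> \<nu>) * eigval \<mu> \<nu> ^ k * chi m A s \<mu>) * chi m B (r \<circ> swp i j) \<nu>)"
        unfolding sum_distrib_right by (rule sum.swap)
      finally show "(case p of (i, j) \<Rightarrow> ?h (s \<circ> r \<circ> swp i j)) =
         (case p of (i, j) \<Rightarrow> \<Sum>\<nu>\<in>?Q. (\<Sum>\<mu>\<in>?P. real (lr_number m l \<mu> \<nu>) * eigval \<mu> \<nu> ^ k * chi m A s \<mu>) * chi m B (r \<circ> swp i j) \<nu>)"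
        unfolding p(1) prod.case comp_assoc .
    qed
    also have "\<dots> = (\<Sum>\<nu>\<in>?Q. (\<Sum>\<mu>\<in>?P. real (lr_number m l \<mu> \<nu>) * eigval \<mu> \<nu> ^ k * chi m A s \<mu>) * (2 * content m \<nu> * chi m B r \<nu>))"
      unfolding trans_sum_linear by (intro sum.cong refl) (simp add: trans_sum_chi B Suc.prems)
    also have "\<dots> = (\<Sum>\<mu>\<in>?P. \<Sum>\<nu>\<in>?Q. real (lr_number m l \<mu> \<nu>) * eigval \<mu> \<nu> ^ k * chi m A s \<mu> * (2 * content m \<nu> * chi m B r \<nu>))"
      unfolding sum_distrib_right by (rule sum.swap)
    finally show ?thesis by (simp add: mult_ac)
  qed
  have "(walk c \<alpha> \<beta> \<gamma> A B ^^ Suc k) (\<lambda>s. chi m (A \<union> B) s l) (s \<circ> r) =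
      c * ?h (s \<circ> r) + \<alpha> * trans_sum A ?h (s \<circ> r) + \<beta> * trans_sum B ?h (s \<circ> r) + \<gamma> * (2 * content m l * ?h (s \<circ> r))"
    by (simp add: walk_def[of _ _ _ _ _ _ ?h] walk_pow_eigen[OF sr])
  also have "\<dots> = (\<Sum>\<mu>\<in>?P. \<Sum>\<nu>\<in>?Q. c * ?t \<mu> \<nu> + \<alpha> * (2 * content m \<mu> * ?t \<mu> \<nu>) + \<beta> * (2 * content m \<nu> * ?t \<mu> \<nu>)
      + \<gamma> * (2 * content m l * ?t \<mu> \<nu>))"
    unfolding UA UB Suc.IH[OF Suc.prems] by (simp add: sum.distrib sum_distrib_left)
  also have "\<dots> = (\<Sum>\<mu>\<in>?P. \<Sum>\<nu>\<in>?Q. real (lr_number m l \<mu> \<nu>) * eigval \<mu> \<nu> ^ Suc k * chi m A s \<mu> * chi m B r \<nu>)"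
    by (intro sum.cong refl) (simp add: eigval_def algebra_simps)
  finally show ?case .
qed

end

section \<open>The regular character\<close>

lemma card_bijections:
  assumes I: "finite I" and J: "finite J" and c: "card I = card J"
  shows "card {w \<in> extensional I. bij_betw w I J} = fact (card I)"
proof -
  obtain g where g: "bij_betw g I J" using finite_same_card_bij[OF I J c] by blast
  have gi: "inv_into I g (g i) = i" if "i \<in> I" for i using g that by (simp add: bij_betw_def)
  have ig: "g (inv_into I g j) = j" if "j \<in> J" for j using g that by (simp add: bij_betw_def f_inv_into_f)
  have "bij_betw (\<lambda>p. restrict (g \<circ> p) I) {p. p permutes I} {w \<in> extensional I. bij_betw w I J}"
  proof (rule bij_betw_byWitness[where f' = "\<lambda>w i. if i \<in> I then inv_into I g (w i) else i"])
    show "\<forall>p\<in>{p. p permutes I}. (\<lambda>i. if i \<in> I then inv_into I g (restrict (g \<circ> p) I i) else i) = p"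
      using gi by (auto simp: fun_eq_iff permutes_in_image permutes_not_in)
    show "\<forall>w\<in>{w \<in> extensional I. bij_betw w I J}. restrict (g \<circ> (\<lambda>i. if i \<in> I then inv_into I g (w i) else i)) I = w"
      using ig by (auto simp: fun_eq_iff extensional_def dest: bij_betwE)
    show "(\<lambda>p. restrict (g \<circ> p) I) ` {p. p permutes I} \<subseteq> {w \<in> extensional I. bij_betw w I J}"
    proof safe
      fix p assume "p permutes I"
      then have "bij_betw (g \<circ> p) I J" by (rule bij_betw_trans[OF permutes_imp_bij g])
      then show "bij_betw (restrict (g \<circ> p) I) I J"
        using bij_betw_cong[of I "restrict (g \<circ> p) I" "g \<circ> p" J] by simp
    qed simp
    show "(\<lambda>w i. if i \<in> I then inv_into I g (w i) else i) ` {w \<in> extensional I. bij_betw w I J} \<subseteq> {p. p permutes I}"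
    proof safe
      fix w assume w: "bij_betw w I J"
      have "bij_betw (inv_into I g \<circ> w) I I" by (rule bij_betw_trans[OF w bij_betw_inv_into[OF g]])
      then have "bij_betw (\<lambda>i. if i \<in> I then inv_into I g (w i) else i) I I" by (simp cong: bij_betw_cong)
      then show "(\<lambda>i. if i \<in> I then inv_into I g (w i) else i) permutes I"
        by (rule bij_imp_permutes) auto
    qed
  qed
  then have "card {w \<in> extensional I. bij_betw w I J} = card {p. p permutes I}"
    by (simp add: bij_betw_same_card)
  then show ?thesis using card_permutations[OF refl I] by simp
qed

text \<open>\<open>paths n n l\<close> is the coefficient of the product of all variables in the
  Schur polynomial of \<open>l\<close>, so the sum counts the words that are fixed by
  \<open>s\<close> and use every letter once. Such words are injective, and only the identity fixes
  an injective word.\<close>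

theorem regular_character:
  assumes I: "finite I" and n: "card I = n" and s: "s permutes I"
  shows "(\<Sum>l\<in>Par n n. real (paths n n l) * chi n I s l) = (if s = id then fact n else 0)"
proof -
  have "(\<Sum>l\<in>Par n n. real (paths n n l) * chi n I s l) = (\<Sum>l\<in>Par n n. chi n I s l * real (card {G \<in> GT n l. \<forall>k<n. wt n G k = 1}))"
    by (intro sum.cong refl) (simp add: card_GT1[symmetric] GT1_def)
  also have "\<dots> = real (card {w \<in> words n I s. \<forall>k<n. ct I w k = 1})"
    using words_schur_coefficients[OF I s, of n "\<lambda>_. 1"] n by simp
  also have "\<dots> = (if s = id then fact n else 0)"
  proof -
    have bij: "bij_betw w I {..<n}" if w: "w \<in> I \<rightarrow>\<^sub>E {..<n}" "\<forall>k<n. ct I w k = 1" for w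
    proof -
      have "w ` I = {..<n}"
      proof (intro equalityI subsetI)
        fix k assume "k \<in> {..<n}"
        then have "card {i \<in> I. w i = k} = 1" using w by (simp add: ct_def)
        then obtain i where "{i \<in> I. w i = k} = {i}" by (rule card_1_singletonE)
        then have "i \<in> {i \<in> I. w i = k}" by simp
        then show "k \<in> w ` I" by blast
      qed (use w in auto)
      then have "inj_on w I" using I n by (intro eq_card_imp_inj_on) simp_all
      then show ?thesis using \<open>w ` I = {..<n}\<close> by (simp add: bij_betw_def)
    qed
    show ?thesis
    proof (cases "s = id")
      case True
      have "{w \<in> words n I s. \<forall>k<n. ct I w k = 1} = {w \<in> extensional I. bij_betw w I {..<n}}"
      proof (intro equalityI subsetI)
        fix w assume "w \<in> {w \<in> words n I s. \<forall>k<n. ct I w k = 1}"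
        then show "w \<in> {w \<in> extensional I. bij_betw w I {..<n}}"
          using bij by (auto simp: words_def PiE_def)
      next
        fix w assume w: "w \<in> {w \<in> extensional I. bij_betw w I {..<n}}"
        then have b: "bij_betw w I {..<n}" by simp
        have "ct I w k = 1" if k: "k < n" for k
        proof -
          obtain i where i: "i \<in> I" "w i = k" using b k unfolding bij_betw_def by (metis imageE lessThan_iff)
          then have "{i \<in> I. w i = k} = {i}" using b by (auto simp: bij_betw_def inj_on_def)
          then show ?thesis by (simp add: ct_def)
        qed
        then show "w \<in> {w \<in> words n I s. \<forall>k<n. ct I w k = 1}"
          using w True by (auto simp: words_def PiE_def dest: bij_betwE)
      qed
      then show ?thesis using card_bijections[OF I, of "{..<n}"] n True by simp
    next
      case False
      have "w \<notin> words n I s" if "\<forall>k<n. ct I w k = 1" for w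
      proof
        assume w: "w \<in> words n I s"
        then have "inj_on w I" using bij[of w] that by (auto simp: words_def bij_betw_def)
        then have "s i = i" if "i \<in> I" for i
          using w that permutes_in_image[OF s, of i] by (auto simp: words_def inj_on_def)
        then have "s = id" using permutes_not_in[OF s] by (auto simp: fun_eq_iff)
        then show False using False by simp
      qed
      then have "{w \<in> words n I s. \<forall>k<n. ct I w k = 1} = {}" by blast
      then show ?thesis using False by (simp only: card.empty of_nat_0 if_False)
    qed
  qed
  finally show ?thesis .
qed

section \<open>The transition matrix\<close>

lemma swp_eq_iff:
  assumes "p \<noteq> q"
  shows "swp p q = swp i j \<longleftrightarrow> i = p \<and> j = q \<or> i = q \<and> j = p"
proof
  assume e: "swp p q = swp i j"
  have h: "swp i j p = q" using fun_cong[OF e, of p] by simp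
  consider "p = i" | "p \<noteq> i" "p = j" | "p \<noteq> i" "p \<noteq> j" by blast
  then show "i = p \<and> j = q \<or> i = q \<and> j = p"
  proof cases
    case 1
    then show ?thesis using h by simp
  next
    case 2
    then show ?thesis using h by simp
  next
    case 3
    then have "swp i j p = p" by (intro transpose_apply_other) auto
    then show ?thesis using h assms by simp
  qed
next
  assume "i = p \<and> j = q \<or> i = q \<and> j = p"
  then show "swp p q = swp i j"
  proof
    assume "i = q \<and> j = p"
    then show ?thesis by (simp only: transpose_commute)
  qed simp
qed

lemma is_transposition_between_swp:
  assumes "p \<noteq> q"
  shows "is_transposition_between X Y (swp p q) \<longleftrightarrow> p \<in> X \<and> q \<in> Y \<or> q \<in> X \<and> p \<in> Y"
proof
  assume "is_transposition_between X Y (swp p q)"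
  then obtain i j where ij: "i \<in> X" "j \<in> Y" "swp p q = swp i j"
    unfolding is_transposition_between_def by blast
  from ij(3) have "i = p \<and> j = q \<or> i = q \<and> j = p" unfolding swp_eq_iff[OF assms] .
  then show "p \<in> X \<and> q \<in> Y \<or> q \<in> X \<and> p \<in> Y" using ij(1,2) by (elim disjE conjE) simp_all
next
  assume "p \<in> X \<and> q \<in> Y \<or> q \<in> X \<and> p \<in> Y"
  then show "is_transposition_between X Y (swp p q)"
  proof
    assume "p \<in> X \<and> q \<in> Y"
    then show ?thesis using assms unfolding is_transposition_between_def by (intro bexI[of _ p] bexI[of _ q]) simp_all
  next
    assume "q \<in> X \<and> p \<in> Y"
    moreover have "swp p q = swp q p" by (rule transpose_commute)
    ultimately show ?thesis using assms unfolding is_transposition_between_def by (intro bexI[of _ q] bexI[of _ p] conjI) simp_all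
  qed
qed

lemma is_transposition_betweenE:
  assumes "is_transposition_between X Y s" "X \<subseteq> I" "Y \<subseteq> I"
  obtains p q where "(p, q) \<in> offdiag I" "s = swp p q"
  using assms unfolding is_transposition_between_def offdiag_def by blast

lemma finite_offdiag: "finite I \<Longrightarrow> finite (offdiag I)"
  by (rule finite_subset[of _ "I \<times> I"]) (auto simp: offdiag_def)

lemma sum_diag_offdiag:
  fixes f :: "nat \<times> nat \<Rightarrow> real"
  assumes I: "finite I"
  shows "(\<Sum>p\<in>I \<times> I. f p) = (\<Sum>i\<in>I. f (i, i)) + (\<Sum>p\<in>offdiag I. f p)"
proof -
  have "I \<times> I = (\<lambda>i. (i, i)) ` I \<union> offdiag I" by (auto simp: offdiag_def)
  moreover have "finite (offdiag I)" using I by (rule finite_offdiag)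
  moreover have "(\<lambda>i. (i, i)) ` I \<inter> offdiag I = {}" by (auto simp: offdiag_def)
  ultimately have "(\<Sum>p\<in>I \<times> I. f p) = sum f ((\<lambda>i. (i, i)) ` I) + (\<Sum>p\<in>offdiag I. f p)"
    using I by (simp add: sum.union_disjoint)
  also have "sum f ((\<lambda>i. (i, i)) ` I) = (\<Sum>i\<in>I. f (i, i))"
    by (subst sum.reindex) (auto simp: inj_on_def)
  finally show ?thesis .
qed

lemma sum_offdiag_restrict:
  fixes f :: "nat \<times> nat \<Rightarrow> real"
  assumes "finite I" "X \<subseteq> I"
  shows "(\<Sum>p\<in>offdiag I. if fst p \<in> X \<and> snd p \<in> X then f p else 0) = (\<Sum>p\<in>offdiag X. f p)"
proof -
  have "(\<Sum>p\<in>offdiag I. if fst p \<in> X \<and> snd p \<in> X then f p else 0) = (\<Sum>p\<in>{p \<in> offdiag I. fst p \<in> X \<and> snd p \<in> X}. f p)"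
    by (rule sum.inter_filter[symmetric]) (rule finite_offdiag[OF assms(1)])
  also have "{p \<in> offdiag I. fst p \<in> X \<and> snd p \<in> X} = offdiag X" using assms(2) by (auto simp: offdiag_def)
  finally show ?thesis .
qed

section \<open>One step of the shuffle as a weighted sum over pairs of cards\<close>

definition delta_id :: "(nat \<Rightarrow> nat) \<Rightarrow> real" where
  "delta_id \<pi> = (if \<pi> = id then 1 else 0)"

context
  fixes A B :: "nat set" and a b :: real
  assumes A: "finite A" and B: "finite B" and AB: "A \<inter> B = {}"
begin

definition wgt :: "nat \<Rightarrow> real" where "wgt i = (if i \<in> A then a else b)"

definition tot :: real where "tot = real (card A + card B)"

definition hold :: real where "hold = (a\<^sup>2 * real (card A) + b\<^sup>2 * real (card B)) / tot\<^sup>2"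

lemma sum_wgt_squares: "(\<Sum>i\<in>A \<union> B. wgt i * wgt i / tot\<^sup>2) = hold"
proof -
  have "(\<Sum>i\<in>A \<union> B. wgt i * wgt i / tot\<^sup>2) = (\<Sum>i\<in>A. wgt i * wgt i / tot\<^sup>2) + (\<Sum>i\<in>B. wgt i * wgt i / tot\<^sup>2)"
    by (rule sum.union_disjoint[OF A B AB])
  also have "(\<Sum>i\<in>A. wgt i * wgt i / tot\<^sup>2) = (\<Sum>i\<in>A. a\<^sup>2 / tot\<^sup>2)"
    by (rule sum.cong[OF refl]) (simp add: wgt_def power2_eq_square)
  also have "(\<Sum>i\<in>B. wgt i * wgt i / tot\<^sup>2) = (\<Sum>i\<in>B. b\<^sup>2 / tot\<^sup>2)"
  proof (rule sum.cong[OF refl])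
    fix i assume "i \<in> B"
    then have "i \<notin> A" using AB by blast
    then show "wgt i * wgt i / tot\<^sup>2 = b\<^sup>2 / tot\<^sup>2" by (simp add: wgt_def power2_eq_square)
  qed
  finally show ?thesis by (simp add: hold_def add_divide_distrib mult.commute)
qed

text \<open>The five cases merge into one sum over the ordered pair of chosen cards: the two orders
  of a pair give the factor \<open>2\<close>, and choosing the same card twice gives the holding
  probability.\<close>

lemma shuffle_prob_eq_sum:
  assumes x: "x permutes A \<union> B" and z: "z permutes A \<union> B"
  shows "shuffle_prob A B a b x z =
    (\<Sum>(i, j)\<in>(A \<union> B) \<times> (A \<union> B). if z = swp i j \<circ> x then wgt i * wgt j / tot\<^sup>2 else 0)"
proof -
  let ?I = "A \<union> B"
  define s where "s = z \<circ> inv x"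
  have zs: "z = swp i j \<circ> x \<longleftrightarrow> s = swp i j" for i j
  proof
    assume "z = swp i j \<circ> x"
    then show "s = swp i j" using permutes_inv_o(1)[OF x] by (simp only: s_def comp_assoc comp_id)
  next
    assume "s = swp i j"
    then have "swp i j \<circ> x = z \<circ> inv x \<circ> x" by (simp only: s_def[symmetric])
    then have "swp i j \<circ> x = z \<circ> (inv x \<circ> x)" by (simp only: comp_assoc)
    then show "z = swp i j \<circ> x" using permutes_inv_o(2)[OF x] by (simp only: comp_id)
  qed
  have zx: "z = x \<longleftrightarrow> s = id" using zs[of 0 0] by simp
  have P: "shuffle_prob A B a b x z =
      (if is_transposition_between A A s then 2 * a\<^sup>2 / tot\<^sup>2
      else if is_transposition_between B B s then 2 * b\<^sup>2 / tot\<^sup>2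
      else if is_transposition_between A B s then 2 * a * b / tot\<^sup>2
      else if s = id then hold else 0)"
    unfolding shuffle_prob_def Let_def s_def[symmetric] tot_def[symmetric] hold_def zx ..
  have S: "(\<Sum>(i, j)\<in>?I \<times> ?I. if z = swp i j \<circ> x then wgt i * wgt j / tot\<^sup>2 else 0) =
      (if s = id then hold else 0) + (\<Sum>(i, j)\<in>offdiag ?I. if s = swp i j then wgt i * wgt j / tot\<^sup>2 else 0)"
  proof -
    have "finite ?I" using A B by simp
    note split = sum_diag_offdiag[OF this, of "\<lambda>(i, j). if s = swp i j then wgt i * wgt j / tot\<^sup>2 else 0"]
    have "(\<Sum>i\<in>?I. if s = swp i i then wgt i * wgt i / tot\<^sup>2 else 0) = (if s = id then hold else 0)"
    proof (cases "s = id")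
      case True
      then show ?thesis using sum_wgt_squares by simp
    next
      case False
      then show ?thesis by simp
    qed
    then show ?thesis unfolding zs split by (simp only: prod.case)
  qed
  show ?thesis
  proof (cases "\<exists>p q. (p, q) \<in> offdiag ?I \<and> s = swp p q")
    case True
    then obtain p q where pq: "p \<in> ?I" "q \<in> ?I" "p \<noteq> q" and s: "s = swp p q" by (auto simp: offdiag_def)
    have id: "s \<noteq> id" using pq(3) unfolding s by (metis id_apply transpose_apply_first)
    have "(\<Sum>(i, j)\<in>offdiag ?I. if s = swp i j then wgt i * wgt j / tot\<^sup>2 else 0) =
        (\<Sum>(i, j)\<in>{(p, q), (q, p)}. if s = swp i j then wgt i * wgt j / tot\<^sup>2 else 0)"
    proof (rule sum.mono_neutral_right)
      show "finite (offdiag ?I)" using A B by (simp add: finite_offdiag)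
      show "{(p, q), (q, p)} \<subseteq> offdiag ?I" using pq by (simp add: offdiag_def)
      show "\<forall>t\<in>offdiag ?I - {(p, q), (q, p)}. (case t of (i, j) \<Rightarrow> if s = swp i j then wgt i * wgt j / tot\<^sup>2 else 0) = 0"
      proof
        fix t assume "t \<in> offdiag ?I - {(p, q), (q, p)}"
        then obtain i j where t: "t = (i, j)" "\<not> (i = p \<and> j = q \<or> i = q \<and> j = p)" by (cases t) blast
        then have "s \<noteq> swp i j" unfolding s swp_eq_iff[OF pq(3)] by blast
        then show "(case t of (i, j) \<Rightarrow> if s = swp i j then wgt i * wgt j / tot\<^sup>2 else 0) = 0" by (simp add: t(1))
      qed
    qed
    also have "\<dots> = 2 * (wgt p * wgt q) / tot\<^sup>2"
    proof -
      have "swp q p = swp p q" by (rule transpose_commute)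
      moreover have "(p, q) \<noteq> (q, p)" using pq(3) by simp
      ultimately show ?thesis by (simp add: s)
    qed
    finally have "(\<Sum>(i, j)\<in>?I \<times> ?I. if z = swp i j \<circ> x then wgt i * wgt j / tot\<^sup>2 else 0) = 2 * (wgt p * wgt q) / tot\<^sup>2"
      unfolding S using id by simp
    moreover have "shuffle_prob A B a b x z = 2 * (wgt p * wgt q) / tot\<^sup>2"
    proof -
      have d: "i \<notin> A" if "i \<in> B" for i using AB that by blast
      have d': "i \<notin> B" if "i \<in> A" for i using AB that by blast
      consider "p \<in> A" "q \<in> A" | "p \<in> A" "q \<in> B" | "p \<in> B" "q \<in> A" | "p \<in> B" "q \<in> B" using pq by blast
      then show ?thesis
        unfolding P s is_transposition_between_swp[OF pq(3)]
        by cases (simp_all add: d d' wgt_def power2_eq_square)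
    qed
    ultimately show ?thesis by simp
  next
    case False
    then have n: "\<not> is_transposition_between X Y s" if "X \<subseteq> ?I" "Y \<subseteq> ?I" for X Y
      using is_transposition_betweenE[of X Y s ?I] that by blast
    have "(\<Sum>(i, j)\<in>offdiag ?I. if s = swp i j then wgt i * wgt j / tot\<^sup>2 else 0) = 0"
      using False by (intro sum.neutral) auto
    then show ?thesis unfolding P S using n[of A A] n[of B B] n[of A B] by simp
  qed
qed

abbreviation (input) "step \<equiv> walk hold ((a\<^sup>2 - a * b) / tot\<^sup>2) ((b\<^sup>2 - a * b) / tot\<^sup>2) (a * b / tot\<^sup>2) A B"

text \<open>For any two cards, \<open>wgt i * wgt j\<close> is \<open>a * b\<close>, corrected by
  \<open>a\<^sup>2 - a * b\<close> when both lie in \<open>A\<close> and by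
  \<open>b\<^sup>2 - a * b\<close> when both lie in \<open>B\<close>; this is the origin of the
  coefficients in the eigenvalues. Their factor \<open>2\<close> comes from \<open>trans_sum\<close>
  running over ordered pairs.\<close>

lemma sum_wgt_eq_step:
  "(\<Sum>(i, j)\<in>(A \<union> B) \<times> (A \<union> B). wgt i * wgt j / tot\<^sup>2 * f (\<pi> \<circ> swp i j)) = step f \<pi>"
proof -
  let ?I = "A \<union> B"
  have I: "finite ?I" using A B by simp
  let ?f = "\<lambda>p. f (\<pi> \<circ> swp (fst p) (snd p))"
  have "(\<Sum>(i, j)\<in>?I \<times> ?I. wgt i * wgt j / tot\<^sup>2 * f (\<pi> \<circ> swp i j)) =
      (\<Sum>i\<in>?I. wgt i * wgt i / tot\<^sup>2) * f \<pi> + (\<Sum>p\<in>offdiag ?I. wgt (fst p) * wgt (snd p) / tot\<^sup>2 * ?f p)"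
    by (subst sum_diag_offdiag[OF I]) (simp add: case_prod_unfold sum_distrib_right)
  also have "(\<Sum>p\<in>offdiag ?I. wgt (fst p) * wgt (snd p) / tot\<^sup>2 * ?f p) =
      (\<Sum>p\<in>offdiag ?I. (a\<^sup>2 - a * b) / tot\<^sup>2 * (if fst p \<in> A \<and> snd p \<in> A then ?f p else 0)
        + (b\<^sup>2 - a * b) / tot\<^sup>2 * (if fst p \<in> B \<and> snd p \<in> B then ?f p else 0) + a * b / tot\<^sup>2 * ?f p)"
  proof (rule sum.cong[OF refl])
    fix p assume "p \<in> offdiag ?I"
    then have p: "fst p \<in> A \<or> fst p \<in> B" "snd p \<in> A \<or> snd p \<in> B" by (auto simp: offdiag_def)
    have d: "i \<notin> B" if "i \<in> A" for i using AB that by blast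
    show "wgt (fst p) * wgt (snd p) / tot\<^sup>2 * ?f p = (a\<^sup>2 - a * b) / tot\<^sup>2 * (if fst p \<in> A \<and> snd p \<in> A then ?f p else 0)
        + (b\<^sup>2 - a * b) / tot\<^sup>2 * (if fst p \<in> B \<and> snd p \<in> B then ?f p else 0) + a * b / tot\<^sup>2 * ?f p"
    proof -
      have d': "i \<notin> A" if "i \<in> B" for i using AB that by blast
      consider "fst p \<in> A" "snd p \<in> A" | "fst p \<in> A" "snd p \<in> B" | "fst p \<in> B" "snd p \<in> A" | "fst p \<in> B" "snd p \<in> B"
        using p by blast
      then show ?thesis
        by cases (simp_all add: d d' wgt_def power2_eq_square diff_divide_distrib left_diff_distrib mult.commute[of b a])
    qed
  qed
  also have "\<dots> = (a\<^sup>2 - a * b) / tot\<^sup>2 * (\<Sum>p\<in>offdiag ?I. if fst p \<in> A \<and> snd p \<in> A then ?f p else 0)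
      + (b\<^sup>2 - a * b) / tot\<^sup>2 * (\<Sum>p\<in>offdiag ?I. if fst p \<in> B \<and> snd p \<in> B then ?f p else 0)
      + a * b / tot\<^sup>2 * (\<Sum>p\<in>offdiag ?I. ?f p)"
    by (simp only: sum.distrib sum_distrib_left)
  also have "\<dots> = (a\<^sup>2 - a * b) / tot\<^sup>2 * trans_sum A f \<pi> + (b\<^sup>2 - a * b) / tot\<^sup>2 * trans_sum B f \<pi>
      + a * b / tot\<^sup>2 * trans_sum ?I f \<pi>"
    using sum_offdiag_restrict[OF I, of A ?f] sum_offdiag_restrict[OF I, of B ?f]
    by (simp add: trans_sum_def case_prod_unfold)
  finally show ?thesis unfolding walk_def sum_wgt_squares add.assoc .
qed

section \<open>Powers of the transition matrix and their traces\<close>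

context
  fixes ps :: "(nat \<Rightarrow> nat) list"
  assumes ps: "distinct ps" "set ps = {p. p permutes A \<union> B}"
begin

abbreviation (input) "M \<equiv> shuffle_matrix A B a b ps"

lemma M_carrier: "M \<in> carrier_mat (length ps) (length ps)"
  by (simp add: shuffle_matrix_def)

lemma nth_permutes: "r < length ps \<Longrightarrow> ps ! r permutes A \<union> B"
  using ps(2) nth_mem by blast

text \<open>A step multiplies the state \<open>x\<close> by a transposition on the left, hence
  \<open>y \<circ> inv x\<close> on the right. So the entry is a function of
  \<open>y \<circ> inv x\<close> alone, which evolves under \<open>step\<close>; expanding the power
  from the left keeps \<open>y\<close> fixed.\<close>

lemma matrix_power_entry:
  assumes "r < length ps" "s < length ps"
  shows "(M ^\<^sub>m k) $$ (r, s) = (step ^^ k) delta_id (ps ! s \<circ> inv (ps ! r))"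
  using assms
proof (induction k arbitrary: r s)
  case 0
  let ?x = "ps ! r" and ?y = "ps ! s"
  have "?y \<circ> inv ?x = id \<longleftrightarrow> r = s"
  proof
    assume "?y \<circ> inv ?x = id"
    then have "?y \<circ> (inv ?x \<circ> ?x) = ?x" by (simp only: comp_assoc[symmetric] id_comp)
    then have "?y = ?x" using permutes_inv_o(2)[OF nth_permutes[OF 0(1)]] by (simp only: comp_id)
    then show "r = s" using ps(1) 0 by (simp add: nth_eq_iff_index_eq)
  qed (use permutes_inv_o(1)[OF nth_permutes[OF 0(1)]] in simp)
  moreover have "(M ^\<^sub>m 0) $$ (r, s) = (if r = s then 1 else 0)" using 0 M_carrier by simp
  ultimately show ?case by (simp only: funpow.simps id_apply delta_id_def)
next
  case (Suc k)
  let ?x = "ps ! r" and ?y = "ps ! s" and ?I = "A \<union> B"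
  let ?F = "(step ^^ k) delta_id"
  let ?Perm = "{p. p permutes ?I}"
  have x: "?x permutes ?I" by (rule nth_permutes[OF Suc.prems(1)])
  have bij: "bij_betw (\<lambda>t. ps ! t) {..<length ps} ?Perm"
    using ps by (intro bij_betw_nth) simp_all
  have Mk: "M ^\<^sub>m k \<in> carrier_mat (length ps) (length ps)" using M_carrier by simp
  have "(M ^\<^sub>m Suc k) $$ (r, s) = (\<Sum>t<length ps. M $$ (r, t) * (M ^\<^sub>m k) $$ (t, s))"
    unfolding pow_mat_Suc_left[OF M_carrier] using M_carrier Mk Suc.prems
    by (simp add: scalar_prod_def atLeast0LessThan)
  also have "\<dots> = (\<Sum>t<length ps. shuffle_prob A B a b ?x (ps ! t) * ?F (?y \<circ> inv (ps ! t)))"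
  proof (rule sum.cong[OF refl])
    fix t assume "t \<in> {..<length ps}"
    then have t: "t < length ps" by simp
    have "M $$ (r, t) = shuffle_prob A B a b ?x (ps ! t)"
      using t Suc.prems(1) by (simp add: shuffle_matrix_def)
    then show "M $$ (r, t) * (M ^\<^sub>m k) $$ (t, s) = shuffle_prob A B a b ?x (ps ! t) * ?F (?y \<circ> inv (ps ! t))"
      by (simp only: Suc.IH[OF t Suc.prems(2)])
  qed
  also have "\<dots> = (\<Sum>z\<in>?Perm. shuffle_prob A B a b ?x z * ?F (?y \<circ> inv z))"
    by (rule sum.reindex_bij_betw[OF bij])
  also have "\<dots> = (\<Sum>z\<in>?Perm. \<Sum>p\<in>?I \<times> ?I. if z = swp (fst p) (snd p) \<circ> ?x then wgt (fst p) * wgt (snd p) / tot\<^sup>2 * ?F (?y \<circ> inv z) else 0)"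
  proof (rule sum.cong[OF refl])
    fix z assume "z \<in> ?Perm"
    then have "shuffle_prob A B a b ?x z = (\<Sum>p\<in>?I \<times> ?I. if z = swp (fst p) (snd p) \<circ> ?x then wgt (fst p) * wgt (snd p) / tot\<^sup>2 else 0)"
      using shuffle_prob_eq_sum[OF x, of z] by (simp add: case_prod_unfold)
    then have "shuffle_prob A B a b ?x z * ?F (?y \<circ> inv z) =
        (\<Sum>p\<in>?I \<times> ?I. (if z = swp (fst p) (snd p) \<circ> ?x then wgt (fst p) * wgt (snd p) / tot\<^sup>2 else 0) * ?F (?y \<circ> inv z))"
      by (simp only: sum_distrib_right)
    also have "\<dots> = (\<Sum>p\<in>?I \<times> ?I. if z = swp (fst p) (snd p) \<circ> ?x then wgt (fst p) * wgt (snd p) / tot\<^sup>2 * ?F (?y \<circ> inv z) else 0)"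
      by (rule sum.cong[OF refl]) (simp only: split: if_split, simp)
    finally show "shuffle_prob A B a b ?x z * ?F (?y \<circ> inv z) =
        (\<Sum>p\<in>?I \<times> ?I. if z = swp (fst p) (snd p) \<circ> ?x then wgt (fst p) * wgt (snd p) / tot\<^sup>2 * ?F (?y \<circ> inv z) else 0)" .
  qed
  also have "\<dots> = (\<Sum>p\<in>?I \<times> ?I. \<Sum>z\<in>?Perm. if z = swp (fst p) (snd p) \<circ> ?x then wgt (fst p) * wgt (snd p) / tot\<^sup>2 * ?F (?y \<circ> inv z) else 0)"
    by (rule sum.swap)
  also have "\<dots> = (\<Sum>p\<in>?I \<times> ?I. wgt (fst p) * wgt (snd p) / tot\<^sup>2 * ?F (?y \<circ> inv ?x \<circ> swp (fst p) (snd p)))"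
  proof (rule sum.cong[OF refl])
    fix p assume "p \<in> ?I \<times> ?I"
    then have t: "swp (fst p) (snd p) permutes ?I" by (intro permutes_swap_id) auto
    have tx: "swp (fst p) (snd p) \<circ> ?x \<in> ?Perm" using permutes_compose[OF x t] by simp
    have "inv (swp (fst p) (snd p) \<circ> ?x) = inv ?x \<circ> swp (fst p) (snd p)"
      using o_inv_distrib[OF permutes_bij[OF t] permutes_bij[OF x]] by simp
    moreover have "finite ?Perm" using A B by (intro finite_permutations) simp
    ultimately show "(\<Sum>z\<in>?Perm. if z = swp (fst p) (snd p) \<circ> ?x then wgt (fst p) * wgt (snd p) / tot\<^sup>2 * ?F (?y \<circ> inv z) else 0) =
        wgt (fst p) * wgt (snd p) / tot\<^sup>2 * ?F (?y \<circ> inv ?x \<circ> swp (fst p) (snd p))"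
      using tx by (simp only: sum.delta if_True comp_assoc)
  qed
  also have "\<dots> = step ?F (?y \<circ> inv ?x)"
    unfolding sum_wgt_eq_step[symmetric] by (simp only: case_prod_unfold)
  finally show ?case unfolding funpow.simps comp_apply[of step] .
qed

text \<open>The indicator of the identity is the regular character divided by \<open>n!\<close>, and
  linearity of the walk carries this expansion through all powers.\<close>

lemma step_pow_delta:
  assumes n: "card A + card B = n" and "\<pi> permutes A \<union> B"
  shows "(step ^^ k) delta_id \<pi> = (\<Sum>l\<in>Par n n. real (paths n n l) / fact n * (step ^^ k) (\<lambda>s. chi n (A \<union> B) s l) \<pi>)"
  using assms(2)
proof (induction k arbitrary: \<pi>)
  case 0
  have "card (A \<union> B) = n" using card_Un_disjoint[OF A B AB] n by simp
  then have "(\<Sum>l\<in>Par n n. real (paths n n l) * chi n (A \<union> B) \<pi> l) = (if \<pi> = id then fact n else 0)"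
    using A B 0 by (intro regular_character) simp_all
  then have "(\<Sum>l\<in>Par n n. real (paths n n l) * chi n (A \<union> B) \<pi> l) / fact n = delta_id \<pi>"
    by (simp add: delta_id_def)
  then show ?case by (simp add: sum_divide_distrib)
next
  case (Suc k)
  have "step ((step ^^ k) delta_id) \<pi> = step (\<lambda>\<pi>. \<Sum>l\<in>Par n n. real (paths n n l) / fact n * (step ^^ k) (\<lambda>s. chi n (A \<union> B) s l) \<pi>) \<pi>"
    by (rule walk_cong[OF Suc.IH Suc.prems])
  then show ?case unfolding walk_linear by (simp only: funpow.simps comp_apply)
qed

text \<open>All diagonal entries equal the value at the identity, and there are \<open>n!\<close> of
  them, which removes the denominator; at the identity the characters become numbers of paths. Here
  \<open>n\<close> is the number of all cards and also the number of variables.\<close>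

lemma trace_matrix_power:
  assumes n: "card A + card B = n"
  shows "(\<Sum>r<length ps. (M ^\<^sub>m k) $$ (r, r)) =
    (\<Sum>l\<in>Par n n. \<Sum>\<mu>\<in>Par n (card A). \<Sum>\<nu>\<in>Par n (card B).
       real (paths n n l * paths n (card A) \<mu> * paths n (card B) \<nu> * lr_number n l \<mu> \<nu>) *
       (hold + 2 * ((a\<^sup>2 - a * b) / tot\<^sup>2) * content n \<mu> + 2 * ((b\<^sup>2 - a * b) / tot\<^sup>2) * content n \<nu>
         + 2 * (a * b / tot\<^sup>2) * content n l) ^ k)"
proof -
  let ?e = "\<lambda>l \<mu> \<nu>. hold + 2 * ((a\<^sup>2 - a * b) / tot\<^sup>2) * content n \<mu> + 2 * ((b\<^sup>2 - a * b) / tot\<^sup>2) * content n \<nu>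
         + 2 * (a * b / tot\<^sup>2) * content n l"
  have cI: "card (A \<union> B) = n" using card_Un_disjoint[OF A B AB] n by simp
  have "length ps = card {p. p permutes A \<union> B}" using ps distinct_card[of ps] by simp
  also have "\<dots> = fact n" using card_permutations[OF cI] A B by simp
  finally have len: "real (length ps) = fact n" by simp
  have "(\<Sum>r<length ps. (M ^\<^sub>m k) $$ (r, r)) = (\<Sum>r<length ps. (step ^^ k) delta_id id)"
  proof (rule sum.cong[OF refl])
    fix r assume "r \<in> {..<length ps}"
    then have r: "r < length ps" by simp
    show "(M ^\<^sub>m k) $$ (r, r) = (step ^^ k) delta_id id"
      unfolding matrix_power_entry[OF r r] permutes_inv_o(1)[OF nth_permutes[OF r]] ..
  qed
  also have "\<dots> = fact n * (step ^^ k) delta_id id" using len by simp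
  also have "\<dots> = (\<Sum>l\<in>Par n n. real (paths n n l) * (step ^^ k) (\<lambda>s. chi n (A \<union> B) s l) id)"
    unfolding step_pow_delta[OF n permutes_id] by (simp add: sum_distrib_left)
  also have "\<dots> = (\<Sum>l\<in>Par n n. \<Sum>\<mu>\<in>Par n (card A). \<Sum>\<nu>\<in>Par n (card B).
       real (paths n n l * paths n (card A) \<mu> * paths n (card B) \<nu> * lr_number n l \<mu> \<nu>) * ?e l \<mu> \<nu> ^ k)"
  proof (rule sum.cong[OF refl])
    fix l assume "l \<in> Par n n"
    then have l: "l \<in> Par n (card A + card B)" using n by simp
    have "(step ^^ k) (\<lambda>s. chi n (A \<union> B) s l) (id \<circ> id) =
        (\<Sum>\<mu>\<in>Par n (card A). \<Sum>\<nu>\<in>Par n (card B). real (lr_number n l \<mu> \<nu>) * ?e l \<mu> \<nu> ^ k * chi n A id \<mu> * chi n B id \<nu>)"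
      unfolding walk_pow_product[OF A B AB l permutes_id permutes_id] eigval_def[OF A B AB l] ..
    also have "\<dots> = (\<Sum>\<mu>\<in>Par n (card A). \<Sum>\<nu>\<in>Par n (card B).
        real (lr_number n l \<mu> \<nu>) * ?e l \<mu> \<nu> ^ k * real (paths n (card A) \<mu>) * real (paths n (card B) \<nu>))"
      by (intro sum.cong refl) (simp only: chi_id[OF A] chi_id[OF B])
    finally show "real (paths n n l) * (step ^^ k) (\<lambda>s. chi n (A \<union> B) s l) id =
        (\<Sum>\<mu>\<in>Par n (card A). \<Sum>\<nu>\<in>Par n (card B).
          real (paths n n l * paths n (card A) \<mu> * paths n (card B) \<nu> * lr_number n l \<mu> \<nu>) * ?e l \<mu> \<nu> ^ k)"
      by (simp add: sum_distrib_left mult_ac)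
  qed
  finally show ?thesis .
qed

end

end

lemma power_sum_replicate_mset:
  fixes e :: "'a \<Rightarrow> complex"
  shows "(\<Sum>z\<in>#(\<Sum>t\<in>T. replicate_mset (n t) (e t)). z ^ k) = (\<Sum>t\<in>T. of_nat (n t) * e t ^ k)"
  by (induction T rule: infinite_finite_induct) simp_all

theorem theorem1p2:
  fixes n N :: nat and A B :: "nat set" and a b :: real and ps :: "(nat \<Rightarrow> nat) list"
  assumes "0 < n" and "N = 2 * n"
    and "A \<union> B = {1..N}" and "A \<inter> B = {}" and "card A = n" and "card B = n"
    and "0 < b" and "b \<le> a" and "a + b = 2"
    and "distinct ps" and "set ps = {p. p permutes {1..N}}"
  shows "eigenvalue_mset (shuffle_matrix A B a b ps) =
    (\<Sum>(la, \<mu>, \<nu>) \<in> partitions_of N \<times> partitions_of (card A) \<times> partitions_of (card B).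
       replicate_mset (num_SYT la * num_SYT \<mu> * num_SYT \<nu> * LR_coeff la \<mu> \<nu>)
         (complex_of_real
           ((a\<^sup>2 * real (card A) + b\<^sup>2 * real (card B)) / (real N)\<^sup>2
            + 2 * (a\<^sup>2 - a * b) / (real N)\<^sup>2 * of_int (Diag \<mu>)
            + 2 * (b\<^sup>2 - a * b) / (real N)\<^sup>2 * of_int (Diag \<nu>)
            + 2 * a * b / (real N)\<^sup>2 * of_int (Diag la))))"
proof (rule multiset_eq_if_power_sums_eq)
  fix k
  have fin: "finite (A \<union> B)" unfolding assms(3) by simp
  then have A: "finite A" and B: "finite B" by auto
  note AB = assms(4)
  have N: "card A + card B = N" using assms by simp
  have ps: "distinct ps" "set ps = {p. p permutes A \<union> B}" using assms(3,10,11) by simp_all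
  let ?la = "partitions_of N" and ?mu = "partitions_of (card A)" and ?nu = "partitions_of (card B)"
  have tot: "tot A B = real N" unfolding tot_def[OF A B AB] N ..
  let ?e = "\<lambda>l \<mu> \<nu>. hold A B a b + 2 * ((a\<^sup>2 - a * b) / (real N)\<^sup>2) * content N \<mu> + 2 * ((b\<^sup>2 - a * b) / (real N)\<^sup>2) * content N \<nu>
         + 2 * (a * b / (real N)\<^sup>2) * content N l"
  let ?c = "\<lambda>l \<mu> \<nu>. real (paths N N l * paths N (card A) \<mu> * paths N (card B) \<nu> * lr_number N l \<mu> \<nu>)"
  let ?E = "\<lambda>la \<mu> \<nu>. (a\<^sup>2 * real (card A) + b\<^sup>2 * real (card B)) / (real N)\<^sup>2
            + 2 * (a\<^sup>2 - a * b) / (real N)\<^sup>2 * of_int (Diag \<mu>)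
            + 2 * (b\<^sup>2 - a * b) / (real N)\<^sup>2 * of_int (Diag \<nu>)
            + 2 * a * b / (real N)\<^sup>2 * of_int (Diag la)"
  let ?C = "\<lambda>la \<mu> \<nu>. num_SYT la * num_SYT \<mu> * num_SYT \<nu> * LR_coeff la \<mu> \<nu>"
  have "(\<Sum>z\<in>#eigenvalue_mset (shuffle_matrix A B a b ps). z ^ k) =
      of_real (\<Sum>r<length ps. (shuffle_matrix A B a b ps ^\<^sub>m k) $$ (r, r))"
    by (rule eigenvalue_mset_power_sum[OF M_carrier[OF A B AB ps]])
  also have "(\<Sum>r<length ps. (shuffle_matrix A B a b ps ^\<^sub>m k) $$ (r, r)) =
      (\<Sum>l\<in>Par N N. \<Sum>\<mu>\<in>Par N (card A). \<Sum>\<nu>\<in>Par N (card B). ?c l \<mu> \<nu> * ?e l \<mu> \<nu> ^ k)"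
    unfolding trace_matrix_power[OF A B AB ps N] tot ..
  also have "\<dots> = (\<Sum>la\<in>?la. \<Sum>\<mu>\<in>?mu. \<Sum>\<nu>\<in>?nu. ?c (part la) (part \<mu>) (part \<nu>) * ?e (part la) (part \<mu>) (part \<nu>) ^ k)"
  proof -
    \<comment> \<open>With \<open>N\<close> variables, \<open>Par N i\<close> stands for all
      partitions of \<open>i\<close> for each of the three sizes.\<close>
    have s: "(\<Sum>l\<in>Par N i. g l) = (\<Sum>la\<in>partitions_of i. g (part la))" if "i \<le> N" for i and g :: "(nat \<Rightarrow> nat) \<Rightarrow> real"
      by (rule sum.reindex_bij_betw[OF bij_betw_part[OF that], symmetric])
    show ?thesis using N by (simp only: s[of N] s[of "card A"] s[of "card B"] le_add1 le_add2 order_refl)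
  qed
  also have "\<dots> = (\<Sum>la\<in>?la. \<Sum>\<mu>\<in>?mu. \<Sum>\<nu>\<in>?nu. real (?C la \<mu> \<nu>) * ?E la \<mu> \<nu> ^ k)"
  proof (intro sum.cong refl)
    fix la \<mu> \<nu> assume la: "la \<in> ?la" and \<mu>: "\<mu> \<in> ?mu" and \<nu>: "\<nu> \<in> ?nu"
    have le: "card A \<le> N" "card B \<le> N" using N by auto
    have la': "la \<in> partitions_of (card A + card B)" using la N by simp
    have "?c (part la) (part \<mu>) (part \<nu>) = real (?C la \<mu> \<nu>)"
      using num_SYT_paths[OF la order_refl] num_SYT_paths[OF \<mu> le(1)] num_SYT_paths[OF \<nu> le(2)]
        LR_coeff_eq_lr_number[OF la' \<mu> \<nu>, of N] N by simp
    moreover have "?e (part la) (part \<mu>) (part \<nu>) = ?E la \<mu> \<nu>"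
      by (simp add: Diag_content[OF la order_refl] Diag_content[OF \<mu> le(1)] Diag_content[OF \<nu> le(2)]
        hold_def[OF A B AB] tot)
    ultimately show "?c (part la) (part \<mu>) (part \<nu>) * ?e (part la) (part \<mu>) (part \<nu>) ^ k = real (?C la \<mu> \<nu>) * ?E la \<mu> \<nu> ^ k"
      by simp
  qed
  also have "\<dots> = (\<Sum>(la, \<mu>, \<nu>) \<in> ?la \<times> ?mu \<times> ?nu. real (?C la \<mu> \<nu>) * ?E la \<mu> \<nu> ^ k)"
    by (simp only: sum.cartesian_product case_prod_unfold fst_conv snd_conv)
  also have "complex_of_real \<dots> = (\<Sum>t \<in> ?la \<times> ?mu \<times> ?nu. of_nat (case t of (la, \<mu>, \<nu>) \<Rightarrow> ?C la \<mu> \<nu>) *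
       (case t of (la, \<mu>, \<nu>) \<Rightarrow> complex_of_real (?E la \<mu> \<nu>)) ^ k)"
    unfolding of_real_sum by (intro sum.cong refl) (simp add: case_prod_unfold)
  also have "\<dots> = (\<Sum>z\<in>#(\<Sum>t \<in> ?la \<times> ?mu \<times> ?nu. replicate_mset (case t of (la, \<mu>, \<nu>) \<Rightarrow> ?C la \<mu> \<nu>) (case t of (la, \<mu>, \<nu>) \<Rightarrow> complex_of_real (?E la \<mu> \<nu>))). z ^ k)"
    by (rule power_sum_replicate_mset[symmetric])
  also have "(\<Sum>t \<in> ?la \<times> ?mu \<times> ?nu. replicate_mset (case t of (la, \<mu>, \<nu>) \<Rightarrow> ?C la \<mu> \<nu>) (case t of (la, \<mu>, \<nu>) \<Rightarrow> complex_of_real (?E la \<mu> \<nu>))) =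
      (\<Sum>(la, \<mu>, \<nu>) \<in> ?la \<times> ?mu \<times> ?nu. replicate_mset (?C la \<mu> \<nu>) (complex_of_real (?E la \<mu> \<nu>)))"
    by (intro sum.cong refl) (simp only: case_prod_unfold)
  finally show "(\<Sum>z\<in>#eigenvalue_mset (shuffle_matrix A B a b ps). z ^ k) =
    (\<Sum>z\<in>#(\<Sum>(la, \<mu>, \<nu>) \<in> ?la \<times> ?mu \<times> ?nu. replicate_mset (?C la \<mu> \<nu>) (complex_of_real (?E la \<mu> \<nu>))). z ^ k)" .
qed

end
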